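(* Let $\lambda$ be a dominant analytically integral weight of $G$ and consider the Toeplitz quantization map $T^\lambda:L^2(G/L)\to\mathrm{End}(\mathcal H_\lambda)$, $f\mapsto T^\lambda_f$. Then $\ker T^\lambda=(\mathcal K^\lambda)^\perp$ (orthogonal complement in $L^2(G/L)$). In particular, the restriction $T^\lambda:\mathcal K^\lambda\to\mathcal H_\lambda\otimes\overline{\mathcal H_\lambda}=\mathrm{End}(\mathcal H_\lambda)$ is a linear isomorphism.
   Context: $G$ is a compact connected Lie group with normalized Haar measure $dy$, with a fixed maximal torus and a fixed positive root system. $(\sigma^\lambda,\mathcal H_\lambda)$ is the irreducible unitary representation of $G$ with highest weight $\lambda$ (inner products linear in the first variable), $d_\lambda=\dim\mathcal H_\lambda$, $v_\lambda$ a unit highest-weight vector, and $L=\{g\in G:\sigma^\lambda(g)v_\lambda\in\mathbb C v_\lambda\}$. Functions on $G/L$ are identified with right-$L$-invariant functions on $G$. For $f\in L^1(G/L)$ the Toeplitz operator $T^\lambda_f\in\mathrm{End}(\mathcal H_\lambda)$ is given by $$\langle T^\lambda_f v,w\rangle=d_\lambda\int_G f(y)\langle v,\sigma^\lambda(y)v_\lambda\rangle\overline{\langle w,\sigma^\lambda(y)v_\lambda\rangle}\,dy .$$ $\overline{\sigma^\lambda}$ is the conjugate representation on $\overline{\mathcal H_\lambda}$; $\mathcal H_\lambda\otimes\overline{\mathcal H_\lambda}$ is identified with $\mathrm{End}(\mathcal H_\lambda)$ via $(v\otimes\overline w)(u)=\langle u,w\rangle v$. Write $\pi\preceq\sigma^\lambda\otimes\overline{\sigma^\lambda}$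 if the irreducible unitary representation $(\pi,\mathcal H_\pi)$ of $G$ occurs in $\sigma^\lambda\otimes\overline{\sigma^\lambda}$, with multiplicity $m(\pi,\sigma^\lambda\otimes\overline{\sigma^\lambda})$. Fix an orthogonal decomposition $\mathcal H_\lambda\otimes\overline{\mathcal H_\lambda}=\bigoplus_{\pi}(\mathcal H_\pi)^{\oplus m(\pi,\sigma^\lambda\otimes\overline{\sigma^\lambda})}$ into irreducibles (unitary identification), and let $(v_\lambda\otimes\overline{v_\lambda})^\pi_k\in\mathcal H_\pi$ be the component of $v_\lambda\otimes\overline{v_\lambda}$ in the $k$-th copy of $\mathcal H_\pi$; these components are $L$-fixed vectors. Put $$\mathcal K^\lambda_\pi=\mathrm{span}\{(v_\lambda\otimes\overline{v_\lambda})^\pi_k: 1\le k\le m(\pi,\sigma^\lambda\otimes\overline{\sigma^\lambda})\}\subseteq\mathcal H_\pi^L,$$ $$\mathcal K^\lambda=\mathrm{span}\{\pi_{u,v_0}:\pi\preceq\sigma^\lambda\otimes\overline{\sigma^\lambda},\ u\in\mathcal H_\pi,\ v_0\in\mathcal K^\lambda_\pi\}\subseteq L^2(G/L),$$ where $\pi_{u,v_0}(x)=\langle u,\pi(x)v_0\rangle$ and $\mathcal H_\pi^L$ is the space of $L$-fixed vectors. (These spaces do not depend on the chosen decomposition.) *)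

theory Defs
  imports
    "HOL-Probability.Probability"
    "HOL-Algebra.Group"
    "HOL-Library.Function_Algebras"
begin

section \<open>Complex inner product spaces\<close>

class scaleC =
  fixes scaleC :: "complex \<Rightarrow> 'a \<Rightarrow> 'a" (infixr "*\<^sub>C" 75)

class complex_vector = scaleC + ab_group_add +
  assumes scaleC_add_right: "a *\<^sub>C (x + y) = a *\<^sub>C x + a *\<^sub>C y"
    and scaleC_add_left: "(a + b) *\<^sub>C x = a *\<^sub>C x + b *\<^sub>C x"
    and scaleC_scaleC: "a *\<^sub>C b *\<^sub>C x = (a * b) *\<^sub>C x"
    and scaleC_one: "1 *\<^sub>C x = x"

global_interpretation complex_vector: vector_space "scaleC :: complex \<Rightarrow> 'a \<Rightarrow> 'a::complex_vector"
  defines cspan = complex_vector.span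
    and csubspace = complex_vector.subspace
    and cdim = complex_vector.dim
  by unfold_locales
    (simp_all add: scaleC_add_right scaleC_add_left scaleC_scaleC scaleC_one)

text \<open>
  The underlying real inner product is the real part of the Hermitian one; in this way the norm,
  the topology, limits and derivatives are those of the library.
\<close>

class complex_inner = complex_vector + real_inner +
  fixes cinner :: "'a \<Rightarrow> 'a \<Rightarrow> complex"
  assumes scaleR_scaleC: "r *\<^sub>R x = complex_of_real r *\<^sub>C x"
    and cinner_commute: "cinner x y = cnj (cinner y x)"
    and cinner_add_left: "cinner (x + y) z = cinner x z + cinner y z"
    and cinner_scaleC_left: "cinner (c *\<^sub>C x) y = c * cinner x y"
    and inner_eq_Re_cinner: "inner x y = Re (cinner x y)"

instantiation complex :: complex_inner
begin
definition scaleC_complex :: "complex \<Rightarrow> complex \<Rightarrow> complex" where "scaleC_complex c x = c * x"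
definition cinner_complex :: "complex \<Rightarrow> complex \<Rightarrow> complex" where "cinner_complex x y = x * cnj y"
instance
  by standard
    (simp_all add: scaleC_complex_def cinner_complex_def algebra_simps scaleR_conv_of_real
      inner_complex_def)
end

instantiation vec :: (complex_inner, finite) complex_inner
begin
definition scaleC_vec :: "complex \<Rightarrow> ('a, 'b) vec \<Rightarrow> ('a, 'b) vec"
  where "scaleC_vec c x = (\<chi> i. c *\<^sub>C x $ i)"
definition cinner_vec :: "('a, 'b) vec \<Rightarrow> ('a, 'b) vec \<Rightarrow> complex"
  where "cinner_vec x y = (\<Sum>i\<in>UNIV. cinner (x $ i) (y $ i))"
instance
proof
  fix x y z :: "('a, 'b) vec" and c :: complex
  show "cinner x y = cnj (cinner y x)"
    by (simp add: cinner_vec_def cinner_commute[symmetric])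
qed (simp_all add: scaleC_vec_def cinner_vec_def vec_eq_iff scaleC_add_right scaleC_add_left
      scaleC_scaleC scaleC_one scaleR_scaleC cinner_add_left cinner_scaleC_left sum.distrib
      sum_distrib_left inner_vec_def inner_eq_Re_cinner)
end

instantiation "fun" :: (type, complex_vector) complex_vector
begin
definition scaleC_fun :: "complex \<Rightarrow> ('a \<Rightarrow> 'b) \<Rightarrow> 'a \<Rightarrow> 'b" where "scaleC_fun c f = (\<lambda>x. c *\<^sub>C f x)"
instance
  by standard
    (simp_all add: scaleC_fun_def fun_eq_iff scaleC_add_right scaleC_add_left scaleC_scaleC
      scaleC_one)
end

definition clinear_on :: "'a::complex_vector set \<Rightarrow> ('a \<Rightarrow> 'b::complex_vector) \<Rightarrow> bool" where
  "clinear_on W f \<longleftrightarrow>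
     (\<forall>u\<in>W. \<forall>v\<in>W. f (u + v) = f u + f v) \<and> (\<forall>c. \<forall>u\<in>W. f (c *\<^sub>C u) = c *\<^sub>C f u)"

definition endomorphisms :: "('h::complex_vector \<Rightarrow> 'h) set" where
  "endomorphisms = {A. clinear_on UNIV A}"

section \<open>Lie groups\<close>

text \<open>
  \<open>C_on k V S f\<close>: the map \<open>f\<close> is \<open>k\<close> times continuously differentiable on the relatively open subset
  \<open>S\<close> of the linear subspace \<open>V\<close>.  Only the restriction to \<open>V\<close> of the derivative \<open>D x\<close> is determined
  by \<open>f\<close>, hence the restriction to directions in \<open>V\<close>.
\<close>

primrec C_on :: "nat \<Rightarrow> 'a::real_normed_vector set \<Rightarrow> 'a set \<Rightarrow> ('a \<Rightarrow> 'b::real_normed_vector) \<Rightarrow> bool"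
  where
    "C_on 0 V S f \<longleftrightarrow> continuous_on S f"
  | "C_on (Suc k) V S f \<longleftrightarrow>
       (\<exists>D. (\<forall>x\<in>S. (f has_derivative D x) (at x within S)) \<and> (\<forall>v\<in>V. C_on k V S (\<lambda>x. D x v)))"

definition smooth_on :: "'a::real_normed_vector set \<Rightarrow> 'a set \<Rightarrow> ('a \<Rightarrow> 'b::real_normed_vector) \<Rightarrow> bool"
  where "smooth_on V S f \<longleftrightarrow> (\<forall>k. C_on k V S f)"

text \<open>
  The charts take values in a linear subspace \<open>model\<close> of a Euclidean space, not in the whole type,
  because every type of class \<open>euclidean_space\<close> has positive dimension and the trivial group
  has to be covered.
\<close>

record ('g, 'e) lie_group_data = "'g monoid" +
  model :: "'e set"
  charts :: "('g set \<times> ('g \<Rightarrow> 'e)) set"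

definition is_chart ::
  "('g::topological_space, 'e::euclidean_space) lie_group_data \<Rightarrow> 'g set \<Rightarrow> ('g \<Rightarrow> 'e) \<Rightarrow> bool" where
  "is_chart G U \<phi> \<longleftrightarrow>
     open U \<and> openin (top_of_set (model G)) (\<phi> ` U) \<and> homeomorphism U (\<phi> ` U) \<phi> (inv_into U \<phi>)"

definition lie_group ::
  "('g::{t2_space, second_countable_topology}, 'e::euclidean_space) lie_group_data \<Rightarrow> bool" where
  "lie_group G \<longleftrightarrow>
     group G \<and> carrier G = UNIV \<and> subspace (model G) \<and>
     (\<forall>(U, \<phi>)\<in>charts G. is_chart G U \<phi>) \<and> \<Union> (fst ` charts G) = UNIV \<and>
     (\<forall>(U, \<phi>)\<in>charts G. \<forall>(U', \<psi>)\<in>charts G.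
        smooth_on (model G) (\<phi> ` (U \<inter> U')) (\<lambda>x. \<psi> (inv_into U \<phi> x))) \<and>
     continuous_on UNIV (\<lambda>(x, y). x \<otimes>\<^bsub>G\<^esub> y) \<and>
     (\<forall>(U, \<phi>)\<in>charts G. \<forall>(U', \<phi>')\<in>charts G. \<forall>(U'', \<psi>)\<in>charts G.
        smooth_on (model G \<times> model G)
          {(x, y). x \<in> \<phi> ` U \<and> y \<in> \<phi>' ` U' \<and> inv_into U \<phi> x \<otimes>\<^bsub>G\<^esub> inv_into U' \<phi>' y \<in> U''}
          (\<lambda>(x, y). \<psi> (inv_into U \<phi> x \<otimes>\<^bsub>G\<^esub> inv_into U' \<phi>' y))) \<and>
     continuous_on UNIV (\<lambda>x. inv\<^bsub>G\<^esub> x) \<and>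
     (\<forall>(U, \<phi>)\<in>charts G. \<forall>(U', \<psi>)\<in>charts G.
        smooth_on (model G) {x \<in> \<phi> ` U. inv\<^bsub>G\<^esub> (inv_into U \<phi> x) \<in> U'}
          (\<lambda>x. \<psi> (inv\<^bsub>G\<^esub> (inv_into U \<phi> x))))"

definition compact_connected_lie_group ::
  "('g::{t2_space, second_countable_topology}, 'e::euclidean_space) lie_group_data \<Rightarrow> bool" where
  "compact_connected_lie_group G \<longleftrightarrow>
     lie_group G \<and> compact (UNIV :: 'g set) \<and> connected (UNIV :: 'g set)"

definition normalized_haar ::
  "('g::topological_space, 'e) lie_group_data \<Rightarrow> 'g measure \<Rightarrow> bool" where
  "normalized_haar G M \<longleftrightarrow>
     prob_space M \<and> sets M = sets borel \<and> (\<forall>g. distr M M (\<lambda>x. g \<otimes>\<^bsub>G\<^esub> x) = M)"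

text \<open>
  The Lie algebra is the tangent space at the identity, read in a fixed chart around the identity;
  as a vector space it is \<open>model G\<close>.
\<close>

definition base_chart :: "('g, 'e) lie_group_data \<Rightarrow> 'g \<Rightarrow> 'e" where
  "base_chart G = (SOME \<phi>. \<exists>U. (U, \<phi>) \<in> charts G \<and> \<one>\<^bsub>G\<^esub> \<in> U)"

definition one_parameter_subgroup ::
  "('g::topological_space, 'e::euclidean_space) lie_group_data \<Rightarrow> 'e \<Rightarrow> (real \<Rightarrow> 'g) \<Rightarrow> bool" where
  "one_parameter_subgroup G X \<gamma> \<longleftrightarrow>
     continuous_on UNIV \<gamma> \<and> (\<forall>s t. \<gamma> (s + t) = \<gamma> s \<otimes>\<^bsub>G\<^esub> \<gamma> t) \<and>
     ((\<lambda>s. base_chart G (\<gamma> s)) has_vector_derivative X) (at 0)"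

definition lie_exp :: "('g::topological_space, 'e::euclidean_space) lie_group_data \<Rightarrow> 'e \<Rightarrow> 'g" where
  "lie_exp G X = (THE \<gamma>. one_parameter_subgroup G X \<gamma>) 1"

definition Ad :: "('g::topological_space, 'e::euclidean_space) lie_group_data \<Rightarrow> 'g \<Rightarrow> 'e \<Rightarrow> 'e" where
  "Ad G g X =
     vector_derivative (\<lambda>s. base_chart G (g \<otimes>\<^bsub>G\<^esub> lie_exp G (s *\<^sub>R X) \<otimes>\<^bsub>G\<^esub> inv\<^bsub>G\<^esub> g)) (at 0)"

section \<open>Maximal tori, roots and weights\<close>

text \<open>In a compact Lie group the tori are exactly the closed connected abelian subgroups.\<close>

definition torus :: "('g::topological_space, 'e) lie_group_data \<Rightarrow> 'g set \<Rightarrow> bool" where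
  "torus G T \<longleftrightarrow>
     subgroup T G \<and> closed T \<and> connected T \<and> (\<forall>x\<in>T. \<forall>y\<in>T. x \<otimes>\<^bsub>G\<^esub> y = y \<otimes>\<^bsub>G\<^esub> x)"

definition maximal_torus :: "('g::topological_space, 'e) lie_group_data \<Rightarrow> 'g set \<Rightarrow> bool" where
  "maximal_torus G T \<longleftrightarrow> torus G T \<and> (\<forall>T'. torus G T' \<and> T \<subseteq> T' \<longrightarrow> T' = T)"

definition torus_algebra ::
  "('g::topological_space, 'e::euclidean_space) lie_group_data \<Rightarrow> 'g set \<Rightarrow> 'e set" where
  "torus_algebra G T = {X \<in> model G. \<forall>s. lie_exp G (s *\<^sub>R X) \<in> T}"

text \<open>
  Roots and weights take imaginary values on the Lie algebra \<open>\<tt>\<close> of \<open>T\<close>; such a functional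
  \<open>\<i> \<alpha>\<close> is represented by the real functional \<open>\<alpha>\<close>, extended by zero outside of \<open>\<tt>\<close>.
\<close>

definition real_functionals ::
  "('g::topological_space, 'e::euclidean_space) lie_group_data \<Rightarrow> 'g set \<Rightarrow> ('e \<Rightarrow> real) set" where
  "real_functionals G T =
     {\<alpha>. (\<forall>X\<in>torus_algebra G T. \<forall>Y\<in>torus_algebra G T. \<alpha> (X + Y) = \<alpha> X + \<alpha> Y) \<and>
         (\<forall>c. \<forall>X\<in>torus_algebra G T. \<alpha> (c *\<^sub>R X) = c * \<alpha> X) \<and>
         (\<forall>X. X \<notin> torus_algebra G T \<longrightarrow> \<alpha> X = 0)}"

text \<open>
  The pair \<open>(X, Y)\<close> stands for the element \<open>X + \<i> Y\<close> of the complexified Lie algebra.  The two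
  equations are the real and imaginary part of
  \<open>Ad (exp H) (X + \<i> Y) = exp (\<i> \<alpha>(H)) (X + \<i> Y)\<close>.
\<close>

definition root_space ::
  "('g::topological_space, 'e::euclidean_space) lie_group_data \<Rightarrow> 'g set \<Rightarrow> ('e \<Rightarrow> real) \<Rightarrow> ('e \<times> 'e) set"
  where
  "root_space G T \<alpha> =
     {(X, Y). X \<in> model G \<and> Y \<in> model G \<and>
        (\<forall>H\<in>torus_algebra G T.
           Ad G (lie_exp G H) X = cos (\<alpha> H) *\<^sub>R X - sin (\<alpha> H) *\<^sub>R Y \<and>
           Ad G (lie_exp G H) Y = sin (\<alpha> H) *\<^sub>R X + cos (\<alpha> H) *\<^sub>R Y)}"

definition roots ::
  "('g::topological_space, 'e::euclidean_space) lie_group_data \<Rightarrow> 'g set \<Rightarrow> ('e \<Rightarrow> real) set" where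
  "roots G T = {\<alpha> \<in> real_functionals G T. \<alpha> \<noteq> 0 \<and> root_space G T \<alpha> \<noteq> {(0, 0)}}"

definition positive_root_system ::
  "('g::topological_space, 'e::euclidean_space) lie_group_data \<Rightarrow> 'g set \<Rightarrow> ('e \<Rightarrow> real) set \<Rightarrow> bool"
  where
  "positive_root_system G T P \<longleftrightarrow>
     P \<subseteq> roots G T \<and> (\<forall>\<alpha>\<in>roots G T. \<alpha> \<in> P \<longleftrightarrow> - \<alpha> \<notin> P) \<and>
     (\<forall>\<alpha>\<in>P. \<forall>\<beta>\<in>P. \<alpha> + \<beta> \<in> roots G T \<longrightarrow> \<alpha> + \<beta> \<in> P)"

definition analytically_integral ::
  "('g::topological_space, 'e::euclidean_space) lie_group_data \<Rightarrow> 'g set \<Rightarrow> ('e \<Rightarrow> real) \<Rightarrow> bool" where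
  "analytically_integral G T \<Lambda> \<longleftrightarrow>
     \<Lambda> \<in> real_functionals G T \<and>
     (\<forall>H\<in>torus_algebra G T. lie_exp G H = \<one>\<^bsub>G\<^esub> \<longrightarrow> (\<exists>n::int. \<Lambda> H = 2 * pi * of_int n))"

definition Ad_invariant_inner ::
  "('g::topological_space, 'e::euclidean_space) lie_group_data \<Rightarrow> ('e \<Rightarrow> 'e \<Rightarrow> real) \<Rightarrow> bool" where
  "Ad_invariant_inner G B \<longleftrightarrow>
     (\<forall>X\<in>model G. \<forall>Y\<in>model G. \<forall>Z\<in>model G. B (X + Y) Z = B X Z + B Y Z) \<and>
     (\<forall>c. \<forall>X\<in>model G. \<forall>Y\<in>model G. B (c *\<^sub>R X) Y = c * B X Y) \<and>
     (\<forall>X\<in>model G. \<forall>Y\<in>model G. B X Y = B Y X) \<and>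
     (\<forall>X\<in>model G. X \<noteq> 0 \<longrightarrow> 0 < B X X) \<and>
     (\<forall>g. \<forall>X\<in>model G. \<forall>Y\<in>model G. B (Ad G g X) (Ad G g Y) = B X Y)"

text \<open>
  If \<open>H\<close> represents \<open>\<alpha>\<close> with respect to \<open>B\<close>, then \<open>\<Lambda> H\<close> is the inner product of \<open>\<Lambda>\<close> and \<open>\<alpha>\<close>
  on the dual of \<open>\<tt>\<close>.  Its sign does not depend on the choice of \<open>B\<close>.
\<close>

definition dominant ::
  "('g::topological_space, 'e::euclidean_space) lie_group_data \<Rightarrow> 'g set \<Rightarrow> ('e \<Rightarrow> real) set \<Rightarrow>
   ('e \<Rightarrow> real) \<Rightarrow> bool" where
  "dominant G T P \<Lambda> \<longleftrightarrow>
     \<Lambda> \<in> real_functionals G T \<and>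
     (\<forall>B. Ad_invariant_inner G B \<longrightarrow>
        (\<forall>\<alpha>\<in>P. \<forall>H\<in>torus_algebra G T.
           (\<forall>H'\<in>torus_algebra G T. B H H' = \<alpha> H') \<longrightarrow> 0 \<le> \<Lambda> H))"

section \<open>Unitary representations\<close>

text \<open>
  Representations live on a finite-dimensional complex subspace \<open>W\<close> of an inner product space, so
  that families of representations of varying dimension can be formed.  Irreducible unitary
  representations of a compact group are finite-dimensional.
\<close>

definition unitary_rep ::
  "('g::topological_space, 'e) lie_group_data \<Rightarrow> 'h::complex_inner set \<Rightarrow> ('g \<Rightarrow> 'h \<Rightarrow> 'h) \<Rightarrow> bool" where
  "unitary_rep G W \<rho> \<longleftrightarrow>
     (\<exists>B. finite B \<and> W = cspan B) \<and>
     (\<forall>g. clinear_on W (\<rho> g) \<and> \<rho> g ` W \<subseteq> W \<and> (\<forall>u\<in>W. \<forall>v\<in>W. cinner (\<rho> g u) (\<rho> g v) = cinner u v)) \<and>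
     (\<forall>v\<in>W. \<rho> \<one>\<^bsub>G\<^esub> v = v) \<and>
     (\<forall>g h. \<forall>v\<in>W. \<rho> (g \<otimes>\<^bsub>G\<^esub> h) v = \<rho> g (\<rho> h v)) \<and>
     (\<forall>v\<in>W. continuous_on UNIV (\<lambda>g. \<rho> g v))"

definition irreducible_unitary_rep ::
  "('g::topological_space, 'e) lie_group_data \<Rightarrow> 'h::complex_inner set \<Rightarrow> ('g \<Rightarrow> 'h \<Rightarrow> 'h) \<Rightarrow> bool" where
  "irreducible_unitary_rep G W \<rho> \<longleftrightarrow>
     unitary_rep G W \<rho> \<and> W \<noteq> {0} \<and>
     (\<forall>U. csubspace U \<and> U \<subseteq> W \<and> (\<forall>g. \<rho> g ` U \<subseteq> U) \<longrightarrow> U = {0} \<or> U = W)"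

definition equivalent_reps ::
  "'h::complex_inner set \<Rightarrow> ('g \<Rightarrow> 'h \<Rightarrow> 'h) \<Rightarrow> 'h set \<Rightarrow> ('g \<Rightarrow> 'h \<Rightarrow> 'h) \<Rightarrow> bool" where
  "equivalent_reps W \<rho> W' \<rho>' \<longleftrightarrow>
     (\<exists>S. clinear_on W S \<and> bij_betw S W W' \<and> (\<forall>u\<in>W. \<forall>v\<in>W. cinner (S u) (S v) = cinner u v) \<and>
          (\<forall>g. \<forall>v\<in>W. S (\<rho> g v) = \<rho>' g (S v)))"

definition differential_rep ::
  "('g::topological_space, 'e::euclidean_space) lie_group_data \<Rightarrow> ('g \<Rightarrow> 'h::complex_inner \<Rightarrow> 'h) \<Rightarrow>
   'e \<Rightarrow> 'h \<Rightarrow> 'h" where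
  "differential_rep G \<rho> X v = vector_derivative (\<lambda>s. \<rho> (lie_exp G (s *\<^sub>R X)) v) (at 0)"

definition highest_weight_vector ::
  "('g::topological_space, 'e::euclidean_space) lie_group_data \<Rightarrow> 'g set \<Rightarrow> ('e \<Rightarrow> real) set \<Rightarrow>
   ('g \<Rightarrow> 'h::complex_inner \<Rightarrow> 'h) \<Rightarrow> ('e \<Rightarrow> real) \<Rightarrow> 'h \<Rightarrow> bool" where
  "highest_weight_vector G T P \<rho> \<Lambda> v \<longleftrightarrow>
     v \<noteq> 0 \<and>
     (\<forall>H\<in>torus_algebra G T. \<rho> (lie_exp G H) v = exp (\<i> * complex_of_real (\<Lambda> H)) *\<^sub>C v) \<and>
     (\<forall>\<alpha>\<in>P. \<forall>(X, Y)\<in>root_space G T \<alpha>.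
        differential_rep G \<rho> X v + \<i> *\<^sub>C differential_rep G \<rho> Y v = 0)"

section \<open>The representation on \<open>End(\<H>) = \<H> \<otimes> \<H>\<^bold>-\<close>\<close>

definition tensor_conj :: "'h::complex_inner \<Rightarrow> 'h \<Rightarrow> 'h \<Rightarrow> 'h" where
  "tensor_conj v w = (\<lambda>u. cinner u w *\<^sub>C v)"

definition orthonormal_basis :: "'h::complex_inner set \<Rightarrow> bool" where
  "orthonormal_basis B \<longleftrightarrow>
     finite B \<and> (\<forall>x\<in>B. \<forall>y\<in>B. cinner x y = (if x = y then 1 else 0)) \<and> cspan B = UNIV"

text \<open>
  The inner product of \<open>tensor_conj v w\<close> and \<open>tensor_conj v' w'\<close> has to be
  \<open>cinner v v' * cnj (cinner w w')\<close>; this is the Hilbert-Schmidt inner product, which does not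
  depend on the orthonormal basis.  The tensor product action becomes conjugation.
\<close>

definition hs_inner :: "('h::complex_inner \<Rightarrow> 'h) \<Rightarrow> ('h \<Rightarrow> 'h) \<Rightarrow> complex" where
  "hs_inner A B = (\<Sum>b\<in>(SOME E. orthonormal_basis E). cinner (A b) (B b))"

definition tensor_conj_rep ::
  "('g, 'e) lie_group_data \<Rightarrow> ('g \<Rightarrow> 'h::complex_inner \<Rightarrow> 'h) \<Rightarrow> 'g \<Rightarrow> ('h \<Rightarrow> 'h) \<Rightarrow> 'h \<Rightarrow> 'h" where
  "tensor_conj_rep G \<sigma> g A = \<sigma> g \<circ> A \<circ> \<sigma> (inv\<^bsub>G\<^esub> g)"

definition is_components ::
  "'i set \<Rightarrow> ('i \<Rightarrow> 'k set) \<Rightarrow> ('i \<Rightarrow> nat) \<Rightarrow> ('i \<Rightarrow> nat \<Rightarrow> 'k::complex_inner \<Rightarrow> 'h \<Rightarrow> 'h::complex_inner) \<Rightarrow>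
   ('h \<Rightarrow> 'h) \<Rightarrow> ('i \<Rightarrow> nat \<Rightarrow> 'k) \<Rightarrow> bool" where
  "is_components I W m J A c \<longleftrightarrow>
     (\<forall>i\<in>I. \<forall>k\<in>{1..m i}. c i k \<in> W i) \<and> A = (\<Sum>i\<in>I. \<Sum>k\<in>{1..m i}. J i k (c i k))"

text \<open>
  An orthogonal decomposition of \<open>\<sigma>\<close> tensored with its conjugate into irreducible representations:
  \<open>I\<close> indexes the equivalence classes that occur, \<open>(\<pi> i, W i)\<close> is a representative of class \<open>i\<close>
  and \<open>m i\<close> its multiplicity, and \<open>J i k\<close> embeds the \<open>k\<close>-th copy of \<open>W i\<close>.
\<close>

definition orthogonal_decomposition ::
  "('g::topological_space, 'e) lie_group_data \<Rightarrow> ('g \<Rightarrow> 'h::complex_inner \<Rightarrow> 'h) \<Rightarrow>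
   'i set \<Rightarrow> ('i \<Rightarrow> 'k::complex_inner set) \<Rightarrow> ('i \<Rightarrow> 'g \<Rightarrow> 'k \<Rightarrow> 'k) \<Rightarrow> ('i \<Rightarrow> nat) \<Rightarrow>
   ('i \<Rightarrow> nat \<Rightarrow> 'k \<Rightarrow> 'h \<Rightarrow> 'h) \<Rightarrow> bool" where
  "orthogonal_decomposition G \<sigma> I W \<pi> m J \<longleftrightarrow>
     finite I \<and>
     (\<forall>i\<in>I. irreducible_unitary_rep G (W i) (\<pi> i) \<and> 0 < m i) \<and>
     (\<forall>i\<in>I. \<forall>j\<in>I. i \<noteq> j \<longrightarrow> \<not> equivalent_reps (W i) (\<pi> i) (W j) (\<pi> j)) \<and>
     (\<forall>i\<in>I. \<forall>k\<in>{1..m i}.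
        clinear_on (W i) (J i k) \<and> J i k ` W i \<subseteq> endomorphisms \<and>
        (\<forall>u\<in>W i. \<forall>v\<in>W i. hs_inner (J i k u) (J i k v) = cinner u v) \<and>
        (\<forall>g. \<forall>u\<in>W i. J i k (\<pi> i g u) = tensor_conj_rep G \<sigma> g (J i k u))) \<and>
     (\<forall>i\<in>I. \<forall>k\<in>{1..m i}. \<forall>j\<in>I. \<forall>l\<in>{1..m j}. (i, k) \<noteq> (j, l) \<longrightarrow>
        (\<forall>u\<in>W i. \<forall>v\<in>W j. hs_inner (J i k u) (J j l v) = 0)) \<and>
     (\<forall>A\<in>endomorphisms. \<exists>c. is_components I W m J A c)"

section \<open>Toeplitz operators\<close>

definition line_stabilizer :: "('g \<Rightarrow> 'h::complex_inner \<Rightarrow> 'h) \<Rightarrow> 'h \<Rightarrow> 'g set" where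
  "line_stabilizer \<sigma> v = {g. \<exists>c. \<sigma> g v = c *\<^sub>C v}"

text \<open>
  Elements of \<open>L\<^sup>2(G/L)\<close> are represented by functions on \<open>G\<close>; functions that agree almost everywhere
  are not identified.
\<close>

definition L2_quotient :: "('g, 'e) lie_group_data \<Rightarrow> 'g measure \<Rightarrow> 'g set \<Rightarrow> ('g \<Rightarrow> complex) set" where
  "L2_quotient G M L =
     {f \<in> borel_measurable M.
        integrable M (\<lambda>x. (cmod (f x))\<^sup>2) \<and> (\<forall>x. \<forall>l\<in>L. f (x \<otimes>\<^bsub>G\<^esub> l) = f x)}"

definition L2_orthogonal_complement ::
  "('g, 'e) lie_group_data \<Rightarrow> 'g measure \<Rightarrow> 'g set \<Rightarrow> ('g \<Rightarrow> complex) set \<Rightarrow> ('g \<Rightarrow> complex) set" where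
  "L2_orthogonal_complement G M L K =
     {f \<in> L2_quotient G M L. \<forall>h\<in>K. (\<integral>x. f x * cnj (h x) \<partial>M) = 0}"

definition toeplitz ::
  "'g measure \<Rightarrow> ('g \<Rightarrow> 'h::complex_inner \<Rightarrow> 'h) \<Rightarrow> 'h \<Rightarrow> ('g \<Rightarrow> complex) \<Rightarrow> 'h \<Rightarrow> 'h" where
  "toeplitz M \<sigma> v\<^sub>0 f v =
     (THE u. \<forall>w. cinner u w =
        of_nat (cdim (UNIV :: 'h set)) *
        (\<integral>y. f y * cinner v (\<sigma> y v\<^sub>0) * cnj (cinner w (\<sigma> y v\<^sub>0)) \<partial>M))"

definition K_component :: "('i \<Rightarrow> nat) \<Rightarrow> ('i \<Rightarrow> nat \<Rightarrow> 'k::complex_inner) \<Rightarrow> 'i \<Rightarrow> 'k set" where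
  "K_component m c i = cspan {c i k |k. k \<in> {1..m i}}"

definition K_space ::
  "'i set \<Rightarrow> ('i \<Rightarrow> 'k::complex_inner set) \<Rightarrow> ('i \<Rightarrow> 'g \<Rightarrow> 'k \<Rightarrow> 'k) \<Rightarrow> ('i \<Rightarrow> nat) \<Rightarrow>
   ('i \<Rightarrow> nat \<Rightarrow> 'k) \<Rightarrow> ('g \<Rightarrow> complex) set" where
  "K_space I W \<pi> m c =
     cspan {(\<lambda>x. cinner u (\<pi> i x v\<^sub>0)) |i u v\<^sub>0. i \<in> I \<and> u \<in> W i \<and> v\<^sub>0 \<in> K_component m c i}"

end

theory Submission
  imports Defs
begin

text \<open>
  The Berezin symbol of an endomorphism \<open>A\<close> is the function taking \<open>y\<close> to the inner product of
  \<open>A (\<sigma> y v)\<close> with \<open>\<sigma> y v\<close>, where \<open>v\<close> is the highest weight vector.  Up to the dimension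
  as a factor, forming symbols is the adjoint of the Toeplitz quantization, and decomposing the projection onto the line of
  \<open>v\<close> shows that the space \<open>K\<close> consists exactly of all symbols.  This gives the kernel.  For the
  isomorphism one needs that an endomorphism with vanishing symbol vanishes.  Such endomorphisms form a
  subspace that is stable under commutators with the complexified Lie algebra; the latter is the
  sum of the stabilizer of the line of \<open>v\<close> and its complex conjugate, and this allows one to show
  inductively that all matrix coefficients of \<open>A\<close> between vectors generated by \<open>v\<close> vanish.

  The exponential map is obtained from the estimate of the second difference of the
  multiplication in a chart alone: in such a chart \<open>g^n\<close> is \<open>n\<close> times \<open>g\<close> up to a quadratic error, so
  that one-parameter subgroups arise as limits of powers of elements close to the identity.
\<close>

section \<open>Second differences of the multiplication\<close>

text \<open>The vanishing argument is a piece of Lie theory, and the obstacle is how little of that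
  theory the definitions supply: \<open>lie_exp\<close> is a definite description and
  \<open>Ad\<close> a derivative, so even the existence of one-parameter subgroups has to be proved.
  The adjoint action is therefore introduced by conjugating one-parameter subgroups, and the bracket
  as its derivative. Returning from the Lie algebra to the group rests on one principle,
  \<open>closed_subgroup_eq\<close>: a closed subgroup of a closed connected subgroup T equals T as
  soon as it contains all lines of T. It turns commutation with all \<open>dsigma X\<close> into
  commutation with G, and invariance under the lines of a torus into invariance under the torus. No
  root decomposition is formed; of two conjugate root vectors one is positive, and both have the
  same real part. Surjectivity is a dimension count: sending A to the Toeplitz operator of its
  symbol maps the finite-dimensional space of endomorphisms to itself, and a symbol annihilated by
  quantization is orthogonal to all symbols, including itself, hence zero by continuity.\<close>

lemma unit_interval_increment_bound:
  fixes g :: "real \<Rightarrow> 'b::real_normed_vector"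
  assumes "\<And>t. t \<in> {0..1} \<Longrightarrow> (g has_vector_derivative g' t) (at t within {0..1})"
    and "\<And>t. t \<in> {0..1} \<Longrightarrow> norm (g' t) \<le> B"
  shows "norm (g 1 - g 0) \<le> B"
proof -
  have "norm (g 1 - g 0) \<le> B * norm (1 - 0 :: real)"
  proof (rule differentiable_bound)
    show "convex {0..1::real}" by simp
    show "(g has_derivative (\<lambda>x. x *\<^sub>R g' t)) (at t within {0..1})" if "t \<in> {0..1}" for t
      using assms(1)[OF that] by (simp add: has_vector_derivative_def)
    show "onorm (\<lambda>x. x *\<^sub>R g' t) \<le> B" if "t \<in> {0..1}" for t
      using assms(2)[OF that] by (simp add: onorm_scaleR_left onorm_id)
  qed auto
  then show ?thesis by simp
qed

lemma orthonormal_expansion: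
  assumes "finite E" "\<And>a b. a \<in> E \<Longrightarrow> b \<in> E \<Longrightarrow> a \<bullet> b = (if a = b then 1 else 0)" "x \<in> span E"
  shows "(\<Sum>e\<in>E. (x \<bullet> e) *\<^sub>R e) = x"
  using assms(3)
proof (induction rule: span_induct_alt)
  case (step c a y)
  have "(\<Sum>e\<in>E. (c * (a \<bullet> e)) *\<^sub>R e) = (\<Sum>e\<in>E. if e = a then c *\<^sub>R a else 0)"
    using step(1) assms(2) by (intro sum.cong) (auto simp: assms(2))
  also have "\<dots> = c *\<^sub>R a" using step(1) assms(1) by simp
  finally show ?case using step by (simp add: inner_add_left scaleR_add_left sum.distrib)
qed simp

lemma subspace_orthonormal_basis:
  fixes V :: "'a::euclidean_space set"
  assumes "subspace V"
  obtains E where "finite E" "E \<subseteq> V" "span E = V"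
    "\<And>a b. a \<in> E \<Longrightarrow> b \<in> E \<Longrightarrow> a \<bullet> b = (if a = b then 1 else 0)"
proof -
  obtain E where E: "E \<subseteq> V" "pairwise orthogonal E" "\<And>x. x \<in> E \<Longrightarrow> norm x = 1"
    "independent E" "span E = V"
    using orthonormal_basis_subspace[OF assms] by metis
  show ?thesis
  proof (rule that[OF independent_imp_finite[OF E(4)] E(1,5)])
    show "a \<bullet> b = (if a = b then 1 else 0)" if "a \<in> E" "b \<in> E" for a b
      using E(2,3) that by (auto simp: pairwise_def orthogonal_def dot_square_norm)
  qed
qed

text \<open>The mean value inequality is applied twice, once in each variable, so that the mixed
  second derivative bounds the second difference. \<open>C_on\<close> controls only directional
  derivatives along V, each direction separately, so no operator norm is at hand: increments are
  expanded in an orthonormal basis E of V, and the mixed derivatives are bounded on the compact set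
  Q for each pair of basis vectors. C is the sum of these bounds.\<close>

lemma second_difference_bound:
  fixes f :: "'a::euclidean_space \<times> 'a \<Rightarrow> 'b::real_normed_vector"
  assumes V: "subspace V" and S: "openin (top_of_set (V \<times> V)) S" and ab: "(a, b) \<in> S"
    and f: "C_on 2 (V \<times> V) S f"
  obtains R C where "R > 0" "C \<ge> 0" "(cball a R \<inter> V) \<times> (cball b R \<inter> V) \<subseteq> S"
    "\<And>x x' y y'. x \<in> cball a R \<inter> V \<Longrightarrow> x' \<in> cball a R \<inter> V \<Longrightarrow> y \<in> cball b R \<inter> V \<Longrightarrow>
       y' \<in> cball b R \<inter> V \<Longrightarrow>
       norm (f (x, y) - f (x', y) - f (x, y') + f (x', y')) \<le> C * norm (x - x') * norm (y - y')"
proof -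
  have "\<exists>D. (\<forall>z\<in>S. (f has_derivative D z) (at z within S)) \<and>
      (\<forall>v\<in>V \<times> V. C_on 1 (V \<times> V) S (\<lambda>z. D z v))"
    using f unfolding numeral_2_eq_2 One_nat_def by (rule C_on.simps(2)[THEN iffD1])
  then obtain D where D: "\<And>z. z \<in> S \<Longrightarrow> (f has_derivative D z) (at z within S)"
    and D1: "\<And>v. v \<in> V \<times> V \<Longrightarrow> C_on 1 (V \<times> V) S (\<lambda>z. D z v)"
    by blast
  have "\<forall>v\<in>V \<times> V. \<exists>D'. (\<forall>z\<in>S. ((\<lambda>z. D z v) has_derivative D' z) (at z within S)) \<and>
      (\<forall>w\<in>V \<times> V. continuous_on S (\<lambda>z. D' z w))"
    using D1 by simp
  then obtain D' where D': "\<And>v z. v \<in> V \<times> V \<Longrightarrow> z \<in> S \<Longrightarrow>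
        ((\<lambda>z. D z v) has_derivative D' v z) (at z within S)"
    and cont: "\<And>v w. v \<in> V \<times> V \<Longrightarrow> w \<in> V \<times> V \<Longrightarrow> continuous_on S (\<lambda>z. D' v z w)"
    by metis
  obtain E where E: "finite E" "E \<subseteq> V" "span E = V"
    "\<And>a b. a \<in> E \<Longrightarrow> b \<in> E \<Longrightarrow> a \<bullet> b = (if a = b then 1 else 0)"
    using subspace_orthonormal_basis[OF V] by metis
  have abs_E: "\<bar>x \<bullet> e\<bar> \<le> norm x" if "e \<in> E" for x e
    using Cauchy_Schwarz_ineq2[of x e] E(4)[OF that that] by (simp add: norm_eq_sqrt_inner)
  obtain O' where O': "open O'" "S = (V \<times> V) \<inter> O'" using S by (auto simp: openin_open)
  obtain A1 A2 where A: "open A1" "open A2" "a \<in> A1" "b \<in> A2" "A1 \<times> A2 \<subseteq> O'"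
    using O' ab by (auto elim!: open_prod_elim)
  obtain r1 where r1: "r1 > 0" "cball a r1 \<subseteq> A1" using A open_contains_cball by metis
  obtain r2 where r2: "r2 > 0" "cball b r2 \<subseteq> A2" using A open_contains_cball by metis
  define R where "R = min r1 r2"
  define Q where "Q = (cball a R \<inter> V) \<times> (cball b R \<inter> V)"
  have "R > 0" using r1 r2 by (simp add: R_def)
  have QS: "Q \<subseteq> S" using A r1 r2 unfolding O' Q_def R_def by fastforce
  have "compact Q" unfolding Q_def
    by (intro compact_Times compact_Int_closed compact_cball closed_subspace V)
  have "\<exists>K. \<forall>z\<in>Q. norm (D' (0, e) z (e', 0)) \<le> K" if "e \<in> E" "e' \<in> E" for e e'
  proof -
    have "continuous_on Q (\<lambda>z. D' (0, e) z (e', 0))"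
      using that E V by (intro continuous_on_subset[OF cont QS]) (auto simp: subspace_0)
    then have "bounded ((\<lambda>z. D' (0, e) z (e', 0)) ` Q)"
      using \<open>compact Q\<close> compact_continuous_image compact_imp_bounded by blast
    then show ?thesis by (auto simp: bounded_iff)
  qed
  then obtain K where K: "\<And>e e' z. e \<in> E \<Longrightarrow> e' \<in> E \<Longrightarrow> z \<in> Q \<Longrightarrow>
      norm (D' (0, e) z (e', 0)) \<le> K e e'" by metis
  define C where "C = (\<Sum>e\<in>E. \<Sum>e'\<in>E. \<bar>K e e'\<bar>)"
  have CK: "C \<ge> 0" by (simp add: C_def sum_nonneg)
  have seg: "p' + t *\<^sub>R (p - p') \<in> cball c R \<inter> V"
    if "p \<in> cball c R \<inter> V" "p' \<in> cball c R \<inter> V" "t \<in> {0..1}" for p p' c and t :: real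
  proof -
    have "convex (cball c R \<inter> V)" by (intro convex_Int convex_cball subspace_imp_convex V)
    then have "(1 - t) *\<^sub>R p' + t *\<^sub>R p \<in> cball c R \<inter> V"
      using that by (intro convexD) auto
    then show ?thesis by (simp add: algebra_simps)
  qed
  have step1: "norm (D (x, y) (0, e) - D (x', y) (0, e)) \<le> (\<Sum>e'\<in>E. \<bar>K e e'\<bar>) * norm (x - x')"
    if e: "e \<in> E" and x: "x \<in> cball a R \<inter> V" "x' \<in> cball a R \<inter> V" and y: "y \<in> cball b R \<inter> V"
    for e x x' y
  proof -
    let ?z = "\<lambda>t. (x' + t *\<^sub>R (x - x'), y)"
    have z: "?z t \<in> Q" if "t \<in> {0..1}" for t using seg[OF x that] y by (simp add: Q_def)
    have e0: "(0, e) \<in> V \<times> V" using e E V by (auto simp: subspace_0)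
    have "norm (D (?z 1) (0, e) - D (?z 0) (0, e)) \<le> (\<Sum>e'\<in>E. \<bar>K e e'\<bar>) * norm (x - x')"
    proof (rule unit_interval_increment_bound)
      fix t :: real assume t: "t \<in> {0..1}"
      have "(?z has_vector_derivative (x - x', 0)) (at t within {0..1})"
        by (intro has_vector_derivative_Pair) (auto intro!: derivative_eq_intros)
      moreover have "((\<lambda>z. D z (0, e)) has_derivative D' (0, e) (?z t)) (at (?z t) within ?z ` {0..1})"
        using z t QS by (intro has_derivative_subset[OF D'[OF e0]]) auto
      ultimately show "((\<lambda>t. D (?z t) (0, e)) has_vector_derivative D' (0, e) (?z t) (x - x', 0))
          (at t within {0..1})"
        using vector_derivative_diff_chain_within[of ?z "(x - x', 0)" t "{0..1}" "\<lambda>z. D z (0, e)"]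
        by (simp add: o_def)
      have lin: "linear (D' (0, e) (?z t))"
        using D'[OF e0] z[OF t] QS has_derivative_linear by blast
      have "(\<Sum>e'\<in>E. ((x - x') \<bullet> e') *\<^sub>R e') = x - x'"
        using orthonormal_expansion[OF E(1,4)] x V E(3) by (simp add: subspace_diff)
      then have "(x - x', 0) = (\<Sum>e'\<in>E. ((x - x') \<bullet> e') *\<^sub>R (e', 0 :: 'a))"
        by (simp add: prod_eq_iff fst_sum snd_sum)
      then have "D' (0, e) (?z t) (x - x', 0) =
          (\<Sum>e'\<in>E. ((x - x') \<bullet> e') *\<^sub>R D' (0, e) (?z t) (e', 0))"
        by (simp only: linear_sum[OF lin] linear_scale[OF lin] o_def)
      also have "norm \<dots> \<le> (\<Sum>e'\<in>E. norm (x - x') * \<bar>K e e'\<bar>)"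
        using K[OF e _ z[OF t]] abs_E by (intro sum_norm_le) (fastforce intro!: mult_mono)
      finally show "norm (D' (0, e) (?z t) (x - x', 0)) \<le> (\<Sum>e'\<in>E. \<bar>K e e'\<bar>) * norm (x - x')"
        by (simp add: sum_distrib_left mult.commute)
    qed
    then show ?thesis by simp
  qed
  have "norm (f (x, y) - f (x', y) - f (x, y') + f (x', y')) \<le> C * norm (x - x') * norm (y - y')"
    if x: "x \<in> cball a R \<inter> V" "x' \<in> cball a R \<inter> V"
      and y: "y \<in> cball b R \<inter> V" "y' \<in> cball b R \<inter> V" for x x' y y'
  proof -
    let ?w = "\<lambda>t. y' + t *\<^sub>R (y - y')"
    let ?d = "\<lambda>t. D (x, ?w t) (0, y - y') - D (x', ?w t) (0, y - y')"
    have "norm ((f (x, ?w 1) - f (x', ?w 1)) - (f (x, ?w 0) - f (x', ?w 0)))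
        \<le> C * norm (x - x') * norm (y - y')"
    proof (rule unit_interval_increment_bound)
      fix t :: real assume t: "t \<in> {0..1}"
      have deriv: "((\<lambda>t. f (p, ?w t)) has_vector_derivative D (p, ?w t) (0, y - y'))
          (at t within {0..1})" if p: "p \<in> cball a R \<inter> V" for p
      proof -
        have z: "(p, ?w t) \<in> S" if "t \<in> {0..1}" for t
          using seg[OF y that] p QS by (auto simp: Q_def)
        have "((\<lambda>t. (p, ?w t)) has_vector_derivative (0, y - y')) (at t within {0..1})"
          by (intro has_vector_derivative_Pair) (auto intro!: derivative_eq_intros)
        moreover have "(f has_derivative D (p, ?w t)) (at (p, ?w t) within (\<lambda>t. (p, ?w t)) ` {0..1})"
          using z t by (intro has_derivative_subset[OF D]) auto
        ultimately show ?thesis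
          using vector_derivative_diff_chain_within[of "\<lambda>t. (p, ?w t)" "(0, y - y')" t "{0..1}" f]
          by (simp add: o_def)
      qed
      show "((\<lambda>t. f (x, ?w t) - f (x', ?w t)) has_vector_derivative ?d t) (at t within {0..1})"
        using deriv x by (intro has_vector_derivative_diff) auto
      have lin: "linear (D (p, ?w t))" if "p \<in> cball a R \<inter> V" for p
      proof -
        have "(p, ?w t) \<in> S" using seg[OF y t] that QS by (auto simp: Q_def)
        then show ?thesis using D has_derivative_linear by blast
      qed
      have exp: "(\<Sum>e\<in>E. ((y - y') \<bullet> e) *\<^sub>R e) = y - y'"
        using orthonormal_expansion[OF E(1,4)] y V E(3) by (simp add: subspace_diff)
      then have "(0, y - y') = (\<Sum>e\<in>E. ((y - y') \<bullet> e) *\<^sub>R (0 :: 'a, e))"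
        by (simp add: prod_eq_iff fst_sum snd_sum)
      then have "D (p, ?w t) (0, y - y') = (\<Sum>e\<in>E. ((y - y') \<bullet> e) *\<^sub>R D (p, ?w t) (0, e))"
        if "p \<in> cball a R \<inter> V" for p
        by (simp only: linear_sum[OF lin[OF that]] linear_scale[OF lin[OF that]] o_def)
      then have dt: "?d t = (\<Sum>e\<in>E. ((y - y') \<bullet> e) *\<^sub>R (D (x, ?w t) (0, e) - D (x', ?w t) (0, e)))"
        using x by (simp add: scaleR_diff_right sum_subtractf)
      have "norm (?d t) \<le> (\<Sum>e\<in>E. norm (y - y') * ((\<Sum>e'\<in>E. \<bar>K e e'\<bar>) * norm (x - x')))"
        unfolding dt using step1[OF _ x seg[OF y t]] abs_E by (intro sum_norm_le) (auto intro!: mult_mono)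
      also have "\<dots> = norm (y - y') * (C * norm (x - x'))"
        unfolding C_def by (simp only: sum_distrib_left[symmetric] sum_distrib_right[symmetric])
      finally show "norm (?d t) \<le> C * norm (x - x') * norm (y - y')"
        by (simp add: mult_ac)
    qed
    then show ?thesis by (simp add: algebra_simps)
  qed
  with \<open>R > 0\<close> CK QS that show ?thesis unfolding Q_def by blast
qed

section \<open>The exponential map of a group with a chart at the identity\<close>

text \<open>Rounding down loses less than one step \<open>a n\<close>. In this way a real time s is
  reached as a limit of integer powers of elements whose step size shrinks.\<close>

lemma nat_floor_ratio_tendsto:
  fixes a :: "nat \<Rightarrow> real"
  assumes "s \<ge> 0" "\<And>n. a n > 0" "a \<longlonglongrightarrow> 0"
  shows "(\<lambda>n. real (nat \<lfloor>s / a n\<rfloor>) * a n) \<longlonglongrightarrow> s"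
proof (rule tendsto_sandwich)
  have "s - a n \<le> real (nat \<lfloor>s / a n\<rfloor>) * a n \<and> real (nat \<lfloor>s / a n\<rfloor>) * a n \<le> s" for n
  proof -
    have "0 \<le> s / a n" using assms(1) assms(2)[of n] by simp
    then have "s / a n - 1 \<le> real (nat \<lfloor>s / a n\<rfloor>)" "real (nat \<lfloor>s / a n\<rfloor>) \<le> s / a n" by linarith+
    then show ?thesis using assms(2)[of n] by (simp add: field_simps)
  qed
  then show "\<forall>\<^sub>F n in sequentially. s - a n \<le> real (nat \<lfloor>s / a n\<rfloor>) * a n"
    "\<forall>\<^sub>F n in sequentially. real (nat \<lfloor>s / a n\<rfloor>) * a n \<le> s" by auto
  show "(\<lambda>n. s - a n) \<longlonglongrightarrow> s" using tendsto_diff[OF tendsto_const assms(3)] by simp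
qed simp

lemma compact_cball_Int_subspace:
  fixes V :: "'e::euclidean_space set"
  assumes "subspace V"
  shows "compact (cball a r \<inter> V)"
  by (intro compact_Int_closed compact_cball closed_subspace assms)

text \<open>The smooth structure enters only through \<open>second_difference\<close>, and the
  identity has coordinate 0. Setting g' = h' = 1 in it bounds the deviation of the product from
  addition; setting only h' = 1, or only g' = 1, compares two products that differ in one factor.
  The charts take values in the subspace V, hence the intersection of the ball with V in
  \<open>cball_subset\<close>.\<close>

locale group_chart = group G
  for G :: "('g::{t2_space, second_countable_topology}, 'm) monoid_scheme" (structure) +
  fixes V :: "'e::euclidean_space set" and U :: "'g set" and \<psi> :: "'g \<Rightarrow> 'e" and R C :: real
  assumes carrier_UNIV [simp]: "carrier G = UNIV"
    and continuous_mult: "continuous_on UNIV (\<lambda>(x, y). x \<otimes> y)"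
    and continuous_inv: "continuous_on UNIV (\<lambda>x. inv x)"
    and subspace_V: "subspace V"
    and open_U: "open U" and one_U [simp]: "\<one> \<in> U" and psi_one [simp]: "\<psi> \<one> = 0"
    and homeo: "homeomorphism U (\<psi> ` U) \<psi> (inv_into U \<psi>)"
    and R_pos: "R > 0" and C_nonneg: "C \<ge> 0"
    and psi_V: "g \<in> U \<Longrightarrow> \<psi> g \<in> V"
    and cball_subset: "cball 0 R \<inter> V \<subseteq> \<psi> ` U"
    and mult_U: "g \<in> U \<Longrightarrow> h \<in> U \<Longrightarrow> norm (\<psi> g) \<le> R \<Longrightarrow> norm (\<psi> h) \<le> R \<Longrightarrow> g \<otimes> h \<in> U"
    and second_difference: "\<lbrakk>g \<in> U; h \<in> U; g' \<in> U; h' \<in> U; norm (\<psi> g) \<le> R; norm (\<psi> h) \<le> R;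
        norm (\<psi> g') \<le> R; norm (\<psi> h') \<le> R\<rbrakk> \<Longrightarrow>
       norm (\<psi> (g \<otimes> h) - \<psi> (g' \<otimes> h) - \<psi> (g \<otimes> h') + \<psi> (g' \<otimes> h'))
         \<le> C * norm (\<psi> g - \<psi> g') * norm (\<psi> h - \<psi> h')"
begin

abbreviation \<xi> where "\<xi> \<equiv> inv_into U \<psi>"

lemma xi_psi [simp]: "g \<in> U \<Longrightarrow> \<xi> (\<psi> g) = g"
  using homeo by (simp add: homeomorphism_def)

lemma psi_eqD: "g \<in> U \<Longrightarrow> h \<in> U \<Longrightarrow> \<psi> g = \<psi> h \<Longrightarrow> g = h"
  by (metis xi_psi)

lemma xi_U: "z \<in> V \<Longrightarrow> norm z \<le> R \<Longrightarrow> \<xi> z \<in> U"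
  and psi_xi: "z \<in> V \<Longrightarrow> norm z \<le> R \<Longrightarrow> \<psi> (\<xi> z) = z"
  using cball_subset by (auto intro!: inv_into_into f_inv_into_f)

lemma tendsto_xi:
  assumes "\<forall>\<^sub>F n in F. x n \<in> U" "((\<lambda>n. \<psi> (x n)) \<longlongrightarrow> z) F" "z \<in> V" "norm z \<le> R"
  shows "(x \<longlongrightarrow> \<xi> z) F"
proof -
  have "((\<lambda>n. \<xi> (\<psi> (x n))) \<longlongrightarrow> \<xi> z) F"
    using homeo cball_subset assms
    by (intro continuous_on_tendsto_compose[of "\<psi> ` U" \<xi> "\<lambda>n. \<psi> (x n)"])
      (auto simp: homeomorphism_def elim: eventually_mono)
  then show ?thesis
    by (rule Lim_transform_eventually) (use assms(1) in \<open>auto elim: eventually_mono\<close>)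
qed

lemma tendsto_psi:
  assumes "(x \<longlongrightarrow> g) F" "g \<in> U"
  shows "\<forall>\<^sub>F n in F. x n \<in> U" "((\<lambda>n. \<psi> (x n)) \<longlongrightarrow> \<psi> g) F"
proof -
  show ev: "\<forall>\<^sub>F n in F. x n \<in> U" using topological_tendstoD[OF assms(1) open_U assms(2)] .
  show "((\<lambda>n. \<psi> (x n)) \<longlongrightarrow> \<psi> g) F"
    using homeo assms ev
    by (intro continuous_on_tendsto_compose[of U \<psi>]) (auto simp: homeomorphism_def)
qed

lemma xi_zero [simp]: "\<xi> 0 = \<one>"
  using xi_psi[of \<one>] by simp

lemma tendsto_mult_group:
  assumes "(x \<longlongrightarrow> a) F" "(y \<longlongrightarrow> b) F"
  shows "((\<lambda>n. x n \<otimes> y n) \<longlongrightarrow> a \<otimes> b) F"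
  using continuous_on_tendsto_compose[OF continuous_mult tendsto_Pair[OF assms]] by simp

lemma tendsto_inv_group:
  assumes "(x \<longlongrightarrow> a) F"
  shows "((\<lambda>n. inv (x n)) \<longlongrightarrow> inv a) F"
  using continuous_on_tendsto_compose[OF continuous_inv assms] by simp

lemma tendsto_pow_group:
  assumes "(x \<longlongrightarrow> a) F"
  shows "((\<lambda>n. x n [^] (k::nat)) \<longlongrightarrow> a [^] k) F"
  by (induction k) (auto intro: tendsto_mult_group assms)

section \<open>Estimates of products and powers in the chart\<close>

lemma mult_estimate:
  assumes "g \<in> U" "h \<in> U" "norm (\<psi> g) \<le> R" "norm (\<psi> h) \<le> R"
  shows "norm (\<psi> (g \<otimes> h) - \<psi> g - \<psi> h) \<le> C * norm (\<psi> g) * norm (\<psi> h)"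
  using second_difference[of g h \<one> \<one>] assms R_pos by (simp add: algebra_simps)

lemma mult_diff_left:
  assumes "g \<in> U" "h \<in> U" "g' \<in> U" "norm (\<psi> g) \<le> R" "norm (\<psi> h) \<le> R" "norm (\<psi> g') \<le> R"
  shows "norm (\<psi> (g \<otimes> h) - \<psi> (g' \<otimes> h) - (\<psi> g - \<psi> g')) \<le> C * norm (\<psi> g - \<psi> g') * norm (\<psi> h)"
  using second_difference[of g h g' \<one>] assms R_pos by (simp add: algebra_simps)

lemma mult_diff_right:
  assumes "g \<in> U" "h \<in> U" "h' \<in> U" "norm (\<psi> g) \<le> R" "norm (\<psi> h) \<le> R" "norm (\<psi> h') \<le> R"
  shows "norm (\<psi> (g \<otimes> h) - \<psi> (g \<otimes> h') - (\<psi> h - \<psi> h')) \<le> C * norm (\<psi> g) * norm (\<psi> h - \<psi> h')"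
  using second_difference[of g h \<one> h'] assms R_pos by (simp add: algebra_simps)

text \<open>A radius at which the quadratic error is dominated: C \<epsilon> \<le> 1/8 keeps the
  deviation of a power from its linear term below one eighth of that term, and 4 \<epsilon> \<le> R
  leaves room for coordinates of size 2 \<epsilon>. The summand 1 in C + 1 covers C = 0.\<close>

definition \<epsilon> where "\<epsilon> = min (R / 4) (1 / (8 * (C + 1)))"

lemma eps_pos: "\<epsilon> > 0" and eps_R: "4 * \<epsilon> \<le> R" and C_eps: "C * \<epsilon> \<le> 1 / 8"
proof -
  show "\<epsilon> > 0" "4 * \<epsilon> \<le> R" using R_pos C_nonneg by (simp_all add: \<epsilon>_def)
  have "C * \<epsilon> \<le> C * (1 / (8 * (C + 1)))"
    using C_nonneg by (intro mult_left_mono) (simp_all add: \<epsilon>_def)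
  also have "\<dots> \<le> 1 / 8" using C_nonneg by (simp add: field_simps)
  finally show "C * \<epsilon> \<le> 1 / 8" .
qed

lemma C_mult_eps: "0 \<le> x \<Longrightarrow> a \<le> \<epsilon> \<Longrightarrow> C * a * x \<le> x / 8"
proof -
  assume "0 \<le> x" "a \<le> \<epsilon>"
  then have "C * a * x \<le> C * \<epsilon> * x" using C_nonneg by (intro mult_right_mono mult_left_mono)
  also have "\<dots> \<le> 1 / 8 * x" using C_eps \<open>0 \<le> x\<close> by (intro mult_right_mono)
  finally show ?thesis by simp
qed

text \<open>Passing from k to k + 1 adds an error of at most C times the size of
  \<open>g [^] k\<close> times that of g, hence at most 2 C k times the squared norm of
  \<open>\<psi> g\<close>, and k^2 + 2 k \<le> (k + 1)^2 closes the induction. The last bound, which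
  feeds the estimate of the next factor, holds because the total error is at most one eighth of the
  linear term.\<close>

lemma pow_chart:
  assumes "g \<in> U" "real k * norm (\<psi> g) \<le> \<epsilon>"
  shows "g [^] k \<in> U \<and> norm (\<psi> (g [^] k) - real k *\<^sub>R \<psi> g) \<le> C * (real k * norm (\<psi> g))\<^sup>2
    \<and> norm (\<psi> (g [^] k)) \<le> 2 * (real k * norm (\<psi> g))"
  using assms(2)
proof (induction k)
  case 0
  then show ?case by simp
next
  case (Suc k)
  let ?n = "norm (\<psi> g)"
  have "real k * ?n \<le> real (Suc k) * ?n" by (intro mult_right_mono) auto
  then have le: "real k * ?n \<le> \<epsilon>" using Suc.prems by linarith
  note IH = Suc.IH[OF le]
  have n: "?n \<le> \<epsilon>"
    using Suc.prems mult_right_mono[of 1 "real (Suc k)" ?n] by simp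
  have R: "?n \<le> R" "norm (\<psi> (g [^] k)) \<le> R" using n IH le eps_R eps_pos by auto
  have U: "g [^] Suc k \<in> U" using IH assms(1) R by (simp add: mult_U)
  have "norm (\<psi> (g [^] Suc k) - \<psi> (g [^] k) - \<psi> g) \<le> C * norm (\<psi> (g [^] k)) * ?n"
    using mult_estimate[of "g [^] k" g] IH assms(1) R by simp
  also have "\<dots> \<le> C * (2 * (real k * ?n)) * ?n"
    using IH C_nonneg by (intro mult_right_mono mult_left_mono) auto
  finally have "norm (\<psi> (g [^] Suc k) - \<psi> (g [^] k) - \<psi> g) \<le> C * (2 * (real k * ?n)) * ?n" .
  moreover have "\<psi> (g [^] Suc k) - real (Suc k) *\<^sub>R \<psi> g =
      (\<psi> (g [^] Suc k) - \<psi> (g [^] k) - \<psi> g) + (\<psi> (g [^] k) - real k *\<^sub>R \<psi> g)"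
    by (simp add: algebra_simps)
  then have "norm (\<psi> (g [^] Suc k) - real (Suc k) *\<^sub>R \<psi> g) \<le>
      norm (\<psi> (g [^] Suc k) - \<psi> (g [^] k) - \<psi> g) + norm (\<psi> (g [^] k) - real k *\<^sub>R \<psi> g)"
    by (metis norm_triangle_ineq)
  ultimately have "norm (\<psi> (g [^] Suc k) - real (Suc k) *\<^sub>R \<psi> g) \<le>
      C * (2 * (real k * ?n)) * ?n + C * (real k * ?n)\<^sup>2"
    using IH by linarith
  also have "\<dots> \<le> C * (real (Suc k) * ?n)\<^sup>2"
  proof -
    have "0 \<le> C * ?n\<^sup>2" using C_nonneg by simp
    then show ?thesis by (simp add: power2_eq_square algebra_simps)
  qed
  finally have est: "norm (\<psi> (g [^] Suc k) - real (Suc k) *\<^sub>R \<psi> g) \<le> C * (real (Suc k) * ?n)\<^sup>2" .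
  have "C * (real (Suc k) * ?n)\<^sup>2 \<le> (real (Suc k) * ?n) / 8"
    using C_mult_eps[of "real (Suc k) * ?n" "real (Suc k) * ?n"] Suc.prems
    by (simp add: power2_eq_square mult.assoc)
  then have "norm (\<psi> (g [^] Suc k)) \<le> 2 * (real (Suc k) * ?n)"
    using est norm_triangle_ineq2[of "\<psi> (g [^] Suc k)" "real (Suc k) *\<^sub>R \<psi> g"]
      mult_nonneg_nonneg[OF of_nat_0_le_iff[of "Suc k"] norm_ge_zero[of "\<psi> g"]]
    unfolding norm_scaleR abs_of_nat by linarith
  with U est show ?case by blast
qed

text \<open>Write d for the norm of \<open>\<psi> g - \<psi> h\<close>. Exchanging one factor at a
  time in the step from n to n + 1 leaves two deviations: A from the left factor, at most C times 4
  n d times the norm of \<open>\<psi> g\<close>, and B from the right factor. Shifting the n onto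
  the norms of the coordinates, where the product is at most \<epsilon>, shows that both are at most
  d / 2, so a step adds at most 2 d and the constant 4 is preserved.\<close>

lemma pow_diff:
  assumes "g \<in> U" "h \<in> U" "real n * norm (\<psi> g) \<le> \<epsilon>" "real n * norm (\<psi> h) \<le> \<epsilon>"
  shows "norm (\<psi> (g [^] n) - \<psi> (h [^] n)) \<le> 4 * (real n * norm (\<psi> g - \<psi> h))"
  using assms(3,4)
proof (induction n)
  case (Suc n)
  let ?d = "norm (\<psi> g - \<psi> h)"
  have "real n * norm z \<le> real (Suc n) * norm z" for z :: 'e by (intro mult_right_mono) auto
  then have le: "real n * norm (\<psi> g) \<le> \<epsilon>" "real n * norm (\<psi> h) \<le> \<epsilon>"
    using Suc.prems order_trans by blast+
  note IH = Suc.IH[OF le] and pg = pow_chart[OF assms(1) le(1)] and ph = pow_chart[OF assms(2) le(2)]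
  have n: "norm (\<psi> g) \<le> \<epsilon>" "norm (\<psi> h) \<le> \<epsilon>"
    using Suc.prems mult_right_mono[of 1 "real (Suc n)" "norm (\<psi> g)"]
      mult_right_mono[of 1 "real (Suc n)" "norm (\<psi> h)"] by auto
  have R: "norm (\<psi> g) \<le> R" "norm (\<psi> (g [^] n)) \<le> R" "norm (\<psi> h) \<le> R" "norm (\<psi> (h [^] n)) \<le> R"
    using n pg ph le eps_R eps_pos by auto
  define A where "A = \<psi> (g [^] n \<otimes> g) - \<psi> (h [^] n \<otimes> g) - (\<psi> (g [^] n) - \<psi> (h [^] n))"
  define B where "B = \<psi> (h [^] n \<otimes> g) - \<psi> (h [^] n \<otimes> h) - (\<psi> g - \<psi> h)"
  have "norm A \<le> C * norm (\<psi> (g [^] n) - \<psi> (h [^] n)) * norm (\<psi> g)"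
    unfolding A_def using mult_diff_left pg ph assms R by blast
  also have "\<dots> \<le> C * (4 * (real n * ?d)) * norm (\<psi> g)"
    using IH C_nonneg by (intro mult_right_mono mult_left_mono) auto
  also have "\<dots> = C * (real n * norm (\<psi> g)) * (4 * ?d)" by simp
  also have "\<dots> \<le> 4 * ?d / 8" by (intro C_mult_eps le) simp
  finally have A: "norm A \<le> ?d / 2" by simp
  have "norm B \<le> C * norm (\<psi> (h [^] n)) * ?d"
    unfolding B_def using mult_diff_right pg ph assms R by blast
  also have "\<dots> \<le> C * (2 * (real n * norm (\<psi> h))) * ?d"
    using ph C_nonneg by (intro mult_right_mono mult_left_mono) auto
  also have "\<dots> = C * (real n * norm (\<psi> h)) * (2 * ?d)" by simp
  also have "\<dots> \<le> 2 * ?d / 8" by (intro C_mult_eps le) simp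
  finally have B: "norm B \<le> ?d / 2" using norm_ge_zero[of "\<psi> g - \<psi> h"] by linarith
  have "\<psi> (g [^] Suc n) - \<psi> (h [^] Suc n) = A + B + (\<psi> (g [^] n) - \<psi> (h [^] n)) + (\<psi> g - \<psi> h)"
    by (simp add: A_def B_def)
  then have "norm (\<psi> (g [^] Suc n) - \<psi> (h [^] Suc n)) \<le>
      norm A + norm B + norm (\<psi> (g [^] n) - \<psi> (h [^] n)) + ?d"
    by (metis (no_types, lifting) add.assoc add_mono norm_triangle_ineq norm_triangle_le order_refl)
  then have "norm (\<psi> (g [^] Suc n) - \<psi> (h [^] Suc n)) \<le> 4 * (real n * ?d) + 4 * ?d"
    using A B IH norm_ge_zero[of "\<psi> g - \<psi> h"] by linarith
  then show ?case by (simp add: algebra_simps)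
qed simp

text \<open>As long as k times the norm of \<open>\<psi> g\<close> is at most \<epsilon>, it is at
  most 8/7 of the norm of \<open>\<psi> (g [^] k)\<close>, hence at most 2 \<epsilon> / 7; one
  further step adds at most \<epsilon> / 4, so \<epsilon> is never crossed. Powers that stay close
  thus bound the size of g, which gives bounds on difference quotients where no derivative is known
  yet.\<close>

lemma escape:
  assumes "g \<in> U" "\<And>k. k \<le> N \<Longrightarrow> g [^] k \<in> U \<and> norm (\<psi> (g [^] k)) \<le> \<epsilon> / 4"
  shows "real N * norm (\<psi> g) \<le> \<epsilon>"
proof -
  have "k \<le> N \<Longrightarrow> real k * norm (\<psi> g) \<le> \<epsilon>" for k
  proof (induction k)
    case (Suc k)
    let ?x = "real k * norm (\<psi> g)"
    have le: "?x \<le> \<epsilon>" using Suc by simp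
    have "C * ?x\<^sup>2 \<le> ?x / 8"
      using C_mult_eps[of ?x ?x] le by (simp add: power2_eq_square mult.assoc)
    moreover have "norm (\<psi> (g [^] k) - real k *\<^sub>R \<psi> g) \<le> C * ?x\<^sup>2"
      using pow_chart[OF assms(1) le] by blast
    moreover have "?x - norm (\<psi> (g [^] k)) \<le> norm (\<psi> (g [^] k) - real k *\<^sub>R \<psi> g)"
      using norm_triangle_ineq2[of "real k *\<^sub>R \<psi> g" "\<psi> (g [^] k)"] by (simp add: norm_minus_commute)
    moreover have "norm (\<psi> (g [^] k)) \<le> \<epsilon> / 4" using assms(2) Suc.prems by simp
    moreover have "norm (\<psi> g) \<le> \<epsilon> / 4" using assms(2)[of 1] Suc.prems assms(1) by simp
    ultimately have "norm (\<psi> g) + ?x \<le> \<epsilon>" using eps_pos by linarith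
    then show ?case by (simp add: algebra_simps)
  qed (use eps_pos in simp)
  then show ?thesis by simp
qed


lemma scale_V: "X \<in> V \<Longrightarrow> c *\<^sub>R X \<in> V"
  by (rule subspace_scale[OF subspace_V])

lemma closed_V: "closed V"
  by (rule closed_subspace[OF subspace_V])

text \<open>With z the element of step X / (n m), \<open>z [^] m\<close> misses the element of step
  X / n by at most C times the squared norm of X / n. Raising both to the n-th power multiplies this
  by 4 n (\<open>pow_diff\<close>), which still leaves a factor 1 / n.\<close>

lemma pow_step_Cauchy:
  assumes X: "X \<in> V" "norm X \<le> \<epsilon> / 2" and n: "n > 0" and m: "m > 0"
  shows "norm (\<psi> (\<xi> (X /\<^sub>R real n) [^] n) - \<psi> (\<xi> (X /\<^sub>R real (n * m)) [^] (n * m)))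
      \<le> 4 * C * (norm X)\<^sup>2 / real n"
proof -
  have small: "norm (X /\<^sub>R real k) \<le> \<epsilon> / 2" for k
  proof (cases "k = 0")
    case False
    then have "norm X / real k \<le> norm X / 1" by (intro divide_left_mono) auto
    moreover have "norm (X /\<^sub>R real k) = norm X / real k" by (simp add: divide_inverse mult.commute)
    ultimately show ?thesis using X by linarith
  qed (use eps_pos in simp)
  have R: "norm (X /\<^sub>R real k) \<le> R" for k using small[of k] eps_R eps_pos by linarith
  define z where "z = \<xi> (X /\<^sub>R real (n * m))"
  define w where "w = \<xi> (X /\<^sub>R real n)"
  have z: "z \<in> U" "\<psi> z = X /\<^sub>R real (n * m)" and w: "w \<in> U" "\<psi> w = X /\<^sub>R real n"
    unfolding z_def w_def using xi_U psi_xi scale_V[OF X(1)] R by blast+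
  have mz: "real m * norm (\<psi> z) = norm X / real n" "real m *\<^sub>R \<psi> z = X /\<^sub>R real n"
    using m by (auto simp: z field_simps)
  have le1: "norm X / real n \<le> \<epsilon> / 2" using small[of n] n by (simp add: field_simps)
  have pz: "z [^] m \<in> U" "norm (\<psi> (z [^] m) - X /\<^sub>R real n) \<le> C * (norm X / real n)\<^sup>2"
    "norm (\<psi> (z [^] m)) \<le> 2 * (norm X / real n)"
    using pow_chart[OF z(1), of m] le1 eps_pos unfolding mz by auto
  have "norm (\<psi> (w [^] n) - \<psi> ((z [^] m) [^] n)) \<le> 4 * (real n * norm (\<psi> w - \<psi> (z [^] m)))"
  proof (rule pow_diff[OF w(1) pz(1)])
    have "real n * norm (\<psi> w) = norm X" using n by (simp add: w)
    then show "real n * norm (\<psi> w) \<le> \<epsilon>" using X eps_pos by linarith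
    have "real n * norm (\<psi> (z [^] m)) \<le> real n * (2 * (norm X / real n))"
      using pz by (intro mult_left_mono) auto
    then show "real n * norm (\<psi> (z [^] m)) \<le> \<epsilon>" using X n by simp
  qed
  also have "\<dots> \<le> 4 * (real n * (C * (norm X / real n)\<^sup>2))"
    using pz(2) unfolding w by (intro mult_left_mono) (auto simp: norm_minus_commute)
  also have "\<dots> = 4 * C * (norm X)\<^sup>2 / real n" using n by (simp add: power2_eq_square)
  finally have "norm (\<psi> (w [^] n) - \<psi> ((z [^] m) [^] n)) \<le> 4 * C * (norm X)\<^sup>2 / real n" .
  moreover have "(z [^] m) [^] n = z [^] (n * m)" by (simp add: nat_pow_pow mult.commute)
  ultimately show ?thesis unfolding z_def w_def by simp
qed

lemma pow_limit:
  assumes X: "X \<in> V" "norm X \<le> \<epsilon> / 2"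
  obtains Y where "Y \<in> V" "norm (Y - X) \<le> C * (norm X)\<^sup>2" "norm Y \<le> 2 * norm X"
    "(\<lambda>n. \<psi> (\<xi> (X /\<^sub>R real n) [^] n)) \<longlonglongrightarrow> Y"
proof -
  let ?a = "\<lambda>n. \<psi> (\<xi> (X /\<^sub>R real n) [^] n)"
  let ?K = "4 * C * (norm X)\<^sup>2"
  have K: "?K \<ge> 0" using C_nonneg by simp
  have "Cauchy ?a"
  proof (rule metric_CauchyI)
    fix e :: real assume e: "e > 0"
    obtain N where N: "real N > 2 * ?K / e" using reals_Archimedean2 by blast
    have "0 \<le> 2 * ?K / e" using K e by (intro divide_nonneg_pos) auto
    then have N0: "N > 0" using N by linarith
    have half: "?K / real n < e / 2" if "n \<ge> N" for n
    proof -
      have "?K / real n \<le> ?K / real N" using that N0 K by (intro divide_left_mono) auto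
      also have "\<dots> < e / 2" using N N0 e by (simp add: field_simps)
      finally show ?thesis .
    qed
    have "dist (?a n) (?a m) < e" if "n \<ge> N" "m \<ge> N" for n m
    proof -
      \<comment> \<open>The step counts n and m are compared through their common refinement n
        m.\<close>
      have "norm (?a n - ?a (n * m)) < e / 2" "norm (?a m - ?a (m * n)) < e / 2"
        using pow_step_Cauchy[OF X, of n m] pow_step_Cauchy[OF X, of m n] half that N0
        by fastforce+
      then show ?thesis
        using norm_diff_triangle_less[of "?a n" "?a (n * m)" "e / 2" "?a m" "e / 2"]
        by (simp add: dist_norm norm_minus_commute mult.commute)
    qed
    then show "\<exists>M. \<forall>m\<ge>M. \<forall>n\<ge>M. dist (?a m) (?a n) < e" by blast
  qed
  then obtain Y where Y: "?a \<longlonglongrightarrow> Y" using Cauchy_convergent_iff convergent_def by blast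
  have p: "\<psi> (\<xi> (X /\<^sub>R real n) [^] n) \<in> V \<and> norm (?a n - X) \<le> C * (norm X)\<^sup>2 \<and> norm (?a n) \<le> 2 * norm X"
    if "n > 0" for n
  proof -
    have "norm X / real n \<le> norm X / 1" using that by (intro divide_left_mono) auto
    then have R: "norm (X /\<^sub>R real n) \<le> R" using X eps_R eps_pos by (simp add: field_simps)
    have eq: "real n * norm (\<psi> (\<xi> (X /\<^sub>R real n))) = norm X"
      "real n *\<^sub>R \<psi> (\<xi> (X /\<^sub>R real n)) = X"
      using psi_xi[OF scale_V[OF X(1)] R] that by simp_all
    have "norm X \<le> \<epsilon>" using X eps_pos by linarith
    then show ?thesis
      using pow_chart[OF xi_U[OF scale_V[OF X(1)] R], of n] psi_V unfolding eq by blast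
  qed
  have ev: "\<forall>\<^sub>F n in sequentially. ?a n \<in> V" "\<forall>\<^sub>F n in sequentially. norm (?a n - X) \<le> C * (norm X)\<^sup>2"
    "\<forall>\<^sub>F n in sequentially. norm (?a n) \<le> 2 * norm X"
    using eventually_gt_at_top[of 0] by (eventually_elim, use p in blast)+
  have "Y \<in> V" by (rule Lim_in_closed_set[OF closed_V ev(1) _ Y]) simp
  moreover have "norm (Y - X) \<le> C * (norm X)\<^sup>2"
    by (rule Lim_norm_ubound[OF _ tendsto_diff[OF Y tendsto_const] ev(2)]) simp
  moreover have "norm Y \<le> 2 * norm X"
    by (rule Lim_norm_ubound[OF _ Y ev(3)]) simp
  ultimately show ?thesis using Y that by blast
qed

text \<open>The compound interest formula. For large X the first members are arbitrary, as
  \<open>\<xi>\<close> is then applied outside the chart image, but the limit does not see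
  them.\<close>

definition Exp :: "'e \<Rightarrow> 'g" where
  "Exp X = lim (\<lambda>n. \<xi> (X /\<^sub>R real (Suc n)) [^] Suc n)"

text \<open>Named so that a single limit can be asserted for all such pairs of sequences at once,
  before that limit is identified with \<open>Exp X\<close>.\<close>

definition infinitesimal_power :: "(nat \<Rightarrow> 'g) \<Rightarrow> (nat \<Rightarrow> nat) \<Rightarrow> 'e \<Rightarrow> bool" where
  "infinitesimal_power x k X \<longleftrightarrow> (\<forall>\<^sub>F n in sequentially. x n \<in> U) \<and> (\<lambda>n. \<psi> (x n)) \<longlonglongrightarrow> 0 \<and>
     (\<lambda>n. real (k n) *\<^sub>R \<psi> (x n)) \<longlonglongrightarrow> X"

text \<open>If X is nonzero, k n tends to infinity, and \<open>pow_diff\<close> bounds the distance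
  to the reference powers of step X / k n by 4 times the norm of
  \<open>real (k n) *\<^sub>R \<psi> (x n) - X\<close>. If X = 0, k n may stay bounded and the
  reference sequence is of no help, but then \<open>pow_chart\<close> itself forces the coordinates
  of the powers to 0.\<close>

lemma small_pow_tendsto:
  assumes X: "X \<in> V" "norm X \<le> \<epsilon> / 4"
    and x: "\<forall>\<^sub>F n in sequentially. x n \<in> U" "(\<lambda>n. \<psi> (x n)) \<longlonglongrightarrow> 0"
    and k: "(\<lambda>n. real (k n) *\<^sub>R \<psi> (x n)) \<longlonglongrightarrow> X"
    and Y: "Y \<in> V" "norm Y \<le> 2 * norm X" "(\<lambda>n. \<psi> (\<xi> (X /\<^sub>R real n) [^] n)) \<longlonglongrightarrow> Y"
  shows "(\<lambda>n. x n [^] k n) \<longlonglongrightarrow> \<xi> Y"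
proof -
  have "(\<lambda>n. norm (real (k n) *\<^sub>R \<psi> (x n))) \<longlonglongrightarrow> norm X" by (intro tendsto_norm k)
  then have "\<forall>\<^sub>F n in sequentially. norm (real (k n) *\<^sub>R \<psi> (x n)) < \<epsilon>"
    by (rule order_tendstoD(2)) (use X eps_pos in auto)
  then have ev: "\<forall>\<^sub>F n in sequentially. x n \<in> U \<and> real (k n) * norm (\<psi> (x n)) \<le> \<epsilon>"
    using x(1) by eventually_elim simp
  have "(\<lambda>n. \<psi> (x n [^] k n)) \<longlonglongrightarrow> Y"
  proof (cases "X = 0")
    case True
    have lim: "(\<lambda>n. 2 * norm (real (k n) *\<^sub>R \<psi> (x n))) \<longlonglongrightarrow> 0"
      using tendsto_mult_left[OF tendsto_norm[OF k], of 2] True by simp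
    have "\<forall>\<^sub>F n in sequentially. norm (\<psi> (x n [^] k n)) \<le> 2 * norm (real (k n) *\<^sub>R \<psi> (x n))"
      using ev
    proof eventually_elim
      case (elim n)
      then show ?case using pow_chart[of "x n" "k n"] by simp
    qed
    then have "(\<lambda>n. \<psi> (x n [^] k n)) \<longlonglongrightarrow> 0" by (rule Lim_null_comparison[OF _ lim])
    moreover have "Y = 0" using Y(2) True by simp
    ultimately show ?thesis by simp
  next
    case False
    have inf: "filterlim k at_top sequentially"
    proof -
      have ev1: "\<forall>\<^sub>F n in sequentially. norm (real (k n) *\<^sub>R \<psi> (x n)) > norm X / 2"
        using k False by (intro order_tendstoD(1)[OF tendsto_norm]) auto
      show ?thesis unfolding filterlim_at_top
      proof
        fix Z :: nat
        have "\<forall>\<^sub>F n in sequentially. norm (\<psi> (x n)) < norm X / (2 * (real Z + 1))"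
          using tendsto_norm[OF x(2)] False by (intro order_tendstoD(2)) auto
        then show "\<forall>\<^sub>F n in sequentially. Z \<le> k n" using ev1
        proof eventually_elim
          case (elim n)
          have "norm X / 2 < real (k n) * norm (\<psi> (x n))" using elim by simp
          also have "\<dots> \<le> real (k n) * (norm X / (2 * (real Z + 1)))"
            using elim by (intro mult_left_mono) auto
          finally have "norm X * (real Z + 1) < norm X * real (k n)" by (simp add: field_simps)
          then have "real Z + 1 < real (k n)" using False by (simp add: mult_less_cancel_left_pos)
          then show ?case by linarith
        qed
      qed
    qed
    have lim2: "(\<lambda>n. \<psi> (\<xi> (X /\<^sub>R real (k n)) [^] k n)) \<longlonglongrightarrow> Y"
      using filterlim_compose[OF Y(3) inf] .
    have "(\<lambda>n. \<psi> (x n [^] k n) - \<psi> (\<xi> (X /\<^sub>R real (k n)) [^] k n)) \<longlonglongrightarrow> 0"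
    proof (rule Lim_null_comparison)
      have "\<forall>\<^sub>F n in sequentially. k n > 0" by (rule eventually_compose_filterlim[OF eventually_gt_at_top inf])
      then show "\<forall>\<^sub>F n in sequentially. norm (\<psi> (x n [^] k n) - \<psi> (\<xi> (X /\<^sub>R real (k n)) [^] k n))
          \<le> 4 * norm (real (k n) *\<^sub>R \<psi> (x n) - X)"
        using ev
      proof eventually_elim
        case (elim n)
        have "norm X / real (k n) \<le> norm X / 1" using elim by (intro divide_left_mono) auto
        then have R: "norm (X /\<^sub>R real (k n)) \<le> R" using X eps_R eps_pos by (simp add: field_simps)
        note ps = psi_xi[OF scale_V[OF X(1)] R]
        have "norm (\<psi> (x n [^] k n) - \<psi> (\<xi> (X /\<^sub>R real (k n)) [^] k n))
            \<le> 4 * (real (k n) * norm (\<psi> (x n) - X /\<^sub>R real (k n)))"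
        proof -
          have "real (k n) * norm (X /\<^sub>R real (k n)) = norm X" using elim by simp
          then have "real (k n) * norm (\<psi> (\<xi> (X /\<^sub>R real (k n)))) \<le> \<epsilon>"
            unfolding ps using X eps_pos by linarith
          then show ?thesis
            using pow_diff[OF _ xi_U[OF scale_V[OF X(1)] R], of "x n" "k n"] elim unfolding ps by blast
        qed
        also have "real (k n) * norm (\<psi> (x n) - X /\<^sub>R real (k n)) =
            norm (real (k n) *\<^sub>R (\<psi> (x n) - X /\<^sub>R real (k n)))" by simp
        also have "\<dots> = norm (real (k n) *\<^sub>R \<psi> (x n) - X)"
          using elim by (simp add: scaleR_diff_right)
        finally show ?case .
      qed
      have "(\<lambda>n. 4 * norm (real (k n) *\<^sub>R \<psi> (x n) - X)) \<longlonglongrightarrow> 4 * norm (X - X)"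
        by (intro tendsto_intros k)
      then show "(\<lambda>n. 4 * norm (real (k n) *\<^sub>R \<psi> (x n) - X)) \<longlonglongrightarrow> 0" by simp
    qed
    from tendsto_add[OF this lim2] show ?thesis by simp
  qed
  moreover have "\<forall>\<^sub>F n in sequentially. x n [^] k n \<in> U"
    using ev by eventually_elim (use pow_chart in auto)
  ultimately show ?thesis
    using Y X eps_R eps_pos by (intro tendsto_xi) auto
qed

text \<open>Reduction of large X to X / N. The exponent is split as N times \<open>k n div N\<close>
  plus \<open>k n mod N\<close>: the quotients give infinitesimal powers for X / N, and the
  remainder, being less than N, contributes nothing in the limit. Taking N-th powers at the end is
  continuous.\<close>

lemma pow_tendsto_Exp_aux:
  assumes X: "X \<in> V" and N: "N > 0" "norm X / real N \<le> \<epsilon> / 4"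
  obtains g where "\<forall>x k. infinitesimal_power x k X \<longrightarrow> (\<lambda>n. x n [^] k n) \<longlonglongrightarrow> g [^] N"
    "g \<in> U" "norm (\<psi> g - X /\<^sub>R real N) \<le> C * (norm X / real N)\<^sup>2"
proof -
  let ?X = "X /\<^sub>R real N"
  have sm: "?X \<in> V" "norm ?X \<le> \<epsilon> / 4" using scale_V[OF X] N by (auto simp: field_simps)
  have sm': "norm ?X \<le> \<epsilon> / 2" using sm(2) eps_pos by linarith
  obtain Y where Y: "Y \<in> V" "norm (Y - ?X) \<le> C * (norm ?X)\<^sup>2" "norm Y \<le> 2 * norm ?X"
    "(\<lambda>n. \<psi> (\<xi> (?X /\<^sub>R real n) [^] n)) \<longlonglongrightarrow> Y" by (rule pow_limit[OF sm(1) sm'])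
  have YR: "norm Y \<le> R" using Y sm eps_R eps_pos by linarith
  have zero: "(\<lambda>n. \<psi> (\<xi> (0 /\<^sub>R real n) [^] n)) \<longlonglongrightarrow> 0" by simp
  have "(\<lambda>n. x n [^] k n) \<longlonglongrightarrow> \<xi> Y [^] N"
    if "infinitesimal_power x k X" for x k
  proof -
    have x: "\<forall>\<^sub>F n in sequentially. x n \<in> U" "(\<lambda>n. \<psi> (x n)) \<longlonglongrightarrow> 0"
      "(\<lambda>n. real (k n) *\<^sub>R \<psi> (x n)) \<longlonglongrightarrow> X"
      using that by (auto simp: infinitesimal_power_def)
    have rem: "(\<lambda>n. real (k n mod N) *\<^sub>R \<psi> (x n)) \<longlonglongrightarrow> 0"
    proof (rule Lim_null_comparison)
      show "\<forall>\<^sub>F n in sequentially. norm (real (k n mod N) *\<^sub>R \<psi> (x n)) \<le> real N * norm (\<psi> (x n))"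
        using N by (auto intro!: always_eventually mult_right_mono)
      show "(\<lambda>n. real N * norm (\<psi> (x n))) \<longlonglongrightarrow> 0"
        using tendsto_mult_right_zero[OF tendsto_norm_zero[OF x(2)]] .
    qed
    have "(\<lambda>n. (real (k n) *\<^sub>R \<psi> (x n) - real (k n mod N) *\<^sub>R \<psi> (x n)) /\<^sub>R real N) \<longlonglongrightarrow> (X - 0) /\<^sub>R real N"
      by (intro tendsto_intros x rem)
    moreover have "(real (k n) *\<^sub>R \<psi> (x n) - real (k n mod N) *\<^sub>R \<psi> (x n)) /\<^sub>R real N
        = real (k n div N) *\<^sub>R \<psi> (x n)" for n
    proof -
      have "real (k n) - real (k n mod N) = real N * real (k n div N)"
        by (metis (no_types, lifting) add_diff_cancel_right' mult_div_mod_eq of_nat_add of_nat_mult)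
      then show ?thesis using N by (simp flip: scaleR_diff_left)
    qed
    ultimately have quo: "(\<lambda>n. real (k n div N) *\<^sub>R \<psi> (x n)) \<longlonglongrightarrow> ?X" by simp
    have 1: "(\<lambda>n. x n [^] (k n div N)) \<longlonglongrightarrow> \<xi> Y"
      by (rule small_pow_tendsto[OF sm x(1,2) quo Y(1,3,4)])
    have 2: "(\<lambda>n. x n [^] (k n mod N)) \<longlonglongrightarrow> \<xi> 0"
      using eps_pos by (intro small_pow_tendsto[OF _ _ x(1,2) rem _ _ zero])
        (auto simp: subspace_0[OF subspace_V])
    have "(\<lambda>n. (x n [^] (k n div N)) [^] N \<otimes> x n [^] (k n mod N)) \<longlonglongrightarrow> \<xi> Y [^] N \<otimes> \<xi> 0"
      by (intro tendsto_mult_group tendsto_pow_group 1 2)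
    moreover have "(x n [^] (k n div N)) [^] N \<otimes> x n [^] (k n mod N) = x n [^] k n" for n
      by (simp add: nat_pow_pow nat_pow_mult)
    ultimately show ?thesis by simp
  qed
  moreover have "\<xi> Y \<in> U" "\<psi> (\<xi> Y) = Y" using xi_U psi_xi Y YR by auto
  ultimately show ?thesis using Y(2) N by (intro that[of "\<xi> Y"]) (auto simp: field_simps)
qed

lemma
  assumes X: "X \<in> V"
  shows xi_seq_U: "\<forall>\<^sub>F n in sequentially. \<xi> (X /\<^sub>R real (Suc n)) \<in> U"
    and psi_xi_seq: "\<forall>\<^sub>F n in sequentially. \<psi> (\<xi> (X /\<^sub>R real (Suc n))) = X /\<^sub>R real (Suc n)"
    and psi_xi_seq_tendsto: "(\<lambda>n. \<psi> (\<xi> (X /\<^sub>R real (Suc n)))) \<longlonglongrightarrow> 0"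
proof -
  have lim: "(\<lambda>n. X /\<^sub>R real (Suc n)) \<longlonglongrightarrow> 0"
    using tendsto_scaleR[OF LIMSEQ_inverse_real_of_nat tendsto_const, of X] by simp
  then have "\<forall>\<^sub>F n in sequentially. norm (X /\<^sub>R real (Suc n)) < R"
    using R_pos tendsto_norm_zero order_tendstoD(2) by fastforce
  then have ev: "\<forall>\<^sub>F n in sequentially. \<xi> (X /\<^sub>R real (Suc n)) \<in> U \<and>
      \<psi> (\<xi> (X /\<^sub>R real (Suc n))) = X /\<^sub>R real (Suc n)"
    by eventually_elim (use xi_U psi_xi scale_V[OF X] in force)
  then show "\<forall>\<^sub>F n in sequentially. \<xi> (X /\<^sub>R real (Suc n)) \<in> U"
    and eq: "\<forall>\<^sub>F n in sequentially. \<psi> (\<xi> (X /\<^sub>R real (Suc n))) = X /\<^sub>R real (Suc n)"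
    by (auto elim: eventually_mono)
  show "(\<lambda>n. \<psi> (\<xi> (X /\<^sub>R real (Suc n)))) \<longlonglongrightarrow> 0"
    by (rule Lim_transform_eventually[OF lim]) (use eq in \<open>auto elim: eventually_mono\<close>)
qed

lemma scaled_xi_seq:
  assumes X: "X \<in> V" and k: "(\<lambda>n. real (k n) / real (Suc n)) \<longlonglongrightarrow> s"
  shows "(\<lambda>n. real (k n) *\<^sub>R \<psi> (\<xi> (X /\<^sub>R real (Suc n)))) \<longlonglongrightarrow> s *\<^sub>R X"
proof (rule Lim_transform_eventually)
  show "(\<lambda>n. (real (k n) / real (Suc n)) *\<^sub>R X) \<longlonglongrightarrow> s *\<^sub>R X" by (intro tendsto_intros k)
  show "\<forall>\<^sub>F n in sequentially. (real (k n) / real (Suc n)) *\<^sub>R X = real (k n) *\<^sub>R \<psi> (\<xi> (X /\<^sub>R real (Suc n)))"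
    using psi_xi_seq[OF X] by eventually_elim (simp add: divide_inverse)
qed

text \<open>The sequence defining \<open>Exp X\<close> is one of the infinitesimal powers for X, so
  the limit common to all of them is \<open>Exp X\<close>, whatever N was used to find it.\<close>

lemma Exp_eq_pow:
  assumes X: "X \<in> V" and N: "N > 0" "norm X / real N \<le> \<epsilon> / 4"
  obtains g where "\<forall>x k. infinitesimal_power x k X \<longrightarrow> (\<lambda>n. x n [^] k n) \<longlonglongrightarrow> Exp X"
    "Exp X = g [^] N" "g \<in> U" "norm (\<psi> g - X /\<^sub>R real N) \<le> C * (norm X / real N)\<^sup>2"
proof -
  obtain g where g: "\<forall>x k. infinitesimal_power x k X \<longrightarrow> (\<lambda>n. x n [^] k n) \<longlonglongrightarrow> g [^] N"
    "g \<in> U" "norm (\<psi> g - X /\<^sub>R real N) \<le> C * (norm X / real N)\<^sup>2"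
    by (rule pow_tendsto_Exp_aux[OF assms])
  have "(\<lambda>n. real (Suc n) *\<^sub>R \<psi> (\<xi> (X /\<^sub>R real (Suc n)))) \<longlonglongrightarrow> 1 *\<^sub>R X"
    by (intro scaled_xi_seq X) simp
  then have "infinitesimal_power (\<lambda>n. \<xi> (X /\<^sub>R real (Suc n))) Suc X"
    by (simp add: infinitesimal_power_def xi_seq_U[OF X, simplified]
        psi_xi_seq_tendsto[OF X, simplified])
  then have "(\<lambda>n. \<xi> (X /\<^sub>R real (Suc n)) [^] Suc n) \<longlonglongrightarrow> g [^] N" using g(1) by blast
  then have "Exp X = g [^] N" unfolding Exp_def by (rule limI)
  then show ?thesis using g by (intro that[of g]) auto
qed

lemma exists_divisor:
  fixes x :: real
  obtains N :: nat where "N > 0" "x / real N \<le> \<epsilon> / 4"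
proof -
  obtain N where "real N > 4 * x / \<epsilon>" using reals_Archimedean2 by blast
  then have "x / real (Suc N) \<le> \<epsilon> / 4" using eps_pos by (simp add: field_simps)
  then show ?thesis using that by blast
qed

text \<open>The source of the later identities for \<open>Exp\<close>: only the first-order size of
  x n and the number of factors matter, so an identity is proved by exhibiting suitable
  powers.\<close>

theorem pow_tendsto_Exp:
  assumes "\<forall>\<^sub>F n in sequentially. x n \<in> U" "(\<lambda>n. \<psi> (x n)) \<longlonglongrightarrow> 0"
    "(\<lambda>n. real (k n) *\<^sub>R \<psi> (x n)) \<longlonglongrightarrow> X"
  shows "(\<lambda>n. x n [^] k n) \<longlonglongrightarrow> Exp X"
proof -
  have "X \<in> V"
    by (rule Lim_in_closed_set[OF closed_V _ _ assms(3)])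
      (use assms(1) psi_V scale_V in \<open>auto elim!: eventually_mono\<close>)
  moreover obtain N where "N > 0" "norm X / real N \<le> \<epsilon> / 4" by (rule exists_divisor)
  ultimately show ?thesis
    by (rule Exp_eq_pow) (use assms in \<open>auto simp: infinitesimal_power_def\<close>)
qed

lemma Exp_chart:
  assumes "X \<in> V" "norm X \<le> \<epsilon> / 4"
  shows "Exp X \<in> U" "norm (\<psi> (Exp X) - X) \<le> C * (norm X)\<^sup>2"
proof -
  obtain g where "Exp X = g [^] (1::nat)" "g \<in> U" "norm (\<psi> g - X /\<^sub>R real 1) \<le> C * (norm X / real 1)\<^sup>2"
    using Exp_eq_pow[of X 1] assms by auto
  then show "Exp X \<in> U" "norm (\<psi> (Exp X) - X) \<le> C * (norm X)\<^sup>2" by auto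
qed

end

lemma has_vector_derivative_iff_quotient:
  "(f has_vector_derivative D) (at x) \<longleftrightarrow> ((\<lambda>h. (f (x + h) - f x) /\<^sub>R h) \<longlongrightarrow> D) (at 0)"
proof -
  have "((\<lambda>h. norm (f (x + h) - f x - h *\<^sub>R D) / norm h) \<longlongrightarrow> 0) (at 0) \<longleftrightarrow>
      ((\<lambda>h. norm ((f (x + h) - f x) /\<^sub>R h - D)) \<longlongrightarrow> 0) (at 0)"
  proof (rule tendsto_cong)
    have "norm (f (x + h) - f x - h *\<^sub>R D) / norm h = norm ((f (x + h) - f x) /\<^sub>R h - D)" if "h \<noteq> 0" for h
    proof -
      have "(f (x + h) - f x) /\<^sub>R h - D = (f (x + h) - f x - h *\<^sub>R D) /\<^sub>R h"
        using that by (simp add: scaleR_diff_right)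
      then show ?thesis by (simp add: divide_inverse mult.commute)
    qed
    then show "\<forall>\<^sub>F h in at 0. norm (f (x + h) - f x - h *\<^sub>R D) / norm h = norm ((f (x + h) - f x) /\<^sub>R h - D)"
      by (auto simp: eventually_at intro: exI[of _ 1])
  qed
  then show ?thesis
    by (simp add: has_vector_derivative_def has_derivative_at bounded_linear_scaleR_left
        tendsto_norm_zero_iff LIM_zero_iff)
qed

lemma has_vector_derivative_sequentially:
  assumes "(f has_vector_derivative D) (at x)" "a \<longlonglongrightarrow> 0" "\<And>n. a n \<noteq> 0"
  shows "(\<lambda>n. (f (x + a n) - f x) /\<^sub>R a n) \<longlonglongrightarrow> D"
proof -
  have "filterlim a (at 0) sequentially" using assms by (auto simp: filterlim_at)
  from filterlim_compose[OF assms(1)[unfolded has_vector_derivative_iff_quotient] this]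
  show ?thesis .
qed

lemma inverse_Suc_tendsto: "(\<lambda>n. 1 / real (Suc n)) \<longlonglongrightarrow> 0"
  using LIMSEQ_inverse_real_of_nat by (simp add: inverse_eq_divide)

section \<open>One-parameter subgroups\<close>

context group_chart
begin

lemma Exp_zero [simp]: "Exp 0 = \<one>"
  using pow_tendsto_Exp[of "\<lambda>_. \<one>" "\<lambda>_. 0" 0] by (simp add: LIMSEQ_const_iff)

lemma Exp_add_nonneg:
  assumes X: "X \<in> V" and "s \<ge> 0" "t \<ge> 0"
  shows "Exp ((s + t) *\<^sub>R X) = Exp (s *\<^sub>R X) \<otimes> Exp (t *\<^sub>R X)"
proof -
  let ?x = "\<lambda>n. \<xi> (X /\<^sub>R real (Suc n))"
  \<comment> \<open>Exponents close to s (n + 1). The sum of the exponents for s and t need not be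
    the one for s + t, but its ratio to n + 1 has the right limit, which suffices.\<close>
  let ?k = "\<lambda>s n. nat \<lfloor>s / (1 / real (Suc n))\<rfloor>"
  have k: "(\<lambda>n. real (?k r n) / real (Suc n)) \<longlonglongrightarrow> r" if "r \<ge> 0" for r
    using nat_floor_ratio_tendsto[OF that, of "\<lambda>n. 1 / real (Suc n)"] LIMSEQ_inverse_real_of_nat
    by (simp add: inverse_eq_divide)
  have lim: "(\<lambda>n. ?x n [^] j n) \<longlonglongrightarrow> Exp (r *\<^sub>R X)" if "(\<lambda>n. real (j n) / real (Suc n)) \<longlonglongrightarrow> r" for j r
    by (rule pow_tendsto_Exp[OF xi_seq_U[OF X] psi_xi_seq_tendsto[OF X] scaled_xi_seq[OF X that]])
  have "(\<lambda>n. ?x n [^] ?k s n \<otimes> ?x n [^] ?k t n) \<longlonglongrightarrow> Exp (s *\<^sub>R X) \<otimes> Exp (t *\<^sub>R X)"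
    by (intro tendsto_mult_group lim k assms)
  moreover have "(\<lambda>n. ?x n [^] (?k s n + ?k t n)) \<longlonglongrightarrow> Exp ((s + t) *\<^sub>R X)"
    using tendsto_add[OF k[OF assms(2)] k[OF assms(3)]] by (intro lim) (simp add: add_divide_distrib)
  then have "(\<lambda>n. ?x n [^] ?k s n \<otimes> ?x n [^] ?k t n) \<longlonglongrightarrow> Exp ((s + t) *\<^sub>R X)"
    by (simp add: nat_pow_mult)
  ultimately show ?thesis using LIMSEQ_unique by blast
qed

lemma tendsto_one_psi: "x \<longlonglongrightarrow> \<one> \<Longrightarrow> (\<lambda>n. \<psi> (x n)) \<longlonglongrightarrow> 0"
  using tendsto_psi(2)[of x \<one> sequentially] by simp

text \<open>The product estimate for x and its inverse shows that their coordinates cancel up to an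
  error of second order, so the powers of the inverses converge to \<open>Exp (- X)\<close>.\<close>

lemma Exp_minus:
  assumes X: "X \<in> V"
  shows "Exp (- X) = inv (Exp X)"
proof -
  let ?x = "\<lambda>n. \<xi> (X /\<^sub>R real (Suc n))"
  have U: "\<forall>\<^sub>F n in sequentially. ?x n \<in> U" and psi: "(\<lambda>n. \<psi> (?x n)) \<longlonglongrightarrow> 0"
    and sc: "(\<lambda>n. real (Suc n) *\<^sub>R \<psi> (?x n)) \<longlonglongrightarrow> X"
    using xi_seq_U[OF X] psi_xi_seq_tendsto[OF X] scaled_xi_seq[OF X, of Suc 1] by simp_all
  have "?x \<longlonglongrightarrow> \<xi> 0"
    by (rule tendsto_xi[OF U psi]) (use R_pos subspace_0[OF subspace_V] in auto)
  then have inv1: "(\<lambda>n. inv (?x n)) \<longlonglongrightarrow> \<one>" using tendsto_inv_group by fastforce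
  have U': "\<forall>\<^sub>F n in sequentially. inv (?x n) \<in> U" using tendsto_psi(1)[OF inv1] by simp
  note psi' = tendsto_one_psi[OF inv1]
  have R1: "\<forall>\<^sub>F n in sequentially. norm (\<psi> (?x n)) < R" "\<forall>\<^sub>F n in sequentially. norm (\<psi> (inv (?x n))) < R"
    using R_pos tendsto_norm_zero[OF psi] tendsto_norm_zero[OF psi'] order_tendstoD(2) by blast+
  have "(\<lambda>n. real (Suc n) *\<^sub>R (\<psi> (?x n) + \<psi> (inv (?x n)))) \<longlonglongrightarrow> 0"
  proof (rule Lim_null_comparison)
    show "\<forall>\<^sub>F n in sequentially. norm (real (Suc n) *\<^sub>R (\<psi> (?x n) + \<psi> (inv (?x n))))
        \<le> C * norm (real (Suc n) *\<^sub>R \<psi> (?x n)) * norm (\<psi> (inv (?x n)))"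
      using U U' R1
    proof eventually_elim
      case (elim n)
      have "norm (\<psi> (?x n) + \<psi> (inv (?x n))) \<le> C * norm (\<psi> (?x n)) * norm (\<psi> (inv (?x n)))"
        using mult_estimate[OF elim(1,2)] elim(3,4) norm_minus_cancel[of "\<psi> (?x n) + \<psi> (inv (?x n))"]
        by (simp add: add.commute del: norm_minus_cancel)
      then have "real (Suc n) * norm (\<psi> (?x n) + \<psi> (inv (?x n))) \<le>
          real (Suc n) * (C * norm (\<psi> (?x n)) * norm (\<psi> (inv (?x n))))"
        by (intro mult_left_mono) auto
      then show ?case by (simp only: norm_scaleR abs_of_nat mult_ac)
    qed
    have "(\<lambda>n. C * norm (real (Suc n) *\<^sub>R \<psi> (?x n)) * norm (\<psi> (inv (?x n)))) \<longlonglongrightarrow> C * norm X * norm (0 :: 'e)"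
      by (intro tendsto_intros sc psi')
    then show "(\<lambda>n. C * norm (real (Suc n) *\<^sub>R \<psi> (?x n)) * norm (\<psi> (inv (?x n)))) \<longlonglongrightarrow> 0" by simp
  qed
  from tendsto_diff[OF this sc]
  have "(\<lambda>n. real (Suc n) *\<^sub>R \<psi> (inv (?x n))) \<longlonglongrightarrow> - X" by (simp add: scaleR_add_right)
  from pow_tendsto_Exp[OF U' psi' this]
  have 1: "(\<lambda>n. inv (?x n) [^] Suc n) \<longlonglongrightarrow> Exp (- X)" .
  have 2: "(\<lambda>n. inv (?x n [^] Suc n)) \<longlonglongrightarrow> inv (Exp X)"
    by (intro tendsto_inv_group pow_tendsto_Exp U psi sc)
  have "inv (?x n) [^] Suc n = inv (?x n [^] Suc n)" for n by (rule nat_pow_inv) simp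
  with 2 have "(\<lambda>n. inv (?x n) [^] Suc n) \<longlonglongrightarrow> inv (Exp X)" by (simp only:)
  with 1 show ?thesis by (rule LIMSEQ_unique)
qed

lemma Exp_add:
  assumes X: "X \<in> V"
  shows "Exp ((s + t) *\<^sub>R X) = Exp (s *\<^sub>R X) \<otimes> Exp (t *\<^sub>R X)"
proof -
  have shift: "Exp ((r + c) *\<^sub>R X) = Exp (r *\<^sub>R X) \<otimes> Exp (c *\<^sub>R X)" if "c \<ge> \<bar>r\<bar>" for r c
  proof (cases "r \<ge> 0")
    case False
    have "Exp ((- r + (r + c)) *\<^sub>R X) = inv (Exp (r *\<^sub>R X)) \<otimes> Exp ((r + c) *\<^sub>R X)"
      using Exp_add_nonneg[OF X, of "- r" "r + c"] Exp_minus[OF scale_V[OF X], of r] False that by simp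
    then show ?thesis by (simp add: m_assoc[symmetric])
  qed (use Exp_add_nonneg[OF X] that in simp)
  \<comment> \<open>Shifting by c makes s + c and t + c nonnegative; both sides are compared after
    multiplication by \<open>Exp ((2 * c) *\<^sub>R X)\<close>, which is cancelled at the
    end.\<close>
  define c where "c = \<bar>s\<bar> + \<bar>t\<bar>"
  have "Exp ((s + t) *\<^sub>R X) \<otimes> Exp ((2 * c) *\<^sub>R X) = Exp ((s + t + 2 * c) *\<^sub>R X)"
    by (rule shift[symmetric]) (simp add: c_def)
  also have "\<dots> = Exp ((s + c) *\<^sub>R X) \<otimes> Exp ((t + c) *\<^sub>R X)"
    using Exp_add_nonneg[OF X, of "s + c" "t + c"] by (simp add: c_def algebra_simps)
  also have "\<dots> = Exp (s *\<^sub>R X) \<otimes> (Exp (c *\<^sub>R X) \<otimes> Exp ((t + c) *\<^sub>R X))"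
    by (subst shift) (simp_all add: c_def m_assoc)
  also have "Exp (c *\<^sub>R X) \<otimes> Exp ((t + c) *\<^sub>R X) = Exp ((c + (t + c)) *\<^sub>R X)"
    by (rule Exp_add_nonneg[OF X, symmetric]) (auto simp: c_def)
  also have "c + (t + c) = t + 2 * c" by simp
  also have "Exp ((t + 2 * c) *\<^sub>R X) = Exp (t *\<^sub>R X) \<otimes> Exp ((2 * c) *\<^sub>R X)"
    by (rule shift) (simp add: c_def)
  finally show ?thesis by (simp add: m_assoc[symmetric])
qed

lemma Exp_tendsto_one:
  assumes "(x \<longlongrightarrow> 0) F" "\<forall>\<^sub>F n in F. x n \<in> V"
  shows "((\<lambda>n. Exp (x n)) \<longlongrightarrow> \<one>) F"
proof -
  have ev: "\<forall>\<^sub>F n in F. norm (x n) < \<epsilon> / 4"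
    using tendsto_norm_zero[OF assms(1)] eps_pos by (intro order_tendstoD(2)) auto
  have U: "\<forall>\<^sub>F n in F. Exp (x n) \<in> U"
    using ev assms(2) by eventually_elim (use Exp_chart in auto)
  have "((\<lambda>n. \<psi> (Exp (x n)) - x n) \<longlongrightarrow> 0) F"
  proof (rule Lim_null_comparison)
    show "\<forall>\<^sub>F n in F. norm (\<psi> (Exp (x n)) - x n) \<le> C * (norm (x n))\<^sup>2"
      using ev assms(2) by eventually_elim (use Exp_chart in auto)
    have "((\<lambda>n. C * (norm (x n))\<^sup>2) \<longlongrightarrow> C * (norm (0::'e))\<^sup>2) F" by (intro tendsto_intros assms)
    then show "((\<lambda>n. C * (norm (x n))\<^sup>2) \<longlongrightarrow> 0) F" by simp
  qed
  from tendsto_add[OF this assms(1)] have "((\<lambda>n. \<psi> (Exp (x n))) \<longlongrightarrow> 0) F" by simp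
  from tendsto_xi[OF U this] show ?thesis using R_pos subspace_0[OF subspace_V] by simp
qed

lemma Exp_line_tendsto:
  assumes X: "X \<in> V" and "(x \<longlongrightarrow> s) F"
  shows "((\<lambda>n. Exp (x n *\<^sub>R X)) \<longlongrightarrow> Exp (s *\<^sub>R X)) F"
proof -
  have "((\<lambda>n. (x n - s) *\<^sub>R X) \<longlongrightarrow> (s - s) *\<^sub>R X) F" by (intro tendsto_intros assms)
  then have "((\<lambda>n. Exp ((x n - s) *\<^sub>R X)) \<longlongrightarrow> \<one>) F"
    by (intro Exp_tendsto_one) (auto simp: scale_V[OF X])
  from tendsto_mult_group[OF this tendsto_const[of "Exp (s *\<^sub>R X)"]]
  show ?thesis by (simp add: Exp_add[OF X, symmetric])
qed

lemma continuous_on_Exp_line: "X \<in> V \<Longrightarrow> continuous_on UNIV (\<lambda>s. Exp (s *\<^sub>R X))"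
  unfolding continuous_on_def by (auto intro: Exp_line_tendsto tendsto_ident_at)

lemma psi_Exp_has_derivative:
  assumes X: "X \<in> V"
  shows "((\<lambda>s. \<psi> (Exp (s *\<^sub>R X))) has_vector_derivative X) (at 0)"
proof -
  have "((\<lambda>h. norm (\<psi> (Exp (h *\<^sub>R X)) - h *\<^sub>R X) / norm h) \<longlongrightarrow> 0) (at 0)"
  proof (rule Lim_null_comparison)
    have "((\<lambda>h. norm (h *\<^sub>R X)) \<longlongrightarrow> norm (0 *\<^sub>R X)) (at 0)" by (intro tendsto_intros)
    then have "\<forall>\<^sub>F h in at 0. norm (h *\<^sub>R X) < \<epsilon> / 4" using eps_pos by (intro order_tendstoD(2)) auto
    then show "\<forall>\<^sub>F h in at 0. norm (norm (\<psi> (Exp (h *\<^sub>R X)) - h *\<^sub>R X) / norm h) \<le> C * (norm X)\<^sup>2 * \<bar>h\<bar>"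
      using eventually_at_ball'[OF zero_less_one, of 0 UNIV]
    proof eventually_elim
      case (elim h)
      then have "norm (\<psi> (Exp (h *\<^sub>R X)) - h *\<^sub>R X) \<le> C * (norm (h *\<^sub>R X))\<^sup>2"
        using Exp_chart[OF scale_V[OF X], of h] by simp
      then show ?case using elim by (simp add: field_simps power2_eq_square)
    qed
    have "((\<lambda>h::real. C * (norm X)\<^sup>2 * \<bar>h\<bar>) \<longlongrightarrow> C * (norm X)\<^sup>2 * \<bar>0\<bar>) (at 0)" by (intro tendsto_intros)
    then show "((\<lambda>h::real. C * (norm X)\<^sup>2 * \<bar>h\<bar>) \<longlongrightarrow> 0) (at 0)" by simp
  qed
  then show ?thesis
    by (simp add: has_vector_derivative_def has_derivative_at bounded_linear_scaleR_left)
qed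

lemma hom_pow:
  fixes \<gamma> :: "real \<Rightarrow> 'g"
  assumes "\<And>s t. \<gamma> (s + t) = \<gamma> s \<otimes> \<gamma> t"
  shows "\<gamma> 0 = \<one>" "\<gamma> (real k * s) = \<gamma> s [^] k" "\<gamma> (- s) = inv (\<gamma> s)"
proof -
  show 0: "\<gamma> 0 = \<one>" using assms[of 0 0] by (metis UNIV_I add_0 carrier_UNIV l_cancel_one')
  show "\<gamma> (real k * s) = \<gamma> s [^] k"
  proof (induction k)
    case (Suc k)
    have "\<gamma> (real (Suc k) * s) = \<gamma> (real k * s + s)" by (simp add: algebra_simps)
    then show ?case using Suc by (simp add: assms)
  qed (simp add: 0)
  show "\<gamma> (- s) = inv (\<gamma> s)"
    using assms[of "- s" s] 0 by (metis UNIV_I ab_left_minus carrier_UNIV inv_equality)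
qed

lemma Exp_pow: "X \<in> V \<Longrightarrow> Exp ((real k * s) *\<^sub>R X) = Exp (s *\<^sub>R X) [^] k"
  by (rule hom_pow(2)[of "\<lambda>s. Exp (s *\<^sub>R X)"]) (rule Exp_add)

text \<open>A difference quotient that converges along one sequence of times suffices. At s /
  \<open>a n\<close> rounded down, times \<open>a n\<close>, the value of \<gamma> is a power of
  \<gamma> (a n) and so tends to \<open>Exp (s *\<^sub>R X)\<close>; by continuity it also tends to
  \<gamma> s.\<close>

lemma one_parameter_eq_Exp:
  fixes \<gamma> :: "real \<Rightarrow> 'g" and a :: "nat \<Rightarrow> real"
  assumes cont: "continuous_on UNIV \<gamma>" and hom: "\<And>s t. \<gamma> (s + t) = \<gamma> s \<otimes> \<gamma> t"
    and a: "\<And>n. a n > 0" "a \<longlonglongrightarrow> 0" and X: "(\<lambda>n. \<psi> (\<gamma> (a n)) /\<^sub>R a n) \<longlonglongrightarrow> X"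
  shows "X \<in> V" "\<gamma> s = Exp (s *\<^sub>R X)"
proof -
  have lim: "(\<lambda>n. \<gamma> (x n)) \<longlonglongrightarrow> \<gamma> t" if "x \<longlonglongrightarrow> t" for x t
    using continuous_on_tendsto_compose[OF cont that] by simp
  have one: "(\<lambda>n. \<gamma> (a n)) \<longlonglongrightarrow> \<one>" using lim[OF a(2)] by (simp add: hom_pow(1)[OF hom])
  have U: "\<forall>\<^sub>F n in sequentially. \<gamma> (a n) \<in> U" using tendsto_psi(1)[OF one] by simp
  have ev: "\<forall>\<^sub>F n in sequentially. \<psi> (\<gamma> (a n)) /\<^sub>R a n \<in> V"
    using U by eventually_elim (use psi_V scale_V in auto)
  show XV: "X \<in> V" by (rule Lim_in_closed_set[OF closed_V ev _ X]) simp
  have pos: "\<gamma> s = Exp (s *\<^sub>R X)" if "s \<ge> 0" for s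
  proof -
    let ?k = "\<lambda>n. nat \<lfloor>s / a n\<rfloor>"
    note k = nat_floor_ratio_tendsto[OF that a]
    have "(\<lambda>n. (real (?k n) * a n) *\<^sub>R (\<psi> (\<gamma> (a n)) /\<^sub>R a n)) \<longlonglongrightarrow> s *\<^sub>R X"
      by (intro tendsto_scaleR k X)
    moreover have "(real (?k n) * a n) *\<^sub>R (\<psi> (\<gamma> (a n)) /\<^sub>R a n) = real (?k n) *\<^sub>R \<psi> (\<gamma> (a n))" for n
      using a(1)[of n] by simp
    ultimately have "(\<lambda>n. real (?k n) *\<^sub>R \<psi> (\<gamma> (a n))) \<longlonglongrightarrow> s *\<^sub>R X" by (simp only:)
    from pow_tendsto_Exp[OF U tendsto_one_psi[OF one] this]
    have "(\<lambda>n. \<gamma> (real (?k n) * a n)) \<longlonglongrightarrow> Exp (s *\<^sub>R X)" by (simp add: hom_pow(2)[OF hom])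
    with lim[OF k] show ?thesis using LIMSEQ_unique by blast
  qed
  show "\<gamma> s = Exp (s *\<^sub>R X)"
  proof (cases "s \<ge> 0")
    case False
    then show ?thesis
      using pos[of "- s"] hom_pow(3)[OF hom, of s] Exp_minus[OF scale_V[OF XV], of s]
      by (metis UNIV_I carrier_UNIV inv_inv linorder_linear neg_0_le_iff_le scaleR_minus_left)
  qed (rule pos)
qed

lemma one_parameter_unique:
  fixes \<gamma> :: "real \<Rightarrow> 'g"
  assumes "continuous_on UNIV \<gamma>" "\<And>s t. \<gamma> (s + t) = \<gamma> s \<otimes> \<gamma> t"
    and "((\<lambda>s. \<psi> (\<gamma> s)) has_vector_derivative X) (at 0)"
  shows "X \<in> V" "\<gamma> s = Exp (s *\<^sub>R X)"
proof -
  have "(\<lambda>n. \<psi> (\<gamma> (1 / real (Suc n))) /\<^sub>R (1 / real (Suc n))) \<longlonglongrightarrow> X"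
    using has_vector_derivative_sequentially[OF assms(3) inverse_Suc_tendsto] hom_pow(1)[OF assms(2)]
    by simp
  from one_parameter_eq_Exp[OF assms(1,2) _ inverse_Suc_tendsto this]
  show "X \<in> V" "\<gamma> s = Exp (s *\<^sub>R X)" by auto
qed

text \<open>Continuity alone forces a derivative along some sequence. \<gamma> stays in the ball of
  radius \<epsilon> / 4 for times below d; since the powers of \<gamma> (a n) up to n + 1 belong to
  times at most d / 2, \<open>escape\<close> bounds the difference quotients, and a convergent
  subsequence provides X.\<close>

lemma continuous_hom_eq_Exp:
  fixes \<gamma> :: "real \<Rightarrow> 'g"
  assumes cont: "continuous_on UNIV \<gamma>" and hom: "\<And>s t. \<gamma> (s + t) = \<gamma> s \<otimes> \<gamma> t"
  obtains X where "X \<in> V" "\<forall>s. \<gamma> s = Exp (s *\<^sub>R X)"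
proof -
  have "(\<gamma> \<longlongrightarrow> \<one>) (at 0)"
    using cont hom_pow(1)[OF hom] unfolding continuous_on_def by (metis UNIV_I)
  from tendsto_psi[OF this] have "\<forall>\<^sub>F s in at 0. \<gamma> s \<in> U" "((\<lambda>s. \<psi> (\<gamma> s)) \<longlongrightarrow> 0) (at 0)" by auto
  then have "\<forall>\<^sub>F s in at 0. \<gamma> s \<in> U \<and> norm (\<psi> (\<gamma> s)) < \<epsilon> / 4"
    using eps_pos by (intro eventually_conj order_tendstoD(2)[OF tendsto_norm_zero]) auto
  then obtain d where d: "d > 0" "\<And>s. s \<noteq> 0 \<Longrightarrow> \<bar>s\<bar> < d \<Longrightarrow> \<gamma> s \<in> U \<and> norm (\<psi> (\<gamma> s)) < \<epsilon> / 4"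
    unfolding eventually_at by (auto simp: dist_real_def)
  then have near: "\<gamma> s \<in> U \<and> norm (\<psi> (\<gamma> s)) \<le> \<epsilon> / 4" if "\<bar>s\<bar> < d" for s
    using that eps_pos hom_pow(1)[OF hom] by (cases "s = 0") (auto simp: less_imp_le)
  define a where "a n = d / 2 / real (Suc n)" for n
  have a: "a n > 0" for n using d by (simp add: a_def)
  have a0: "a \<longlonglongrightarrow> 0"
    using tendsto_mult_right_zero[OF inverse_Suc_tendsto, of "d / 2"] by (simp add: a_def[abs_def])
  have le: "real (Suc n) * norm (\<psi> (\<gamma> (a n))) \<le> \<epsilon>" for n
  proof (rule escape)
    have ka: "\<bar>real k * a n\<bar> < d" if "k \<le> Suc n" for k
    proof -
      have "real k * a n \<le> real (Suc n) * a n" using that a[of n] by (intro mult_right_mono) auto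
      also have "\<dots> = d / 2" by (simp add: a_def del: of_nat_Suc)
      finally show ?thesis using d a[of n] by simp
    qed
    show "\<gamma> (a n) \<in> U" using near[OF ka[of 1]] by simp
    show "\<gamma> (a n) [^] k \<in> U \<and> norm (\<psi> (\<gamma> (a n) [^] k)) \<le> \<epsilon> / 4" if "k \<le> Suc n" for k
      using near[OF ka[OF that]] by (simp add: hom_pow(2)[OF hom])
  qed
  have "norm (\<psi> (\<gamma> (a n)) /\<^sub>R a n) \<le> \<epsilon> / (d / 2)" for n
  proof -
    have "norm (\<psi> (\<gamma> (a n)) /\<^sub>R a n) = real (Suc n) * norm (\<psi> (\<gamma> (a n))) / (d / 2)"
      using a[of n] d by (simp add: a_def field_simps)
    also have "\<dots> \<le> \<epsilon> / (d / 2)" using le[of n] d by (intro divide_right_mono) auto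
    finally show ?thesis .
  qed
  then have "bounded (range (\<lambda>n. \<psi> (\<gamma> (a n)) /\<^sub>R a n))" by (auto simp: bounded_iff)
  then obtain X r where r: "strict_mono r" "((\<lambda>n. \<psi> (\<gamma> (a n)) /\<^sub>R a n) \<circ> r) \<longlonglongrightarrow> X"
    using bounded_imp_convergent_subsequence by blast
  have ar: "(\<lambda>n. a (r n)) \<longlonglongrightarrow> 0" using LIMSEQ_subseq_LIMSEQ[OF a0 r(1)] by (simp add: o_def)
  from one_parameter_eq_Exp[OF cont hom a ar, of X] r(2)
  have "X \<in> V" "\<forall>s. \<gamma> s = Exp (s *\<^sub>R X)" by (auto simp: o_def)
  then show ?thesis by (rule that)
qed

lemma Exp_line_inj:
  assumes "X \<in> V" "Y \<in> V" "\<And>s. Exp (s *\<^sub>R X) = Exp (s *\<^sub>R Y)"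
  shows "X = Y"
proof -
  have "((\<lambda>s. \<psi> (Exp (s *\<^sub>R X))) has_vector_derivative Y) (at 0)"
    unfolding assms(3) by (rule psi_Exp_has_derivative[OF assms(2)])
  with psi_Exp_has_derivative[OF assms(1)] show ?thesis by (rule vector_derivative_unique_at)
qed

lemma Exp_mult_has_derivative:
  assumes X: "X \<in> V" and Y: "Y \<in> V"
  shows "((\<lambda>s. \<psi> (Exp (s *\<^sub>R X) \<otimes> Exp (s *\<^sub>R Y))) has_vector_derivative X + Y) (at 0)"
proof -
  let ?x = "\<lambda>s. Exp (s *\<^sub>R X)" and ?y = "\<lambda>s. Exp (s *\<^sub>R Y)"
  have q: "((\<lambda>h. \<psi> (Exp (h *\<^sub>R Z)) /\<^sub>R h) \<longlongrightarrow> Z) (at 0)" if "Z \<in> V" for Z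
    using psi_Exp_has_derivative[OF that] by (simp add: has_vector_derivative_iff_quotient)
  have one: "((\<lambda>h. Exp (h *\<^sub>R Z)) \<longlongrightarrow> \<one>) (at 0)" if "Z \<in> V" for Z
    using Exp_line_tendsto[OF that tendsto_ident_at[of 0]] by simp
  have psi0: "((\<lambda>h. \<psi> (Exp (h *\<^sub>R Z))) \<longlongrightarrow> 0) (at 0)" and
    ev: "\<forall>\<^sub>F h in at 0. Exp (h *\<^sub>R Z) \<in> U \<and> norm (\<psi> (Exp (h *\<^sub>R Z))) < R" if "Z \<in> V" for Z
  proof -
    show *: "((\<lambda>h. \<psi> (Exp (h *\<^sub>R Z))) \<longlongrightarrow> 0) (at 0)" using tendsto_psi(2)[OF one[OF that]] by simp
    show "\<forall>\<^sub>F h in at 0. Exp (h *\<^sub>R Z) \<in> U \<and> norm (\<psi> (Exp (h *\<^sub>R Z))) < R"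
      using tendsto_psi(1)[OF one[OF that]] R_pos
      by (intro eventually_conj order_tendstoD(2)[OF tendsto_norm_zero[OF *]]) auto
  qed
  have "((\<lambda>h. (\<psi> (?x h \<otimes> ?y h) - \<psi> (?x h) - \<psi> (?y h)) /\<^sub>R h) \<longlongrightarrow> 0) (at 0)"
  proof (rule Lim_null_comparison)
    show "\<forall>\<^sub>F h in at 0. norm ((\<psi> (?x h \<otimes> ?y h) - \<psi> (?x h) - \<psi> (?y h)) /\<^sub>R h)
        \<le> C * norm (\<psi> (?x h) /\<^sub>R h) * norm (\<psi> (?y h))"
      using ev[OF X] ev[OF Y]
    proof eventually_elim
      case (elim h)
      then have "norm (\<psi> (?x h \<otimes> ?y h) - \<psi> (?x h) - \<psi> (?y h)) \<le> C * norm (\<psi> (?x h)) * norm (\<psi> (?y h))"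
        by (intro mult_estimate) auto
      then have "\<bar>inverse h\<bar> * norm (\<psi> (?x h \<otimes> ?y h) - \<psi> (?x h) - \<psi> (?y h)) \<le>
          \<bar>inverse h\<bar> * (C * norm (\<psi> (?x h)) * norm (\<psi> (?y h)))" by (intro mult_left_mono) auto
      then show ?case by (simp only: norm_scaleR mult_ac)
    qed
    have "((\<lambda>h. C * norm (\<psi> (?x h) /\<^sub>R h) * norm (\<psi> (?y h))) \<longlongrightarrow> C * norm X * norm (0::'e)) (at 0)"
      by (intro tendsto_intros q X psi0 Y)
    then show "((\<lambda>h. C * norm (\<psi> (?x h) /\<^sub>R h) * norm (\<psi> (?y h))) \<longlongrightarrow> 0) (at 0)" by simp
  qed
  from tendsto_add[OF this tendsto_add[OF q[OF X] q[OF Y]]]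
  show ?thesis by (simp add: has_vector_derivative_iff_quotient scaleR_diff_right)
qed

text \<open>The product of two commuting lines is again a one-parameter subgroup, with derivative X
  + Y at 0, so uniqueness applies. This makes the Lie algebra of a torus closed under
  addition.\<close>

lemma Exp_commuting_add:
  assumes X: "X \<in> V" and Y: "Y \<in> V"
    and comm: "\<And>s t. Exp (s *\<^sub>R X) \<otimes> Exp (t *\<^sub>R Y) = Exp (t *\<^sub>R Y) \<otimes> Exp (s *\<^sub>R X)"
  shows "Exp (s *\<^sub>R (X + Y)) = Exp (s *\<^sub>R X) \<otimes> Exp (s *\<^sub>R Y)"
proof (rule one_parameter_unique(2)[symmetric])
  show "continuous_on UNIV (\<lambda>s. Exp (s *\<^sub>R X) \<otimes> Exp (s *\<^sub>R Y))"
    unfolding continuous_on_def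
    by (auto intro!: tendsto_mult_group Exp_line_tendsto X Y tendsto_ident_at)
  show "Exp ((s + t) *\<^sub>R X) \<otimes> Exp ((s + t) *\<^sub>R Y) =
      Exp (s *\<^sub>R X) \<otimes> Exp (s *\<^sub>R Y) \<otimes> (Exp (t *\<^sub>R X) \<otimes> Exp (t *\<^sub>R Y))" for s t
  proof -
    have "Exp ((s + t) *\<^sub>R X) \<otimes> Exp ((s + t) *\<^sub>R Y) =
        Exp (s *\<^sub>R X) \<otimes> ((Exp (t *\<^sub>R X) \<otimes> Exp (s *\<^sub>R Y)) \<otimes> Exp (t *\<^sub>R Y))"
      by (simp add: Exp_add[OF X] Exp_add[OF Y] m_assoc)
    then show ?thesis unfolding comm[of t s] by (simp add: m_assoc)
  qed
  show "((\<lambda>s. \<psi> (Exp (s *\<^sub>R X) \<otimes> Exp (s *\<^sub>R Y))) has_vector_derivative X + Y) (at 0)"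
    by (rule Exp_mult_has_derivative[OF X Y])
qed

text \<open>The Lie product formula: in the limit only the first-order term of the product counts,
  which is X + Y. It is what makes the adjoint action additive.\<close>

lemma Exp_product_formula:
  assumes X: "X \<in> V" and Y: "Y \<in> V"
  shows "(\<lambda>n. (Exp (X /\<^sub>R real (Suc n)) \<otimes> Exp (Y /\<^sub>R real (Suc n))) [^] Suc n) \<longlonglongrightarrow> Exp (X + Y)"
proof -
  let ?z = "\<lambda>n. Exp (X /\<^sub>R real (Suc n)) \<otimes> Exp (Y /\<^sub>R real (Suc n))"
  have inv: "(\<lambda>n. inverse (real (Suc n))) \<longlonglongrightarrow> 0" by (rule LIMSEQ_inverse_real_of_nat)
  have one: "?z \<longlonglongrightarrow> \<one>"
    using tendsto_mult_group[OF Exp_line_tendsto[OF X inv] Exp_line_tendsto[OF Y inv]] by simp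
  have "(\<lambda>n. real (Suc n) *\<^sub>R \<psi> (?z n)) \<longlonglongrightarrow> X + Y"
    using has_vector_derivative_sequentially[OF Exp_mult_has_derivative[OF X Y] inv] by simp
  then show ?thesis
    using tendsto_psi(1)[OF one] by (intro pow_tendsto_Exp tendsto_one_psi one) simp_all
qed

lemma Exp_small_Lipschitz:
  assumes X: "X \<in> V" "norm X < \<epsilon> / 4" and Y: "Y \<in> V" "norm Y < \<epsilon> / 4"
  shows "norm (\<psi> (Exp X) - \<psi> (Exp Y)) \<le> 4 * norm (X - Y)"
proof -
  let ?p = "\<lambda>X n. \<psi> (\<xi> (X /\<^sub>R real (Suc n)) [^] Suc n)"
  have lim: "?p Z \<longlonglongrightarrow> \<psi> (Exp Z)" if "Z \<in> V" "norm Z < \<epsilon> / 4" for Z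
  proof -
    have "(\<lambda>n. \<xi> (Z /\<^sub>R real (Suc n)) [^] Suc n) \<longlonglongrightarrow> Exp Z"
      using scaled_xi_seq[OF that(1), of Suc 1]
      by (intro pow_tendsto_Exp xi_seq_U psi_xi_seq_tendsto that) simp
    then show ?thesis by (rule tendsto_psi(2)) (use Exp_chart that in simp)
  qed
  have "\<forall>\<^sub>F n in sequentially. norm (?p X n - ?p Y n) \<le> 4 * norm (X - Y)"
    using xi_seq_U[OF X(1)] xi_seq_U[OF Y(1)] psi_xi_seq[OF X(1)] psi_xi_seq[OF Y(1)]
  proof eventually_elim
    case (elim n)
    have sc: "real (Suc n) * norm (Z /\<^sub>R real (Suc n)) = norm Z" for Z :: 'e by simp
    have "norm (?p X n - ?p Y n) \<le> 4 * (real (Suc n) * norm (X /\<^sub>R real (Suc n) - Y /\<^sub>R real (Suc n)))"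
      using pow_diff[OF elim(1,2), of "Suc n"] X(2) Y(2) eps_pos unfolding elim(3,4) sc by linarith
    also have "X /\<^sub>R real (Suc n) - Y /\<^sub>R real (Suc n) = (X - Y) /\<^sub>R real (Suc n)"
      by (simp add: scaleR_diff_right)
    finally show ?case unfolding sc .
  qed
  then show ?thesis
    by (rule Lim_norm_ubound[OF _ tendsto_diff[OF lim[OF X] lim[OF Y]], rotated]) simp
qed

text \<open>\<open>Exp\<close> is Lipschitz near 0 (\<open>Exp_small_Lipschitz\<close>), and
  dividing by a fixed N brings a neighbourhood of X into that region; the N-th power restores the
  original arguments.\<close>

lemma Exp_tendsto:
  assumes x: "x \<longlonglongrightarrow> X" "\<And>n. x n \<in> V"
  shows "(\<lambda>n. Exp (x n)) \<longlonglongrightarrow> Exp X"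
proof -
  have X: "X \<in> V" by (rule Lim_in_closed_set[OF closed_V _ _ x(1)]) (auto simp: x)
  obtain N where N: "N > 0" "(norm X + 1) / real N \<le> \<epsilon> / 4" by (rule exists_divisor)
  have small: "norm (Z /\<^sub>R real N) < \<epsilon> / 4" if "norm Z < norm X + 1" for Z :: 'e
  proof -
    have "norm (Z /\<^sub>R real N) = norm Z / real N" by (simp add: divide_inverse mult.commute)
    also have "\<dots> < (norm X + 1) / real N" using that N by (intro divide_strict_right_mono) auto
    finally show ?thesis using N(2) by linarith
  qed
  have sX: "norm (X /\<^sub>R real N) < \<epsilon> / 4" by (rule small) simp
  have "(\<lambda>n. norm (x n)) \<longlonglongrightarrow> norm X" by (intro tendsto_norm x)
  then have ev: "\<forall>\<^sub>F n in sequentially. norm (x n) < norm X + 1" by (rule order_tendstoD(2)) simp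
  have U: "\<forall>\<^sub>F n in sequentially. Exp (x n /\<^sub>R real N) \<in> U"
    using ev by eventually_elim (use small Exp_chart(1)[OF scale_V[OF x(2)]] in force)
  have lim: "(\<lambda>n. \<psi> (Exp (x n /\<^sub>R real N)) - \<psi> (Exp (X /\<^sub>R real N))) \<longlonglongrightarrow> 0"
  proof (rule Lim_null_comparison)
    show "\<forall>\<^sub>F n in sequentially. norm (\<psi> (Exp (x n /\<^sub>R real N)) - \<psi> (Exp (X /\<^sub>R real N)))
        \<le> 4 * norm (x n /\<^sub>R real N - X /\<^sub>R real N)"
      using ev by eventually_elim (intro Exp_small_Lipschitz small sX scale_V X x)
    have "(\<lambda>n. 4 * norm (x n /\<^sub>R real N - X /\<^sub>R real N)) \<longlonglongrightarrow> 4 * norm (X /\<^sub>R real N - X /\<^sub>R real N)"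
      by (intro tendsto_intros x)
    then show "(\<lambda>n. 4 * norm (x n /\<^sub>R real N - X /\<^sub>R real N)) \<longlonglongrightarrow> 0" by simp
  qed
  have EX: "Exp (X /\<^sub>R real N) \<in> U" "norm (\<psi> (Exp (X /\<^sub>R real N)) - X /\<^sub>R real N) \<le> C * (norm (X /\<^sub>R real N))\<^sup>2"
    using Exp_chart[OF scale_V[OF X] less_imp_le[OF sX]] by simp_all
  have "C * (norm (X /\<^sub>R real N))\<^sup>2 \<le> norm (X /\<^sub>R real N) / 8"
    using C_mult_eps[of "norm (X /\<^sub>R real N)" "norm (X /\<^sub>R real N)"] sX eps_pos
    by (simp add: power2_eq_square mult.assoc)
  then have "norm (\<psi> (Exp (X /\<^sub>R real N))) \<le> R"
    using EX(2) sX eps_R eps_pos norm_triangle_ineq2[of "\<psi> (Exp (X /\<^sub>R real N))" "X /\<^sub>R real N"] by linarith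
  then have "(\<lambda>n. Exp (x n /\<^sub>R real N)) \<longlonglongrightarrow> \<xi> (\<psi> (Exp (X /\<^sub>R real N)))"
    using tendsto_xi[OF U LIM_zero_cancel[OF lim] psi_V[OF EX(1)]] by blast
  then have "(\<lambda>n. Exp (x n /\<^sub>R real N) [^] N) \<longlonglongrightarrow> Exp (X /\<^sub>R real N) [^] N"
    using EX(1) by (intro tendsto_pow_group) simp
  moreover have "Exp (Z /\<^sub>R real N) [^] N = Exp Z" if "Z \<in> V" for Z
    using Exp_pow[OF that, of N "inverse (real N)"] N by simp
  ultimately show ?thesis using X x(2) by simp
qed

end

section \<open>Closed subgroups and the adjoint action\<close>

context group_chart
begin

lemma mult_inv_cancel: "inv g \<otimes> (g \<otimes> x) = x" "g \<otimes> (inv g \<otimes> x) = x"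
  by (simp_all add: m_assoc[symmetric])

text \<open>The translate of W by an element h of H meets T inside H, so H is open as well as closed
  in the connected set T.\<close>

lemma subgroup_clopen:
  assumes H: "subgroup H G" "closed H" and T: "subgroup T G" "connected T" and "H \<subseteq> T"
    and W: "open W" "\<one> \<in> W" "T \<inter> W \<subseteq> H"
  shows "H = T"
proof -
  have mult: "x \<otimes> y \<in> K" if "subgroup K G" "x \<in> K" "y \<in> K" for K x y
    using subgroup.m_closed[OF that(1)] that by blast
  have minv: "inv x \<in> K" if "subgroup K G" "x \<in> K" for K x
    using subgroup.m_inv_closed[OF that(1)] that by blast
  have "openin (top_of_set T) H"
  proof (subst openin_subopen, intro ballI)
    fix h assume h: "h \<in> H"
    let ?O = "(\<lambda>x. inv h \<otimes> x) -` W"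
    have "continuous_on UNIV (\<lambda>x. inv h \<otimes> x)"
      unfolding continuous_on_def by (auto intro!: tendsto_mult_group tendsto_ident_at)
    then have "open ?O" using W(1) by (simp add: continuous_on_open_vimage)
    then have "openin (top_of_set T) (T \<inter> ?O)" by (simp add: openin_open_Int)
    moreover have "h \<in> T \<inter> ?O" using h \<open>H \<subseteq> T\<close> W(2) by auto
    moreover have "T \<inter> ?O \<subseteq> H"
    proof
      fix x assume x: "x \<in> T \<inter> ?O"
      then have "inv h \<otimes> x \<in> H"
        using W(3) mult[OF T(1) minv[OF T(1)], of h x] h \<open>H \<subseteq> T\<close> by auto
      from mult[OF H(1) h this] show "x \<in> H" by (simp add: m_assoc[symmetric])
    qed
    ultimately show "\<exists>V. openin (top_of_set T) V \<and> h \<in> V \<and> V \<subseteq> H" by blast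
  qed
  moreover have "closedin (top_of_set T) H" using H(2) \<open>H \<subseteq> T\<close> by (rule closed_subset[rotated])
  moreover have "H \<noteq> {}" using subgroup.one_closed[OF H(1)] by blast
  ultimately show ?thesis using T(2) unfolding connected_clopen by blast
qed

text \<open>
  Otherwise there are elements t of T arbitrarily close to the identity outside of H.  Multiplying t
  by an element of H such that the product y has minimal distance to the identity, the directions
  of these products accumulate at a direction Z, and the line through Z is contained in T, hence
  in H.  But then multiplying y by a small element of this line decreases its size.
\<close>

theorem closed_subgroup_eq:
  assumes H: "subgroup H G" "closed H" and T: "subgroup T G" "closed T" "connected T" and "H \<subseteq> T"
    and line: "\<And>X s. X \<in> V \<Longrightarrow> (\<And>s. Exp (s *\<^sub>R X) \<in> T) \<Longrightarrow> Exp (s *\<^sub>R X) \<in> H"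
  shows "H = T"
proof (rule ccontr)
  assume "H \<noteq> T"
  have mult: "x \<otimes> y \<in> K" if "subgroup K G" "x \<in> K" "y \<in> K" for K x y
    using subgroup.m_closed[OF that(1)] that by blast
  have oneH: "\<one> \<in> H" using subgroup.one_closed[OF H(1)] .
  let ?B = "\<lambda>r. {g \<in> U. norm (\<psi> g) \<le> r}"
  have cont_psi: "continuous_on U \<psi>" using homeo by (simp add: homeomorphism_def)
  have "\<exists>t. t \<in> T \<and> t \<in> U \<and> norm (\<psi> t) < R / 2 / real (Suc n) \<and> t \<notin> H" for n
  proof (rule ccontr)
    assume no: "\<nexists>t. t \<in> T \<and> t \<in> U \<and> norm (\<psi> t) < R / 2 / real (Suc n) \<and> t \<notin> H"
    let ?W = "U \<inter> (\<lambda>g. norm (\<psi> g)) -` {..<R / 2 / real (Suc n)}"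
    have "open ?W"
      using continuous_on_norm[OF cont_psi] by (rule continuous_open_preimage) (auto simp: open_U)
    moreover have "\<one> \<in> ?W" using R_pos by simp
    moreover have "T \<inter> ?W \<subseteq> H" using no by auto
    ultimately show False using subgroup_clopen[OF H T(1,3) \<open>H \<subseteq> T\<close>] \<open>H \<noteq> T\<close> by blast
  qed
  then obtain t where t: "\<And>n. t n \<in> T" "\<And>n. t n \<in> U" "\<And>n. norm (\<psi> (t n)) < R / 2 / real (Suc n)"
    "\<And>n. t n \<notin> H" by metis
  have tR: "norm (\<psi> (t n)) \<le> R / 2" for n
  proof -
    have "R / 2 / real (Suc n) \<le> R / 2 / 1" using R_pos by (intro divide_left_mono) auto
    then show ?thesis using t(3)[of n] by linarith
  qed
  have compB: "compact (?B (R / 2))"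
  proof -
    have "?B (R / 2) = \<xi> ` (cball 0 (R / 2) \<inter> V)"
    proof
      show "?B (R / 2) \<subseteq> \<xi> ` (cball 0 (R / 2) \<inter> V)"
        using psi_V by (force simp: image_iff intro!: bexI[of _ "\<psi> _"])
      show "\<xi> ` (cball 0 (R / 2) \<inter> V) \<subseteq> ?B (R / 2)"
        using xi_U psi_xi R_pos by auto
    qed
    moreover have "continuous_on (cball 0 (R / 2) \<inter> V) \<xi>"
    proof (rule continuous_on_subset)
      show "continuous_on (\<psi> ` U) \<xi>" using homeo by (simp add: homeomorphism_def)
      have "cball 0 (R / 2) \<subseteq> cball (0 :: 'e) R" using R_pos by (intro subset_cball) simp
      then show "cball 0 (R / 2) \<inter> V \<subseteq> \<psi> ` U" using cball_subset by blast
    qed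
    ultimately show ?thesis
      using compact_continuous_image compact_cball_Int_subspace[OF subspace_V] by metis
  qed
  have "\<exists>g. g \<in> H \<and> t n \<otimes> g \<in> ?B (R / 2) \<and>
      (\<forall>h\<in>H. t n \<otimes> h \<in> ?B (R / 2) \<longrightarrow> norm (\<psi> (t n \<otimes> g)) \<le> norm (\<psi> (t n \<otimes> h)))" for n
  proof -
    let ?K = "(\<lambda>x. t n \<otimes> x) ` H \<inter> ?B (R / 2)"
    have "(\<lambda>x. t n \<otimes> x) ` H = (\<lambda>x. inv (t n) \<otimes> x) -` H"
      by (auto simp: m_assoc[symmetric] image_iff intro!: bexI[of _ "inv (t n) \<otimes> _"])
    moreover have "continuous_on UNIV (\<lambda>x. inv (t n) \<otimes> x)"
      unfolding continuous_on_def by (auto intro!: tendsto_mult_group tendsto_ident_at)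
    ultimately have "closed ((\<lambda>x. t n \<otimes> x) ` H)"
      using H(2) by (simp add: continuous_on_closed_vimage)
    then have "compact ?K" using compB by (intro closed_Int_compact)
    moreover have "t n \<in> ?K" using t(2) tR oneH by (auto simp: image_iff intro!: bexI[of _ \<one>])
    moreover have "continuous_on ?K (\<lambda>x. norm (\<psi> x))"
      by (intro continuous_on_norm continuous_on_subset[OF cont_psi]) auto
    ultimately obtain x where "x \<in> ?K" "\<forall>y\<in>?K. norm (\<psi> x) \<le> norm (\<psi> y)"
      using continuous_attains_inf[of ?K "\<lambda>x. norm (\<psi> x)"] by blast
    then obtain h where "h \<in> H" "x = t n \<otimes> h" "x \<in> ?B (R / 2)" by blast
    with \<open>\<forall>y\<in>?K. norm (\<psi> x) \<le> norm (\<psi> y)\<close> show ?thesis by blast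
  qed
  then have "\<forall>n. \<exists>g. g \<in> H \<and> t n \<otimes> g \<in> ?B (R / 2) \<and>
      (\<forall>h\<in>H. t n \<otimes> h \<in> ?B (R / 2) \<longrightarrow> norm (\<psi> (t n \<otimes> g)) \<le> norm (\<psi> (t n \<otimes> h)))" by blast
  from choice[OF this] obtain g where g: "\<And>n. g n \<in> H" "\<And>n. t n \<otimes> g n \<in> ?B (R / 2)"
    and gmin: "\<And>n h. h \<in> H \<Longrightarrow> t n \<otimes> h \<in> ?B (R / 2) \<Longrightarrow> norm (\<psi> (t n \<otimes> g n)) \<le> norm (\<psi> (t n \<otimes> h))"
    by blast
  define y where "y n = t n \<otimes> g n" for n
  define a where "a n = norm (\<psi> (y n))" for n
  have yT: "y n \<in> T" for n unfolding y_def using mult[OF T(1) t(1)] g(1) \<open>H \<subseteq> T\<close> by blast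
  have yU: "y n \<in> U" and yR: "norm (\<psi> (y n)) \<le> R / 2" for n using g(2) by (auto simp: y_def)
  have "y n \<noteq> \<one>" for n
  proof
    assume "y n = \<one>"
    then have "t n = inv (g n)" unfolding y_def by (metis UNIV_I carrier_UNIV inv_equality)
    then show False using t(4)[of n] subgroup.m_inv_closed[OF H(1) g(1)] by metis
  qed
  then have apos: "a n > 0" for n using psi_eqD[OF yU one_U] by (auto simp: a_def)
  have a_le: "a n \<le> R / 2 / real (Suc n)" for n
    using gmin[OF oneH, of n] t(2,3)[of n] tR[of n] by (simp add: a_def y_def)
  have a0: "a \<longlonglongrightarrow> 0"
  proof (rule Lim_null_comparison)
    show "\<forall>\<^sub>F n in sequentially. norm (a n) \<le> R / 2 * (1 / real (Suc n))"
      using a_le apos by (auto simp: less_imp_le)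
    show "(\<lambda>n. R / 2 * (1 / real (Suc n))) \<longlonglongrightarrow> 0"
      by (rule tendsto_mult_right_zero[OF inverse_Suc_tendsto])
  qed
  have "norm (\<psi> (y n) /\<^sub>R a n) = 1" for n using apos[of n] by (simp add: a_def)
  then have "bounded (range (\<lambda>n. \<psi> (y n) /\<^sub>R a n))" by (auto simp: bounded_iff)
  then obtain Z r where r: "strict_mono r" "((\<lambda>n. \<psi> (y n) /\<^sub>R a n) \<circ> r) \<longlonglongrightarrow> Z"
    using bounded_imp_convergent_subsequence by blast
  have limZ: "(\<lambda>n. \<psi> (y (r n)) /\<^sub>R a (r n)) \<longlonglongrightarrow> Z" using r(2) by (simp add: o_def)
  have ar: "(\<lambda>n. a (r n)) \<longlonglongrightarrow> 0" using LIMSEQ_subseq_LIMSEQ[OF a0 r(1)] by (simp add: o_def)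
  have Z: "Z \<in> V"
    by (rule Lim_in_closed_set[OF closed_V _ _ limZ]) (use yU psi_V scale_V in auto)
  have psi0: "(\<lambda>n. \<psi> (y (r n))) \<longlonglongrightarrow> 0"
    using ar by (simp add: a_def tendsto_norm_zero_iff)
  have ExpT: "Exp (s *\<^sub>R Z) \<in> T" if "s \<ge> 0" for s
  proof -
    let ?k = "\<lambda>n. nat \<lfloor>s / a (r n)\<rfloor>"
    have "(\<lambda>n. (real (?k n) * a (r n)) *\<^sub>R (\<psi> (y (r n)) /\<^sub>R a (r n))) \<longlonglongrightarrow> s *\<^sub>R Z"
      by (intro tendsto_scaleR limZ nat_floor_ratio_tendsto that apos ar)
    moreover have "(real (?k n) * a (r n)) *\<^sub>R (\<psi> (y (r n)) /\<^sub>R a (r n)) = real (?k n) *\<^sub>R \<psi> (y (r n))" for n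
      using apos[of "r n"] by simp
    ultimately have "(\<lambda>n. real (?k n) *\<^sub>R \<psi> (y (r n))) \<longlonglongrightarrow> s *\<^sub>R Z" by (simp only:)
    then have "(\<lambda>n. y (r n) [^] ?k n) \<longlonglongrightarrow> Exp (s *\<^sub>R Z)"
      by (intro pow_tendsto_Exp psi0) (simp_all add: yU)
    moreover have "y n [^] (k::nat) \<in> T" for n k
      by (induction k) (auto intro: mult[OF T(1)] yT subgroup.one_closed[OF T(1)])
    ultimately show ?thesis by (intro Lim_in_closed_set[OF T(2)]) auto
  qed
  have "Exp (s *\<^sub>R Z) \<in> T" for s
  proof (cases "s \<ge> 0")
    case False
    then have "inv (Exp ((- s) *\<^sub>R Z)) \<in> T"
      using ExpT[of "- s"] subgroup.m_inv_closed[OF T(1)] by simp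
    then show ?thesis using Exp_minus[OF scale_V[OF Z], of "- s"] by simp
  qed (rule ExpT)
  then have lineH: "Exp (s *\<^sub>R Z) \<in> H" for s using line[OF Z] by blast
  let ?h = "\<lambda>n. Exp ((- a (r n)) *\<^sub>R Z)"
  have arm: "(\<lambda>n. - a (r n)) \<longlonglongrightarrow> 0" using tendsto_minus[OF ar] by simp
  have hq: "(\<lambda>n. \<psi> (?h n) /\<^sub>R (- a (r n))) \<longlonglongrightarrow> Z"
    using has_vector_derivative_sequentially[OF psi_Exp_has_derivative[OF Z] arm] apos
    by (simp add: less_imp_neq[THEN not_sym])
  have h1: "?h \<longlonglongrightarrow> \<one>" using Exp_line_tendsto[OF Z arm] by simp
  have evh: "\<forall>\<^sub>F n in sequentially. ?h n \<in> U" "\<forall>\<^sub>F n in sequentially. norm (\<psi> (?h n)) < R"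
    using tendsto_psi(1)[OF h1] order_tendstoD(2)[OF tendsto_norm_zero[OF tendsto_one_psi[OF h1]] R_pos]
    by auto
  \<comment> \<open>This quantity bounds the size of \<open>y (r n) \<otimes> ?h n\<close> relative
    to \<open>a (r n)\<close>: the first term is the difference of two directions that both tend to
    Z, the second the error of the product. It tends to 0, whereas minimality of
    \<open>y (r n)\<close> requires a ratio of at least 1.\<close>
  have "(\<lambda>n. norm (\<psi> (y (r n)) /\<^sub>R a (r n) - \<psi> (?h n) /\<^sub>R (- a (r n))) + C * norm (\<psi> (?h n))) \<longlonglongrightarrow>
      norm (Z - Z) + C * norm (0 :: 'e)"
    by (intro tendsto_intros limZ hq tendsto_one_psi h1)
  then have "\<forall>\<^sub>F n in sequentially.
      norm (\<psi> (y (r n)) /\<^sub>R a (r n) - \<psi> (?h n) /\<^sub>R (- a (r n))) + C * norm (\<psi> (?h n)) < 1"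
    by (rule order_tendstoD(2)) simp
  then have "\<forall>\<^sub>F n in sequentially. False"
    using evh
  proof eventually_elim
    case (elim n)
    let ?y = "y (r n)" and ?a = "a (r n)"
    have "norm (\<psi> (?y \<otimes> ?h n) - \<psi> ?y - \<psi> (?h n)) \<le> C * ?a * norm (\<psi> (?h n))"
      using mult_estimate[OF yU elim(2)] yR[of "r n"] elim(3) R_pos by (simp add: a_def)
    moreover have "norm (\<psi> ?y + \<psi> (?h n)) = ?a * norm (\<psi> ?y /\<^sub>R ?a - \<psi> (?h n) /\<^sub>R (- ?a))"
    proof -
      have "\<psi> ?y + \<psi> (?h n) = ?a *\<^sub>R (\<psi> ?y /\<^sub>R ?a - \<psi> (?h n) /\<^sub>R (- ?a))"
        using apos[of "r n"] by (simp add: scaleR_add_right)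
      then show ?thesis using apos[of "r n"] by (metis abs_of_pos norm_scaleR)
    qed
    moreover have "norm (\<psi> (?y \<otimes> ?h n)) \<le>
        norm (\<psi> (?y \<otimes> ?h n) - \<psi> ?y - \<psi> (?h n)) + norm (\<psi> ?y + \<psi> (?h n))"
      using norm_triangle_ineq[of "\<psi> (?y \<otimes> ?h n) - \<psi> ?y - \<psi> (?h n)" "\<psi> ?y + \<psi> (?h n)"] by simp
    ultimately have "norm (\<psi> (?y \<otimes> ?h n)) \<le>
        ?a * (norm (\<psi> ?y /\<^sub>R ?a - \<psi> (?h n) /\<^sub>R (- ?a)) + C * norm (\<psi> (?h n)))"
      by (simp add: algebra_simps)
    also have "\<dots> < ?a * 1" using elim(1) apos by (intro mult_strict_left_mono)
    finally have less: "norm (\<psi> (?y \<otimes> ?h n)) < ?a" by simp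
    have eq: "?y \<otimes> ?h n = t (r n) \<otimes> (g (r n) \<otimes> ?h n)" by (simp add: y_def m_assoc)
    have "?y \<otimes> ?h n \<in> U"
      using mult_U[OF yU elim(2)] yR[of "r n"] elim(3) R_pos by simp
    then have "t (r n) \<otimes> (g (r n) \<otimes> ?h n) \<in> ?B (R / 2)"
      using less yR[of "r n"] unfolding eq by (simp add: a_def)
    from gmin[OF mult[OF H(1) g(1) lineH] this] less show False
      unfolding eq[symmetric] by (simp add: a_def y_def)
  qed
  then show False by simp
qed

text \<open>The conjugate of a one-parameter subgroup is again one, and Y is its direction; it
  exists by \<open>continuous_hom_eq_Exp\<close>. Algebraic properties thereby reduce to the
  uniqueness of Y, without differentiating anything.\<close>

definition Adj :: "'g \<Rightarrow> 'e \<Rightarrow> 'e" where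
  "Adj g X = (SOME Y. Y \<in> V \<and> (\<forall>s. g \<otimes> Exp (s *\<^sub>R X) \<otimes> inv g = Exp (s *\<^sub>R Y)))"

lemma
  assumes X: "X \<in> V"
  shows Adj_V: "Adj g X \<in> V" and Exp_Adj: "Exp (s *\<^sub>R Adj g X) = g \<otimes> Exp (s *\<^sub>R X) \<otimes> inv g"
proof -
  let ?c = "\<lambda>s. g \<otimes> Exp (s *\<^sub>R X) \<otimes> inv g"
  have "\<exists>Y. Y \<in> V \<and> (\<forall>s. ?c s = Exp (s *\<^sub>R Y))"
  proof -
    have "continuous_on UNIV ?c"
      unfolding continuous_on_def
      by (auto intro!: tendsto_mult_group Exp_line_tendsto X tendsto_ident_at tendsto_const)
    moreover have "?c (s + t) = ?c s \<otimes> ?c t" for s t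
      by (simp add: Exp_add[OF X] m_assoc mult_inv_cancel)
    ultimately obtain Y where "Y \<in> V" "\<forall>s. ?c s = Exp (s *\<^sub>R Y)" by (rule continuous_hom_eq_Exp)
    then show ?thesis by blast
  qed
  from someI_ex[OF this] have "Adj g X \<in> V \<and> (\<forall>s. ?c s = Exp (s *\<^sub>R Adj g X))"
    unfolding Adj_def .
  then show "Adj g X \<in> V" "Exp (s *\<^sub>R Adj g X) = ?c s" by auto
qed

lemma Adj_unique:
  "X \<in> V \<Longrightarrow> Y \<in> V \<Longrightarrow> (\<And>s. g \<otimes> Exp (s *\<^sub>R X) \<otimes> inv g = Exp (s *\<^sub>R Y)) \<Longrightarrow> Adj g X = Y"
  by (rule Exp_line_inj) (auto simp: Adj_V Exp_Adj)

lemma Adj_one: "X \<in> V \<Longrightarrow> Adj \<one> X = X"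
  by (rule Adj_unique) auto

lemma Adj_mult: "X \<in> V \<Longrightarrow> Adj (g \<otimes> h) X = Adj g (Adj h X)"
  by (rule Adj_unique) (auto simp: Adj_V Exp_Adj m_assoc inv_mult_group)

lemma Adj_scale: "X \<in> V \<Longrightarrow> Adj g (c *\<^sub>R X) = c *\<^sub>R Adj g X"
  by (rule Adj_unique) (auto simp: Adj_V Exp_Adj scale_V)

text \<open>Conjugation is a continuous automorphism, so it passes through the Lie product formula
  factor by factor.\<close>

lemma Adj_add:
  assumes X: "X \<in> V" and Y: "Y \<in> V"
  shows "Adj g (X + Y) = Adj g X + Adj g Y"
proof (rule Adj_unique)
  show XY: "X + Y \<in> V" "Adj g X + Adj g Y \<in> V" using X Y Adj_V subspace_add[OF subspace_V] by auto
  fix s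
  let ?c = "\<lambda>x. g \<otimes> x \<otimes> inv g"
  have pow: "?c (x [^] n) = (?c x) [^] n" for x and n :: nat
  proof (induction n)
    case (Suc n)
    have "?c (x [^] Suc n) = ?c (x [^] n) \<otimes> ?c x" by (simp add: m_assoc mult_inv_cancel)
    then show ?case using Suc by simp
  qed simp
  let ?z = "\<lambda>X Y n. Exp (X /\<^sub>R real (Suc n)) \<otimes> Exp (Y /\<^sub>R real (Suc n))"
  have cz: "?c (?z (s *\<^sub>R X) (s *\<^sub>R Y) n) = ?z (s *\<^sub>R Adj g X) (s *\<^sub>R Adj g Y) n" for n
    by (simp add: Exp_Adj X Y m_assoc mult_inv_cancel)
  have "(\<lambda>n. ?c (?z (s *\<^sub>R X) (s *\<^sub>R Y) n [^] Suc n)) \<longlonglongrightarrow> ?c (Exp (s *\<^sub>R X + s *\<^sub>R Y))"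
    by (intro tendsto_mult_group tendsto_const Exp_product_formula scale_V X Y)
  moreover have "(\<lambda>n. ?z (s *\<^sub>R Adj g X) (s *\<^sub>R Adj g Y) n [^] Suc n) \<longlonglongrightarrow> Exp (s *\<^sub>R Adj g X + s *\<^sub>R Adj g Y)"
    by (intro Exp_product_formula scale_V Adj_V X Y)
  ultimately show "?c (Exp (s *\<^sub>R (X + Y))) = Exp (s *\<^sub>R (Adj g X + Adj g Y))"
    unfolding pow cz scaleR_add_right by (rule LIMSEQ_unique)
qed

text \<open>By compactness there is a time d up to which all conjugates of the line of X stay in the
  ball of radius \<epsilon> / 4: otherwise there would be counterexamples at times tending to 0,
  whose conjugates tend to the identity along a subsequence. \<open>escape\<close> then bounds every
  speed by \<epsilon> / d.\<close>

lemma Adj_bounded: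
  assumes comp: "compact (UNIV :: 'g set)" and X: "X \<in> V"
  obtains K where "\<And>g. norm (Adj g X) \<le> K"
proof -
  have "\<exists>d>0. \<forall>g s. 0 \<le> s \<and> s \<le> d \<longrightarrow> g \<otimes> Exp (s *\<^sub>R X) \<otimes> inv g \<in> U \<and>
      norm (\<psi> (g \<otimes> Exp (s *\<^sub>R X) \<otimes> inv g)) \<le> \<epsilon> / 4"
  proof (rule ccontr)
    assume no: "\<not> ?thesis"
    have "\<exists>g s. 0 \<le> s \<and> s \<le> 1 / real (Suc n) \<and> \<not> (g \<otimes> Exp (s *\<^sub>R X) \<otimes> inv g \<in> U \<and>
        norm (\<psi> (g \<otimes> Exp (s *\<^sub>R X) \<otimes> inv g)) \<le> \<epsilon> / 4)" for n
      using no by (auto dest!: spec[of _ "1 / real (Suc n)"])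
    then obtain g s where gs: "\<And>n. 0 \<le> s n" "\<And>n. s n \<le> 1 / real (Suc n)"
      "\<And>n. \<not> (g n \<otimes> Exp (s n *\<^sub>R X) \<otimes> inv (g n) \<in> U \<and>
        norm (\<psi> (g n \<otimes> Exp (s n *\<^sub>R X) \<otimes> inv (g n))) \<le> \<epsilon> / 4)" by metis
    obtain l r where r: "strict_mono r" "(g \<circ> r) \<longlonglongrightarrow> l"
      using compact_imp_seq_compact[OF comp] unfolding seq_compact_def by blast
    have "s \<longlonglongrightarrow> 0"
      by (rule tendsto_sandwich[OF _ _ tendsto_const inverse_Suc_tendsto])
        (auto simp: gs simp del: of_nat_Suc)
    then have sr: "(\<lambda>n. s (r n)) \<longlonglongrightarrow> 0" using LIMSEQ_subseq_LIMSEQ[OF _ r(1)] by (fastforce simp: o_def)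
    have gr: "(\<lambda>n. g (r n)) \<longlonglongrightarrow> l" using r(2) by (simp add: o_def)
    have "(\<lambda>n. g (r n) \<otimes> Exp (s (r n) *\<^sub>R X) \<otimes> inv (g (r n))) \<longlonglongrightarrow> l \<otimes> Exp (0 *\<^sub>R X) \<otimes> inv l"
      by (intro tendsto_mult_group tendsto_inv_group gr Exp_line_tendsto X sr)
    then have lim: "(\<lambda>n. g (r n) \<otimes> Exp (s (r n) *\<^sub>R X) \<otimes> inv (g (r n))) \<longlonglongrightarrow> \<one>" by simp
    have "\<forall>\<^sub>F n in sequentially. norm (\<psi> (g (r n) \<otimes> Exp (s (r n) *\<^sub>R X) \<otimes> inv (g (r n)))) < \<epsilon> / 4"
      using eps_pos by (intro order_tendstoD(2)[OF tendsto_norm_zero[OF tendsto_one_psi[OF lim]]]) simp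
    with tendsto_psi(1)[OF lim one_U] have "\<forall>\<^sub>F n in sequentially. False"
      by eventually_elim (use gs(3) less_imp_le in blast)
    then show False by simp
  qed
  then obtain d where d: "d > 0" "\<And>g s. 0 \<le> s \<Longrightarrow> s \<le> d \<Longrightarrow> g \<otimes> Exp (s *\<^sub>R X) \<otimes> inv g \<in> U \<and>
      norm (\<psi> (g \<otimes> Exp (s *\<^sub>R X) \<otimes> inv g)) \<le> \<epsilon> / 4" by blast
  have "norm (Adj g X) \<le> \<epsilon> / d" for g
  proof -
    let ?x = "\<lambda>n. Exp ((d / real (Suc n)) *\<^sub>R Adj g X)"
    have U: "Exp (s *\<^sub>R Adj g X) \<in> U" and le: "norm (\<psi> (Exp (s *\<^sub>R Adj g X))) \<le> \<epsilon> / 4"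
      if "0 \<le> s" "s \<le> d" for s using d(2)[OF that, of g] by (auto simp: Exp_Adj[OF X])
    have b: "norm (\<psi> (?x n) /\<^sub>R (d / real (Suc n))) \<le> \<epsilon> / d" for n
    proof -
      have *: "0 \<le> real k * (d / real (Suc n))" "real k * (d / real (Suc n)) \<le> d" if "k \<le> Suc n" for k
      proof -
        have "real k / real (Suc n) \<le> 1" using that by (simp add: field_simps)
        then have "d * (real k / real (Suc n)) \<le> d * 1" using d(1) by (intro mult_left_mono) auto
        then show "real k * (d / real (Suc n)) \<le> d" by (simp add: mult.commute)
      qed (use d(1) in simp)
      have "real (Suc n) * norm (\<psi> (?x n)) \<le> \<epsilon>"
      proof (rule escape)
        show "?x n \<in> U" using U[OF *[of 1]] by simp
        show "?x n [^] k \<in> U \<and> norm (\<psi> (?x n [^] k)) \<le> \<epsilon> / 4" if "k \<le> Suc n" for k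
          using U[OF *[OF that]] le[OF *[OF that]] by (simp add: Exp_pow[OF Adj_V[OF X], symmetric])
      qed
      then have "real (Suc n) * norm (\<psi> (?x n)) / d \<le> \<epsilon> / d" using d(1) by (intro divide_right_mono) auto
      then show ?thesis using d(1) by (simp add: divide_inverse mult_ac)
    qed
    have lim: "(\<lambda>n. d / real (Suc n)) \<longlonglongrightarrow> 0"
      using tendsto_mult_right_zero[OF inverse_Suc_tendsto, of d] by simp
    have "(\<lambda>n. \<psi> (?x n) /\<^sub>R (d / real (Suc n))) \<longlonglongrightarrow> Adj g X"
      using has_vector_derivative_sequentially[OF psi_Exp_has_derivative[OF Adj_V[OF X]] lim, of g] d(1)
      by simp
    then show ?thesis by (rule Lim_norm_ubound[rotated]) (use b in auto)
  qed
  then show ?thesis by (rule that)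
qed

text \<open>A closed graph argument: bounded values have convergent subsequences, and any limit Z
  satisfies the conjugation identity that determines \<open>Adj g X\<close>, because
  \<open>Exp\<close> and the multiplication are continuous.\<close>

lemma continuous_Adj:
  assumes comp: "compact (UNIV :: 'g set)" and X: "X \<in> V"
  shows "continuous_on UNIV (\<lambda>g. Adj g X)"
proof (rule continuous_on_sequentiallyI)
  fix x :: "nat \<Rightarrow> 'g" and g assume x: "x \<longlonglongrightarrow> g"
  obtain K where K: "\<And>g. norm (Adj g X) \<le> K" using Adj_bounded[OF comp X] by blast
  show "(\<lambda>n. Adj (x n) X) \<longlonglongrightarrow> Adj g X"
  proof (rule ccontr)
    assume "\<not> ?thesis"
    then obtain e where e: "e > 0" "\<not> (\<forall>\<^sub>F n in sequentially. dist (Adj (x n) X) (Adj g X) < e)"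
      unfolding tendsto_iff by blast
    then have "infinite {n. dist (Adj (x n) X) (Adj g X) \<ge> e}"
      unfolding eventually_sequentially infinite_nat_iff_unbounded_le mem_Collect_eq not_all not_ex
        not_imp not_less by blast
    from infinite_enumerate[OF this]
    obtain q :: "nat \<Rightarrow> nat" where q: "strict_mono q" "\<And>n. dist (Adj (x (q n)) X) (Adj g X) \<ge> e" by auto
    have "bounded (range (\<lambda>n. Adj (x (q n)) X))" using K by (auto simp: bounded_iff)
    then obtain Z r where r: "strict_mono r" "((\<lambda>n. Adj (x (q n)) X) \<circ> r) \<longlonglongrightarrow> Z"
      using bounded_imp_convergent_subsequence by blast
    have lim: "(\<lambda>n. Adj (x (q (r n))) X) \<longlonglongrightarrow> Z" using r(2) by (simp add: o_def)
    have Z: "Z \<in> V" by (rule Lim_in_closed_set[OF closed_V _ _ lim]) (auto simp: Adj_V X)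
    have xqr: "(\<lambda>n. x (q (r n))) \<longlonglongrightarrow> g"
      using LIMSEQ_subseq_LIMSEQ[OF x strict_mono_o[OF q(1) r(1)]] by (simp add: o_def)
    have "Exp (s *\<^sub>R Z) = g \<otimes> Exp (s *\<^sub>R X) \<otimes> inv g" for s
    proof (rule LIMSEQ_unique)
      show "(\<lambda>n. Exp (s *\<^sub>R Adj (x (q (r n))) X)) \<longlonglongrightarrow> Exp (s *\<^sub>R Z)"
        by (intro Exp_tendsto tendsto_scaleR tendsto_const lim scale_V Adj_V X)
      show "(\<lambda>n. Exp (s *\<^sub>R Adj (x (q (r n))) X)) \<longlonglongrightarrow> g \<otimes> Exp (s *\<^sub>R X) \<otimes> inv g"
        unfolding Exp_Adj[OF X]
        by (intro tendsto_mult_group tendsto_inv_group tendsto_const xqr)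
    qed
    then have "Adj g X = Z" by (intro Adj_unique X Z) simp
    moreover have "(\<lambda>n. dist (Adj (x (q (r n))) X) (Adj g X)) \<longlonglongrightarrow> dist Z (Adj g X)"
      by (intro tendsto_dist lim tendsto_const)
    then have "dist Z (Adj g X) \<ge> e"
      by (rule tendsto_lowerbound) (use q(2) in auto)
    ultimately show False using e(1) by simp
  qed
qed

end

section \<open>One-parameter groups of linear maps\<close>

text \<open>The representation space is only known to be an inner product space with a finite
  spanning set, so bases of its subspaces are handled as explicit orthonormal sets.\<close>

lemma finite_orthonormal_basis:
  fixes B :: "'a::real_inner set"
  assumes "finite B"
  obtains E where "finite E" "span E = span B"
    "\<forall>a\<in>E. \<forall>b\<in>E. a \<bullet> b = (if a = b then 1 else 0)"
proof -
  obtain C where C: "finite C" "span C = span B" "pairwise orthogonal C"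
    using basis_orthogonal[OF assms] by blast
  define E where "E = (\<lambda>x. x /\<^sub>R norm x) ` (C - {0})"
  have "E \<subseteq> span C" by (auto simp: E_def intro: span_scale span_base)
  moreover have "C \<subseteq> span E"
  proof
    fix x assume x: "x \<in> C"
    show "x \<in> span E"
    proof (cases "x = 0")
      case False
      then have "x /\<^sub>R norm x \<in> span E" using x by (intro span_base) (auto simp: E_def)
      then have "norm x *\<^sub>R (x /\<^sub>R norm x) \<in> span E" by (rule span_scale)
      then show ?thesis using False by simp
    qed (simp add: span_zero)
  qed
  ultimately have "span E = span B" using C(2) by (metis span_eq)
  moreover have "a \<bullet> b = (if a = b then 1 else 0)" if ab: "a \<in> E" "b \<in> E" for a b
  proof -
    obtain x y where xy: "x \<in> C" "x \<noteq> 0" "a = x /\<^sub>R norm x" "y \<in> C" "y \<noteq> 0" "b = y /\<^sub>R norm y"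
      using ab by (auto simp: E_def)
    show ?thesis
    proof (cases "x = y")
      case True
      then show ?thesis using xy by (simp add: dot_square_norm power2_eq_square)
    next
      case False
      then have "x \<bullet> y = 0" using C(3) xy by (auto simp: pairwise_def orthogonal_def)
      then have "a \<bullet> b = 0" using xy by simp
      moreover have "a \<noteq> b"
      proof
        assume "a = b"
        then have "a \<bullet> a = 0" using \<open>a \<bullet> b = 0\<close> by simp
        then show False using xy by simp
      qed
      ultimately show ?thesis by simp
    qed
  qed
  ultimately show ?thesis using C(1) by (intro that[of E]) (auto simp: E_def)
qed

lemma tendsto_mem_span:
  fixes E :: "'a::real_inner set"
  assumes E: "finite E" "\<And>a b. a \<in> E \<Longrightarrow> b \<in> E \<Longrightarrow> a \<bullet> b = (if a = b then 1 else 0)"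
    and x: "\<And>n. x n \<in> span E" "x \<longlonglongrightarrow> w"
  shows "w \<in> span E"
proof -
  have "(\<lambda>n. \<Sum>e\<in>E. (x n \<bullet> e) *\<^sub>R e) \<longlonglongrightarrow> (\<Sum>e\<in>E. (w \<bullet> e) *\<^sub>R e)"
    by (intro tendsto_intros x)
  then have "x \<longlonglongrightarrow> (\<Sum>e\<in>E. (w \<bullet> e) *\<^sub>R e)"
    using orthonormal_expansion[OF E x(1)] by simp
  with x(2) have "w = (\<Sum>e\<in>E. (w \<bullet> e) *\<^sub>R e)" by (rule LIMSEQ_unique)
  also have "\<dots> \<in> span E" by (intro span_sum span_scale span_base)
  finally show ?thesis .
qed

lemma finite_dim_subspace_orthonormal:
  fixes S :: "'a::real_inner set"
  assumes S: "subspace S" "S \<subseteq> span B" and B: "finite B"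
  obtains E where "finite E" "span E = S"
    "\<forall>a\<in>E. \<forall>b\<in>E. a \<bullet> b = (if a = b then 1 else 0)"
proof -
  obtain A where A: "A \<subseteq> S" "independent A" "S \<subseteq> span A" by (metis maximal_independent_subset)
  have "finite A" using independent_span_bound[OF B A(2)] A(1) S(2) by blast
  moreover have "span A = S" using A S(1) by (simp add: span_minimal subset_antisym)
  ultimately show ?thesis using finite_orthonormal_basis[of A] that by metis
qed

lemma has_vector_derivative_shift:
  assumes "((\<lambda>h. f (t + h)) has_vector_derivative D) (at 0)"
  shows "(f has_vector_derivative D) (at t)"
  using assms by (simp add: has_vector_derivative_iff_quotient)

lemma zero_vector_derivative_const:
  assumes "\<And>t. (f has_vector_derivative 0) (at t)"
  shows "f t = f 0"
proof -
  have "(f has_derivative (\<lambda>_. 0)) (at x within UNIV)" for x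
    using assms[of x] by (simp add: has_vector_derivative_def)
  from has_derivative_zero_constant[OF convex_UNIV this] show ?thesis by (metis UNIV_I)
qed

text \<open>Covers both the representation restricted to a line and the adjoint action of a line on
  V. Only continuity in time is assumed; differentiability is a consequence of finite
  dimension.\<close>

locale linear_flow =
  fixes E :: "'a::real_inner set" and \<Phi> :: "real \<Rightarrow> 'a \<Rightarrow> 'a"
  assumes finite_E: "finite E"
    and ortho: "\<And>a b. a \<in> E \<Longrightarrow> b \<in> E \<Longrightarrow> a \<bullet> b = (if a = b then 1 else 0)"
    and flow_mem: "w \<in> span E \<Longrightarrow> \<Phi> s w \<in> span E"
    and flow_add: "w \<in> span E \<Longrightarrow> z \<in> span E \<Longrightarrow> \<Phi> s (w + z) = \<Phi> s w + \<Phi> s z"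
    and flow_scale: "w \<in> span E \<Longrightarrow> \<Phi> s (r *\<^sub>R w) = r *\<^sub>R \<Phi> s w"
    and flow_zero: "w \<in> span E \<Longrightarrow> \<Phi> 0 w = w"
    and flow_hom: "w \<in> span E \<Longrightarrow> \<Phi> (s + t) w = \<Phi> s (\<Phi> t w)"
    and flow_cont: "w \<in> span E \<Longrightarrow> continuous_on UNIV (\<lambda>s. \<Phi> s w)"
begin

lemma expansion: "w \<in> span E \<Longrightarrow> (\<Sum>e\<in>E. (w \<bullet> e) *\<^sub>R e) = w"
  by (rule orthonormal_expansion[OF finite_E ortho])

lemma flow_sum:
  assumes "finite A" "A \<subseteq> E"
  shows "\<Phi> s (\<Sum>e\<in>A. c e *\<^sub>R e) = (\<Sum>e\<in>A. c e *\<^sub>R \<Phi> s e)"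
  using assms
proof (induction A rule: finite_induct)
  case empty
  show ?case using flow_scale[of 0 s 0] by (simp add: span_zero)
next
  case (insert x F)
  then have "x \<in> span E" "(\<Sum>e\<in>F. c e *\<^sub>R e) \<in> span E"
    by (auto intro!: span_base span_sum span_scale)
  then show ?case using insert by (simp add: flow_add flow_scale span_scale)
qed

lemma flow_expansion: "w \<in> span E \<Longrightarrow> \<Phi> s w = (\<Sum>e\<in>E. (w \<bullet> e) *\<^sub>R \<Phi> s e)"
  using flow_sum[OF finite_E order_refl, of s "\<lambda>e. w \<bullet> e"] by (simp add: expansion)

text \<open>
  The averages of an orbit over short time intervals are differentiable and approximate its initial
  point; being a closed subspace, the set of all initial points of differentiable orbits is
  everything.
\<close>

lemma flow_differentiable:
  assumes w: "w \<in> span E"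
  shows "\<exists>D\<in>span E. ((\<lambda>s. \<Phi> s w) has_vector_derivative D) (at 0)"
proof -
  define S where "S = {w \<in> span E. \<exists>D\<in>span E. ((\<lambda>s. \<Phi> s w) has_vector_derivative D) (at 0)}"
  have "subspace S"
  proof (rule subspaceI)
    have "\<Phi> s 0 = 0" for s using flow_scale[of 0 s 0] by (simp add: span_zero)
    then show "0 \<in> S" by (auto simp: S_def span_zero intro!: bexI[of _ 0])
  next
    fix x y assume "x \<in> S" "y \<in> S"
    then obtain D D' where "x \<in> span E" "y \<in> span E" "D \<in> span E" "D' \<in> span E"
      "((\<lambda>s. \<Phi> s x) has_vector_derivative D) (at 0)" "((\<lambda>s. \<Phi> s y) has_vector_derivative D') (at 0)"
      by (auto simp: S_def)
    then show "x + y \<in> S"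
      by (auto simp: S_def flow_add intro!: bexI[of _ "D + D'"] has_vector_derivative_add span_add)
  next
    fix r x assume "x \<in> S"
    then obtain D where D: "x \<in> span E" "D \<in> span E" "((\<lambda>s. \<Phi> s x) has_vector_derivative D) (at 0)"
      by (auto simp: S_def)
    from bounded_linear.has_vector_derivative[OF bounded_linear_scaleR_right D(3), of r] D(1,2)
    show "r *\<^sub>R x \<in> S"
      by (auto simp: S_def flow_scale intro!: bexI[of _ "r *\<^sub>R D"] span_scale)
  qed
  moreover have "S \<subseteq> span E" by (auto simp: S_def)
  ultimately obtain E' where E': "finite E'" "span E' = S"
    "\<forall>a\<in>E'. \<forall>b\<in>E'. a \<bullet> b = (if a = b then 1 else 0)"
    by (rule finite_dim_subspace_orthonormal[OF _ _ finite_E])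
  define f where "f e s = \<Phi> s w \<bullet> e" for e s
  have fcont: "continuous_on A (f e)" for e A
    unfolding f_def by (intro continuous_intros continuous_on_subset[OF flow_cont[OF w]]) auto
  \<comment> \<open>Antiderivatives of the coordinates of the orbit. The times t + h with |t| < 1
    and 0 \<le> h \<le> 1 that occur below lie in the interior of this interval.\<close>
  have "\<exists>g. \<forall>x\<in>{-2..2}. (g has_vector_derivative f e x) (at x within {-2..2})" for e
    using antiderivative_continuous[OF fcont] by metis
  then obtain g where g0: "\<And>e x. x \<in> {-2..2} \<Longrightarrow> (g e has_vector_derivative f e x) (at x within {-2..2})"
    by metis
  have g: "(g e has_vector_derivative f e x) (at x)" if "\<bar>x\<bar> < 2" for e x
    using g0[of x e] that at_within_interior[of x "{-2..2::real}"] by (simp add: abs_less_iff)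
  \<comment> \<open>The average of the orbit of w over the times from 0 to h.\<close>
  define a where "a h = (\<Sum>e\<in>E. ((g e h - g e 0) / h) *\<^sub>R e)" for h
  \<comment> \<open>Applying the flow at time t to the integral over [0, h] gives the integral over
    [t, t + h]: both sides have the same derivative in h and vanish at h = 0. The right side is
    visibly differentiable in t.\<close>
  have coord: "(\<Sum>e\<in>E. (g e h - g e 0) * (\<Phi> t e \<bullet> e')) = g e' (t + h) - g e' t"
    if t: "\<bar>t\<bar> < 1" and h: "0 \<le> h" "h \<le> 1" and e': "e' \<in> E" for t h e'
  proof -
    define q where "q x = (\<Sum>e\<in>E. (g e x - g e 0) * (\<Phi> t e \<bullet> e')) - (g e' (t + x) - g e' t)" for x
    have "(q has_vector_derivative 0) (at x within {0..1})" if x: "x \<in> {0..1}" for x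
    proof -
      have sh: "((\<lambda>x. g e' (t + x)) has_vector_derivative f e' (t + x)) (at x)"
      proof -
        have "\<bar>t + x\<bar> < 2" using x t by (auto simp: abs_if split: if_splits)
        then show ?thesis
          using g[of "t + x" e'] by (simp add: has_vector_derivative_iff_quotient add.assoc)
      qed
      have "(q has_vector_derivative (\<Sum>e\<in>E. (f e x - 0) * (\<Phi> t e \<bullet> e')) - (f e' (t + x) - 0)) (at x)"
        unfolding q_def using x
        by (intro has_vector_derivative_diff has_vector_derivative_sum has_vector_derivative_mult_left
            has_vector_derivative_const g sh) auto
      moreover have "(\<Sum>e\<in>E. f e x * (\<Phi> t e \<bullet> e')) = f e' (t + x)"
        using flow_expansion[OF flow_mem[OF w], of t x]
        by (simp add: f_def flow_hom[OF w] inner_sum_left)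
      ultimately show ?thesis by (simp add: has_vector_derivative_at_within)
    qed
    then have "(q has_derivative (\<lambda>_. 0)) (at x within {0..1})" if "x \<in> {0..1}" for x
      using that by (simp add: has_vector_derivative_def)
    then have "q h = q 0"
      using has_derivative_zero_constant[of "{0..1::real}" q] h by (metis atLeastAtMost_iff convex_real_interval(5) order_refl zero_le_one)
    then show ?thesis by (simp add: q_def)
  qed
  have aS: "a h \<in> S" if h: "0 < h" "h \<le> 1" for h
  proof -
    have aE: "a h \<in> span E" unfolding a_def by (intro span_sum span_scale span_base)
    define D where "D = (\<Sum>e'\<in>E. ((f e' h - f e' 0) / h) *\<^sub>R e')"
    have eq: "(\<Sum>e'\<in>E. ((g e' (t + h) - g e' t) / h) *\<^sub>R e') = \<Phi> t (a h)" if t: "\<bar>t\<bar> < 1" for t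
    proof -
      have "\<Phi> t (a h) = (\<Sum>e\<in>E. ((g e h - g e 0) / h) *\<^sub>R \<Phi> t e)"
        unfolding a_def by (rule flow_sum[OF finite_E order_refl])
      then have "\<Phi> t (a h) \<bullet> e' = (\<Sum>e\<in>E. (g e h - g e 0) * (\<Phi> t e \<bullet> e')) / h" for e'
        by (simp add: inner_sum_left sum_divide_distrib)
      then have "\<Phi> t (a h) \<bullet> e' = (g e' (t + h) - g e' t) / h" if "e' \<in> E" for e'
        using coord[OF t _ _ that] h by simp
      then show ?thesis using expansion[OF flow_mem[OF aE], of t] by (metis (no_types, lifting) sum.cong)
    qed
    have "((\<lambda>t. \<Sum>e'\<in>E. ((g e' (t + h) - g e' t) / h) *\<^sub>R e') has_vector_derivative D) (at 0)"
    proof -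
      have sh: "((\<lambda>t. g e' (t + h)) has_vector_derivative f e' h) (at 0)" for e'
        using g[of h e'] h by (simp add: has_vector_derivative_iff_quotient add.commute)
      show ?thesis unfolding D_def divide_inverse
        by (intro has_vector_derivative_sum bounded_linear.has_vector_derivative[OF bounded_linear_scaleR_left]
            has_vector_derivative_mult_left has_vector_derivative_diff sh g) simp
    qed
    then have "((\<lambda>t. \<Phi> t (a h)) has_vector_derivative D) (at 0)"
      by (rule has_vector_derivative_transform_within_open[of _ _ _ "{-1<..<1}"]) (auto simp: eq)
    moreover have "D \<in> span E" unfolding D_def by (intro span_sum span_scale span_base)
    ultimately show ?thesis using aE by (auto simp: S_def)
  qed
  have "(\<lambda>n. a (1 / real (Suc n))) \<longlonglongrightarrow> (\<Sum>e\<in>E. f e 0 *\<^sub>R e)"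
    unfolding a_def
  proof (intro tendsto_sum tendsto_scaleR tendsto_const)
    fix e
    show "(\<lambda>n. (g e (1 / real (Suc n)) - g e 0) / (1 / real (Suc n))) \<longlonglongrightarrow> f e 0"
      using has_vector_derivative_sequentially[OF g[of 0 e] inverse_Suc_tendsto]
      by (simp add: divide_inverse mult.commute)
  qed
  moreover have "(\<Sum>e\<in>E. f e 0 *\<^sub>R e) = w" using w by (simp add: f_def flow_zero expansion)
  ultimately have lim: "(\<lambda>n. a (1 / real (Suc n))) \<longlonglongrightarrow> w" by simp
  have "a (1 / real (Suc n)) \<in> span E'" for n unfolding E'(2) by (rule aS) simp_all
  from tendsto_mem_span[OF E'(1) E'(3)[rule_format] this lim] have "w \<in> span E'" by blast
  then show ?thesis by (simp add: E'(2) S_def)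
qed

definition gen :: "'a \<Rightarrow> 'a" where
  "gen w = vector_derivative (\<lambda>s. \<Phi> s w) (at 0)"

lemma gen_derivative_0:
  assumes "w \<in> span E"
  shows "((\<lambda>s. \<Phi> s w) has_vector_derivative gen w) (at 0)" "gen w \<in> span E"
proof -
  obtain D where "D \<in> span E" "((\<lambda>s. \<Phi> s w) has_vector_derivative D) (at 0)"
    using flow_differentiable[OF assms] by blast
  then show "((\<lambda>s. \<Phi> s w) has_vector_derivative gen w) (at 0)" "gen w \<in> span E"
    unfolding gen_def by (simp_all add: vector_derivative_at)
qed

lemma gen_eqI: "((\<lambda>s. \<Phi> s w) has_vector_derivative D) (at 0) \<Longrightarrow> gen w = D"
  unfolding gen_def by (rule vector_derivative_at)

text \<open>Expanding \<open>w s\<close> in the basis E turns the moving argument into scalar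
  functions times orbits of fixed vectors, to which the ordinary product rule applies. It serves to
  differentiate conjugations.\<close>

lemma flow_product_rule:
  assumes w: "\<And>s. w s \<in> span E" and w': "(w has_vector_derivative D) (at t)" "D \<in> span E"
  shows "((\<lambda>s. \<Phi> s (w s)) has_vector_derivative \<Phi> t (gen (w t) + D)) (at t)"
proof -
  have orbit: "((\<lambda>s. \<Phi> s z) has_vector_derivative \<Phi> t (gen z)) (at t)" if z: "z \<in> span E" for z
  proof (rule has_vector_derivative_shift)
    have "((\<lambda>h. \<Sum>e\<in>E. (\<Phi> h z \<bullet> e) *\<^sub>R \<Phi> t e) has_vector_derivative (\<Sum>e\<in>E. (gen z \<bullet> e) *\<^sub>R \<Phi> t e)) (at 0)"
      by (intro has_vector_derivative_sum bounded_linear.has_vector_derivative[OF bounded_linear_scaleR_left]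
          bounded_linear.has_vector_derivative[OF bounded_linear_inner_left] gen_derivative_0 z)
    then show "((\<lambda>h. \<Phi> (t + h) z) has_vector_derivative \<Phi> t (gen z)) (at 0)"
      by (simp add: flow_hom z flow_mem gen_derivative_0 flip: flow_expansion)
  qed
  have "((\<lambda>s. \<Sum>e\<in>E. (w s \<bullet> e) *\<^sub>R \<Phi> s e) has_vector_derivative
      (\<Sum>e\<in>E. (w t \<bullet> e) *\<^sub>R \<Phi> t (gen e) + (D \<bullet> e) *\<^sub>R \<Phi> t e)) (at t)"
  proof (intro has_vector_derivative_sum)
    fix e assume "e \<in> E"
    then have e: "((\<lambda>s. \<Phi> s e) has_vector_derivative \<Phi> t (gen e)) (at t)"
      by (intro orbit span_base)
    have "((\<lambda>s. w s \<bullet> e) has_field_derivative D \<bullet> e) (at t)"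
      using bounded_linear.has_vector_derivative[OF bounded_linear_inner_left w'(1), of e]
      by (simp add: has_real_derivative_iff_has_vector_derivative)
    from has_vector_derivative_scaleR[OF this e]
    show "((\<lambda>s. (w s \<bullet> e) *\<^sub>R \<Phi> s e) has_vector_derivative
        (w t \<bullet> e) *\<^sub>R \<Phi> t (gen e) + (D \<bullet> e) *\<^sub>R \<Phi> t e) (at t)" .
  qed
  moreover have "(\<Sum>e\<in>E. (w t \<bullet> e) *\<^sub>R \<Phi> t (gen e)) = \<Phi> t (gen (w t))"
  proof -
    have "((\<lambda>s. \<Sum>e\<in>E. (w t \<bullet> e) *\<^sub>R \<Phi> s e) has_vector_derivative (\<Sum>e\<in>E. (w t \<bullet> e) *\<^sub>R \<Phi> t (gen e))) (at t)"
      by (intro has_vector_derivative_sum bounded_linear.has_vector_derivative[OF bounded_linear_scaleR_right]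
          orbit span_base)
    then have "((\<lambda>s. \<Phi> s (w t)) has_vector_derivative (\<Sum>e\<in>E. (w t \<bullet> e) *\<^sub>R \<Phi> t (gen e))) (at t)"
      by (simp add: w flip: flow_expansion)
    with orbit[OF w] show ?thesis by (metis vector_derivative_unique_at)
  qed
  ultimately show ?thesis
    by (simp add: w w' sum.distrib flow_add gen_derivative_0 flip: flow_expansion)
qed

lemma flow_derivative:
  assumes "w \<in> span E"
  shows "((\<lambda>s. \<Phi> s w) has_vector_derivative \<Phi> t (gen w)) (at t)"
  using flow_product_rule[of "\<lambda>_. w" 0 t] assms by (simp add: span_zero)

lemma gen_add: "w \<in> span E \<Longrightarrow> z \<in> span E \<Longrightarrow> gen (w + z) = gen w + gen z"
  by (rule gen_eqI) (simp add: flow_add has_vector_derivative_add gen_derivative_0)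

lemma gen_scale: "w \<in> span E \<Longrightarrow> gen (r *\<^sub>R w) = r *\<^sub>R gen w"
  by (rule gen_eqI)
    (simp add: flow_scale gen_derivative_0 bounded_linear.has_vector_derivative[OF bounded_linear_scaleR_right])

lemma gen_flow: "w \<in> span E \<Longrightarrow> gen (\<Phi> t w) = \<Phi> t (gen w)"
proof (rule gen_eqI)
  assume w: "w \<in> span E"
  have "((\<lambda>s. \<Phi> (s + t) w) has_vector_derivative \<Phi> t (gen w)) (at 0)"
    using flow_derivative[OF w, of t] by (simp add: has_vector_derivative_iff_quotient add.commute)
  then show "((\<lambda>s. \<Phi> s (\<Phi> t w)) has_vector_derivative \<Phi> t (gen w)) (at 0)"
    by (simp add: flow_hom[OF w])
qed

end

section \<open>Complex inner products and differentiated representations\<close>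

lemma cinner_add_right: "cinner x (y + z) = cinner x y + cinner x z"
  by (metis cinner_add_left cinner_commute complex_cnj_add)

lemma cinner_scaleC_right: "cinner x (c *\<^sub>C y) = cnj c * cinner x y"
  by (metis cinner_commute cinner_scaleC_left complex_cnj_cnj complex_cnj_mult)

lemma cinner_scaleR_left: "cinner (r *\<^sub>R x) y = of_real r * cinner x y"
  by (simp add: scaleR_scaleC cinner_scaleC_left)

lemma cinner_scaleR_right: "cinner x (r *\<^sub>R y) = of_real r * cinner x y"
  by (simp add: scaleR_scaleC cinner_scaleC_right)

lemma cinner_zero_left [simp]: "cinner 0 x = 0" and cinner_zero_right [simp]: "cinner x 0 = 0"
  using cinner_scaleR_left[of 0 x x] cinner_scaleR_right[of x 0 x] by simp_all

lemma cinner_minus_left: "cinner (- x) y = - cinner x y"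
  using cinner_scaleR_left[of "- 1" x y] by simp

lemma cinner_diff_left: "cinner (x - y) z = cinner x z - cinner y z"
  using cinner_add_left[of x "- y" z] by (simp add: cinner_minus_left)

lemma cinner_sum_left: "cinner (\<Sum>a\<in>A. f a) y = (\<Sum>a\<in>A. cinner (f a) y)"
  by (induction A rule: infinite_finite_induct) (simp_all add: cinner_add_left)

lemma cinner_sum_right: "cinner y (\<Sum>a\<in>A. f a) = (\<Sum>a\<in>A. cinner y (f a))"
  by (induction A rule: infinite_finite_induct) (simp_all add: cinner_add_right)

lemma cinner_self: "cinner x x = of_real ((norm x)\<^sup>2)"
proof -
  have "Im (cinner x x) = 0" using cinner_commute[of x x] by (simp add: complex_eq_iff)
  moreover have "Re (cinner x x) = (norm x)\<^sup>2"
    by (simp add: inner_eq_Re_cinner[symmetric] dot_square_norm)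
  ultimately show ?thesis by (simp add: complex_eq_iff)
qed

lemma cinner_eq_zero_iff: "cinner x x = 0 \<longleftrightarrow> x = 0"
  by (simp add: cinner_self)

lemma cinner_ext: "(\<And>w. cinner u w = cinner u' w) \<Longrightarrow> u = u'"
  using cinner_eq_zero_iff[of "u - u'"] by (simp add: cinner_diff_left)

lemma norm_scaleC:
  fixes x :: "'a::complex_inner"
  shows "norm (c *\<^sub>C x) = cmod c * norm x"
proof -
  have "cinner (c *\<^sub>C x) (c *\<^sub>C x) = (c * cnj c) * cinner x x"
    by (simp only: cinner_scaleC_left cinner_scaleC_right mult_ac)
  then have "complex_of_real ((norm (c *\<^sub>C x))\<^sup>2) = of_real ((cmod c * norm x)\<^sup>2)"
    by (simp only: cinner_self power_mult_distrib of_real_mult complex_norm_square)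
  then have "(norm (c *\<^sub>C x))\<^sup>2 = (cmod c * norm x)\<^sup>2" by (simp only: of_real_eq_iff)
  then show ?thesis by (rule power2_eq_imp_eq) auto
qed

lemma norm_cinner_le: "cmod (cinner x y) \<le> norm x * norm y"
proof (cases "cinner x y = 0")
  case False
  \<comment> \<open>A phase that makes the inner product real and nonnegative, so that the real
    Cauchy-Schwarz inequality applies.\<close>
  define c where "c = cnj (cinner x y) / of_real (cmod (cinner x y))"
  have c: "cmod c = 1" using False by (simp add: c_def norm_divide)
  have "cinner (c *\<^sub>C x) y = of_real (cmod (cinner x y))"
    using False by (simp add: c_def cinner_scaleC_left complex_norm_square[symmetric] power2_eq_square
        field_simps)
  then have "cmod (cinner x y) = (c *\<^sub>C x) \<bullet> y" by (simp add: inner_eq_Re_cinner)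
  also have "\<dots> \<le> norm (c *\<^sub>C x) * norm y" by (rule norm_cauchy_schwarz)
  finally show ?thesis by (simp add: norm_scaleC c)
qed simp

lemma bounded_bilinear_cinner: "bounded_bilinear cinner"
proof
  show "\<exists>K. \<forall>a b. cmod (cinner a b) \<le> norm a * norm b * K"
    by (intro exI[of _ 1]) (simp add: norm_cinner_le)
qed (simp_all add: cinner_add_left cinner_add_right cinner_scaleR_left cinner_scaleR_right
    scaleR_conv_of_real)

lemma bounded_linear_scaleC: "bounded_linear (\<lambda>x :: 'a::complex_inner. c *\<^sub>C x)"
proof
  show "\<exists>K. \<forall>x::'a. norm (c *\<^sub>C x) \<le> norm x * K"
    by (intro exI[of _ "cmod c"]) (simp add: norm_scaleC mult.commute)
qed (simp_all add: scaleC_add_right scaleR_scaleC scaleC_scaleC mult.commute)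

lemmas tendsto_cinner = bounded_bilinear.tendsto[OF bounded_bilinear_cinner]
lemmas has_vector_derivative_cinner =
  bounded_bilinear.has_vector_derivative[OF bounded_bilinear_cinner]
lemmas has_vector_derivative_scaleC = bounded_linear.has_vector_derivative[OF bounded_linear_scaleC]

lemma continuous_on_cinner:
  "continuous_on S f \<Longrightarrow> continuous_on S g \<Longrightarrow> continuous_on S (\<lambda>x. cinner (f x) (g x))"
  unfolding continuous_on_def by (auto intro: tendsto_cinner)

definition corthonormal :: "'a::complex_inner set \<Rightarrow> bool" where
  "corthonormal E \<longleftrightarrow> finite E \<and> (\<forall>a\<in>E. \<forall>b\<in>E. cinner a b = (if a = b then 1 else 0))"

lemma corthonormal_expansion:
  assumes E: "corthonormal E" and x: "x \<in> cspan E"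
  shows "(\<Sum>e\<in>E. cinner x e *\<^sub>C e) = x"
  using x
proof (induction rule: complex_vector.span_induct_alt)
  case (step c a y)
  have "(\<Sum>e\<in>E. (c * cinner a e) *\<^sub>C e) = (\<Sum>e\<in>E. if e = a then c *\<^sub>C a else 0)"
    using step(1) E by (intro sum.cong) (auto simp: corthonormal_def)
  also have "\<dots> = c *\<^sub>C a" using step(1) E by (simp add: corthonormal_def)
  finally show ?case
    using step by (simp add: cinner_add_left cinner_scaleC_left scaleC_add_left sum.distrib)
qed simp

text \<open>Gram-Schmidt, one vector at a time: y is the residue of x, and if it vanishes, x adds
  nothing to the span.\<close>

lemma finite_corthonormal_basis:
  assumes "finite B"
  shows "\<exists>E. corthonormal E \<and> cspan E = cspan B"
  using assms
proof (induction B rule: finite_induct)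
  case empty
  show ?case by (intro exI[of _ "{}"]) (simp add: corthonormal_def)
next
  case (insert x B)
  then obtain E where E: "corthonormal E" "cspan E = cspan B" by blast
  define p where "p = (\<Sum>e\<in>E. cinner x e *\<^sub>C e)"
  define y where "y = x - p"
  have p: "p \<in> cspan E" unfolding p_def
    by (intro complex_vector.span_sum complex_vector.span_scale complex_vector.span_base)
  have ye: "cinner y e = 0" if "e \<in> E" for e
  proof -
    have "cinner p e = (\<Sum>a\<in>E. if a = e then cinner x e else 0)"
      unfolding p_def cinner_sum_left using E(1) that
      by (intro sum.cong) (auto simp: cinner_scaleC_left corthonormal_def)
    also have "\<dots> = cinner x e" using E(1) that by (simp add: corthonormal_def)
    finally show ?thesis by (simp add: y_def cinner_diff_left)
  qed
  show ?case
  proof (cases "y = 0")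
    case True
    then have "x \<in> cspan B" using p E by (simp add: y_def)
    then have "cspan (insert x B) = cspan B"
      by (metis complex_vector.span_redundant)
    then show ?thesis using E by auto
  next
    case False
    define z where "z = (1 / complex_of_real (norm y)) *\<^sub>C y"
    have "norm z = 1" using False by (simp add: z_def norm_scaleC norm_divide)
    then have z1: "cinner z z = 1" by (simp add: cinner_self)
    have ze: "cinner z e = 0" "cinner e z = 0" if "e \<in> E" for e
      using ye[OF that] cinner_commute[of e y]
      by (simp_all add: z_def cinner_scaleC_left cinner_scaleC_right)
    have "corthonormal (insert z E)"
      using E(1) z1 ze by (auto simp: corthonormal_def)
    moreover have "cspan (insert z E) = cspan (insert x B)"
    proof -
      have yz: "y = complex_of_real (norm y) *\<^sub>C z"
        using False by (simp add: z_def scaleC_scaleC scaleC_one)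
      have "z \<in> cspan (insert x B)"
      proof -
        have "p \<in> cspan (insert x B)" using p E(2) complex_vector.span_mono[of B "insert x B"] by blast
        then have "y \<in> cspan (insert x B)" unfolding y_def
          by (rule complex_vector.span_diff[OF complex_vector.span_base[OF insertI1]])
        then show ?thesis unfolding z_def by (rule complex_vector.span_scale)
      qed
      moreover have "E \<subseteq> cspan (insert x B)"
        using E(2) complex_vector.span_superset[of E] complex_vector.span_mono[of B "insert x B"] by blast
      moreover have "x \<in> cspan (insert z E)"
      proof -
        have "y \<in> cspan (insert z E)"
          by (subst yz) (intro complex_vector.span_scale complex_vector.span_base, simp)
        moreover have "p \<in> cspan (insert z E)" using p complex_vector.span_mono[of E "insert z E"] by blast
        ultimately have "y + p \<in> cspan (insert z E)" by (rule complex_vector.span_add)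
        then show ?thesis by (simp add: y_def)
      qed
      moreover have "B \<subseteq> cspan (insert z E)"
        using E(2) complex_vector.span_superset[of B] complex_vector.span_mono[of E "insert z E"] by blast
      ultimately have "insert z E \<subseteq> cspan (insert x B)" "insert x B \<subseteq> cspan (insert z E)" by blast+
      then show ?thesis by (simp only: complex_vector.span_eq)
    qed
    ultimately show ?thesis by blast
  qed
qed

lemma finite_dim_csubspace_corthonormal:
  assumes S: "csubspace S" and B: "finite B" "S \<subseteq> cspan B"
  shows "\<exists>E. corthonormal E \<and> cspan E = S"
proof -
  obtain A where A: "A \<subseteq> S" "complex_vector.independent A" "S \<subseteq> cspan A"
    by (metis complex_vector.maximal_independent_subset)
  have "finite A" using complex_vector.independent_span_bound[OF B(1) A(2)] A(1) B(2) by blast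
  moreover have "cspan A = S"
    using A S by (simp add: complex_vector.span_minimal subset_antisym)
  ultimately show ?thesis using finite_corthonormal_basis by metis
qed

lemma cspan_subset_real_span:
  fixes B :: "'a::complex_inner set"
  shows "cspan B \<subseteq> span (B \<union> (\<lambda>b. \<i> *\<^sub>C b) ` B)"
proof
  fix x assume "x \<in> cspan B"
  then show "x \<in> span (B \<union> (\<lambda>b. \<i> *\<^sub>C b) ` B)"
  proof (induction rule: complex_vector.span_induct_alt)
    case (step c b y)
    have "Re c *\<^sub>R b + Im c *\<^sub>R (\<i> *\<^sub>C b) = c *\<^sub>C b"
    proof -
      have "c = of_real (Re c) + of_real (Im c) * \<i>" by (simp add: complex_eq mult.commute)
      then have "c *\<^sub>C b = (of_real (Re c) + of_real (Im c) * \<i>) *\<^sub>C b" by simp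
      then show ?thesis by (simp add: scaleR_scaleC scaleC_add_left scaleC_scaleC)
    qed
    moreover have "Re c *\<^sub>R b + Im c *\<^sub>R (\<i> *\<^sub>C b) \<in> span (B \<union> (\<lambda>b. \<i> *\<^sub>C b) ` B)"
      using step by (intro span_add span_scale span_base) auto
    ultimately show ?case using step by (metis span_add)
  qed (simp add: span_zero)
qed

locale group_chart_rep = group_chart G V U \<psi> R C
  for G :: "('g::{t2_space, second_countable_topology}, 'e::euclidean_space) lie_group_data" (structure)
    and V :: "'e set" and U :: "'g set" and \<psi> :: "'g \<Rightarrow> 'e" and R C :: real +
  fixes \<sigma> :: "'g \<Rightarrow> 'h::complex_inner \<Rightarrow> 'h"
  assumes rep: "unitary_rep G UNIV \<sigma>"
    and compact_group: "compact (UNIV :: 'g set)"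
    and connected_group: "connected (UNIV :: 'g set)"
begin

lemma sigma_add: "\<sigma> g (u + v) = \<sigma> g u + \<sigma> g v"
  and sigma_scaleC: "\<sigma> g (c *\<^sub>C u) = c *\<^sub>C \<sigma> g u"
  and cinner_sigma: "cinner (\<sigma> g u) (\<sigma> g v) = cinner u v"
  and sigma_one [simp]: "\<sigma> \<one> u = u"
  and sigma_mult: "\<sigma> (g \<otimes> h) u = \<sigma> g (\<sigma> h u)"
  and sigma_cont: "continuous_on UNIV (\<lambda>g. \<sigma> g u)"
  using rep by (auto simp: unitary_rep_def clinear_on_def)

lemma sigma_scaleR: "\<sigma> g (r *\<^sub>R u) = r *\<^sub>R \<sigma> g u"
  by (simp add: scaleR_scaleC sigma_scaleC)

lemma sigma_diff: "\<sigma> g (u - v) = \<sigma> g u - \<sigma> g v"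
  using sigma_add[of g "u - v" v] by simp

lemma sigma_zero [simp]: "\<sigma> g 0 = 0"
  using sigma_diff[of g 0 0] by simp

lemma sigma_sum: "\<sigma> g (\<Sum>a\<in>A. f a) = (\<Sum>a\<in>A. \<sigma> g (f a))"
  by (induction A rule: infinite_finite_induct) (simp_all add: sigma_add)

lemma sigma_inv [simp]: "\<sigma> (inv g) (\<sigma> g u) = u" "\<sigma> g (\<sigma> (inv g) u) = u"
  by (simp_all flip: sigma_mult)

lemma cinner_sigma_left: "cinner (\<sigma> g u) v = cinner u (\<sigma> (inv g) v)"
  using cinner_sigma[of g u "\<sigma> (inv g) v"] by simp

lemma norm_sigma [simp]: "norm (\<sigma> g u) = norm u"
proof -
  have "complex_of_real ((norm (\<sigma> g u))\<^sup>2) = of_real ((norm u)\<^sup>2)"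
    unfolding cinner_self[symmetric] by (rule cinner_sigma)
  then have "(norm (\<sigma> g u))\<^sup>2 = (norm u)\<^sup>2" by (simp only: of_real_eq_iff)
  then show ?thesis by (rule power2_eq_imp_eq) auto
qed

lemma sigma_tendsto: "(x \<longlongrightarrow> g) F \<Longrightarrow> ((\<lambda>n. \<sigma> (x n) u) \<longlongrightarrow> \<sigma> g u) F"
  using continuous_on_tendsto_compose[OF sigma_cont] by simp

lemma finite_dim: "\<exists>B. finite B \<and> cspan B = (UNIV :: 'h set)"
  using rep by (auto simp: unitary_rep_def)

lemma exists_orthonormal_basis: "\<exists>E :: 'h set. corthonormal E \<and> cspan E = UNIV"
  using finite_dim finite_corthonormal_basis by metis

text \<open>A basis over the reals, because \<open>linear_flow\<close> concerns real inner product
  spaces; complex linearity of the generator is recovered in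
  \<open>dsigma_scaleC_right\<close>.\<close>

definition real_basis :: "'h set" where
  "real_basis = (SOME E. finite E \<and> span E = UNIV \<and> (\<forall>a\<in>E. \<forall>b\<in>E. a \<bullet> b = (if a = b then 1 else 0)))"

lemma real_basis: "finite real_basis" "span real_basis = UNIV"
  "a \<in> real_basis \<Longrightarrow> b \<in> real_basis \<Longrightarrow> a \<bullet> b = (if a = b then 1 else 0)"
proof -
  obtain B where B: "finite B" "cspan B = (UNIV :: 'h set)" using finite_dim by blast
  have "span (B \<union> (\<lambda>b. \<i> *\<^sub>C b) ` B) = UNIV" using cspan_subset_real_span[of B] B by auto
  moreover have "finite (B \<union> (\<lambda>b. \<i> *\<^sub>C b) ` B)" using B by simp
  ultimately obtain E :: "'h set" where "finite E" "span E = UNIV" "\<forall>a\<in>E. \<forall>b\<in>E. a \<bullet> b = (if a = b then 1 else 0)"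
    using finite_orthonormal_basis by metis
  then have "\<exists>E :: 'h set. finite E \<and> span E = UNIV \<and> (\<forall>a\<in>E. \<forall>b\<in>E. a \<bullet> b = (if a = b then 1 else 0))"
    by blast
  from someI_ex[OF this]
  show "finite real_basis" "span real_basis = UNIV"
    "a \<in> real_basis \<Longrightarrow> b \<in> real_basis \<Longrightarrow> a \<bullet> b = (if a = b then 1 else 0)"
    unfolding real_basis_def by blast+
qed

lemma rep_flow:
  assumes X: "X \<in> V"
  shows "linear_flow real_basis (\<lambda>s. \<sigma> (Exp (s *\<^sub>R X)))"
proof
  show "continuous_on UNIV (\<lambda>s. \<sigma> (Exp (s *\<^sub>R X)) w)" for w
    using continuous_on_compose2[OF sigma_cont continuous_on_Exp_line[OF X]] by simp
qed (simp_all add: real_basis sigma_add sigma_scaleR Exp_add[OF X] sigma_mult)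

definition dsigma :: "'e \<Rightarrow> 'h \<Rightarrow> 'h" where
  "dsigma X v = vector_derivative (\<lambda>s. \<sigma> (Exp (s *\<^sub>R X)) v) (at 0)"

context
  fixes X assumes X: "X \<in> V"
begin

interpretation flow: linear_flow real_basis "\<lambda>s. \<sigma> (Exp (s *\<^sub>R X))"
  by (rule rep_flow[OF X])

lemma flow_gen_eq: "flow.gen = dsigma X"
  by (simp add: fun_eq_iff flow.gen_def dsigma_def)

lemma dsigma_derivative:
  "((\<lambda>s. \<sigma> (Exp (s *\<^sub>R X)) v) has_vector_derivative \<sigma> (Exp (t *\<^sub>R X)) (dsigma X v)) (at t)"
  using flow.flow_derivative[of v t] unfolding flow_gen_eq by (simp add: real_basis)

lemma dsigma_product_rule:
  assumes "(w has_vector_derivative D) (at t)"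
  shows "((\<lambda>s. \<sigma> (Exp (s *\<^sub>R X)) (w s)) has_vector_derivative
      \<sigma> (Exp (t *\<^sub>R X)) (dsigma X (w t) + D)) (at t)"
  using flow.flow_product_rule[of w D t] assms unfolding flow_gen_eq by (simp add: real_basis)

lemma dsigma_eqI: "((\<lambda>s. \<sigma> (Exp (s *\<^sub>R X)) v) has_vector_derivative D) (at 0) \<Longrightarrow> dsigma X v = D"
  unfolding dsigma_def by (rule vector_derivative_at)

lemma dsigma_derivative_0: "((\<lambda>s. \<sigma> (Exp (s *\<^sub>R X)) v) has_vector_derivative dsigma X v) (at 0)"
  using dsigma_derivative[of v 0] by simp

lemma dsigma_add_right: "dsigma X (u + v) = dsigma X u + dsigma X v"
  using flow.gen_add[of u v] unfolding flow_gen_eq by (simp add: real_basis)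

lemma dsigma_scaleC_right: "dsigma X (c *\<^sub>C u) = c *\<^sub>C dsigma X u"
  by (rule dsigma_eqI)
    (use has_vector_derivative_scaleC[OF dsigma_derivative_0, of c u] in \<open>simp add: sigma_scaleC\<close>)

lemma dsigma_skew: "cinner (dsigma X u) v = - cinner u (dsigma X v)"
proof -
  have "((\<lambda>s. cinner (\<sigma> (Exp (s *\<^sub>R X)) u) (\<sigma> (Exp (s *\<^sub>R X)) v)) has_vector_derivative
      cinner u (dsigma X v) + cinner (dsigma X u) v) (at 0)"
    using has_vector_derivative_cinner[OF dsigma_derivative_0[of u] dsigma_derivative_0[of v]] by simp
  then have "((\<lambda>s. cinner u v) has_vector_derivative
      cinner u (dsigma X v) + cinner (dsigma X u) v) (at (0::real))" by (simp add: cinner_sigma)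
  from vector_derivative_unique_at[OF this has_vector_derivative_const]
  show ?thesis by (simp add: add_eq_0_iff)
qed

lemma dsigma_Adj: "dsigma (Adj g X) v = \<sigma> g (dsigma X (\<sigma> (inv g) v))"
proof -
  obtain E :: "'h set" where E: "corthonormal E" "cspan E = UNIV" using exists_orthonormal_basis by blast
  let ?w = "\<lambda>s. \<sigma> (Exp (s *\<^sub>R X)) (\<sigma> (inv g) v)"
  have eq: "(\<Sum>e\<in>E. cinner u e *\<^sub>C \<sigma> g e) = \<sigma> g u" for u
  proof -
    have "\<sigma> g u = \<sigma> g (\<Sum>e\<in>E. cinner u e *\<^sub>C e)" using corthonormal_expansion[OF E(1)] E(2) by simp
    then show ?thesis by (simp add: sigma_sum sigma_scaleC)
  qed
  have bl: "bounded_linear (\<lambda>u. cinner u e *\<^sub>C \<sigma> g e)" for e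
  proof
    show "\<exists>K. \<forall>x. norm (cinner x e *\<^sub>C \<sigma> g e) \<le> norm x * K"
    proof (intro exI allI)
      fix x show "norm (cinner x e *\<^sub>C \<sigma> g e) \<le> norm x * (norm e * norm e)"
        using mult_right_mono[OF norm_cinner_le[of x e] norm_ge_zero[of e]]
        by (simp add: norm_scaleC mult.assoc)
    qed
  qed (simp_all add: cinner_add_left scaleC_add_left cinner_scaleC_left scaleR_scaleC scaleC_scaleC)
  have "((\<lambda>s. \<Sum>e\<in>E. cinner (?w s) e *\<^sub>C \<sigma> g e) has_vector_derivative
      (\<Sum>e\<in>E. cinner (dsigma X (\<sigma> (inv g) v)) e *\<^sub>C \<sigma> g e)) (at 0)"
    by (intro has_vector_derivative_sum bounded_linear.has_vector_derivative[OF bl] dsigma_derivative_0)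
  then have "((\<lambda>s. \<sigma> g (?w s)) has_vector_derivative \<sigma> g (dsigma X (\<sigma> (inv g) v))) (at 0)"
    by (simp add: eq)
  then have "((\<lambda>s. \<sigma> (Exp (s *\<^sub>R Adj g X)) v) has_vector_derivative
      \<sigma> g (dsigma X (\<sigma> (inv g) v))) (at 0)"
    by (simp add: Exp_Adj[OF X] sigma_mult)
  then show ?thesis unfolding dsigma_def by (rule vector_derivative_at)
qed

lemma dsigma_scale_left: "dsigma (r *\<^sub>R X) v = r *\<^sub>R dsigma X v"
proof -
  have sc: "((\<lambda>s. s * r) has_vector_derivative r) (at 0)"
    by (auto intro!: derivative_eq_intros)
  have "((\<lambda>s. \<sigma> (Exp (s *\<^sub>R X)) v) has_vector_derivative dsigma X v) (at (0 * r))"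
    using dsigma_derivative_0 by simp
  from vector_diff_chain_at[OF sc this]
  have "((\<lambda>s. \<sigma> (Exp (s *\<^sub>R (r *\<^sub>R X))) v) has_vector_derivative r *\<^sub>R dsigma X v) (at 0)"
    by (simp add: o_def)
  then show ?thesis unfolding dsigma_def by (rule vector_derivative_at)
qed

end

text \<open>The point is uniformity in u: the sum of the displacements of the basis vectors bounds
  the displacement of every unit vector, and it tends to 0 at the identity.\<close>

lemma sigma_near_one: "\<exists>r>0. \<forall>g\<in>U. norm (\<psi> g) \<le> r \<longrightarrow> (\<forall>u. norm (\<sigma> g u - u) \<le> norm u / 2)"
proof (rule ccontr)
  let ?S = "\<lambda>g. \<Sum>e\<in>real_basis. norm (\<sigma> g e - e)"
  have bound: "norm (\<sigma> g u - u) \<le> norm u * ?S g" for g u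
  proof -
    have exp: "(\<Sum>e\<in>real_basis. (u \<bullet> e) *\<^sub>R e) = u"
      by (rule orthonormal_expansion) (simp_all add: real_basis)
    have "\<sigma> g u = (\<Sum>e\<in>real_basis. (u \<bullet> e) *\<^sub>R \<sigma> g e)"
      by (subst exp[symmetric]) (simp only: sigma_sum sigma_scaleR)
    then have "\<sigma> g u - u = (\<Sum>e\<in>real_basis. (u \<bullet> e) *\<^sub>R (\<sigma> g e - e))"
      using exp by (simp add: scaleR_diff_right sum_subtractf)
    also have "norm \<dots> \<le> (\<Sum>e\<in>real_basis. norm u * norm (\<sigma> g e - e))"
    proof (rule sum_norm_le)
      fix e assume e: "e \<in> real_basis"
      then have "norm e = 1" using real_basis(3)[OF e e] by (simp add: norm_eq_sqrt_inner)
      then have "\<bar>u \<bullet> e\<bar> \<le> norm u" using Cauchy_Schwarz_ineq2[of u e] by simp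
      then show "norm ((u \<bullet> e) *\<^sub>R (\<sigma> g e - e)) \<le> norm u * norm (\<sigma> g e - e)"
        by (simp add: mult_right_mono)
    qed
    finally show ?thesis by (simp add: sum_distrib_left)
  qed
  assume no: "\<not> ?thesis"
  have "\<exists>g. g \<in> U \<and> norm (\<psi> g) \<le> 1 / real (Suc n) \<and> 1 / 2 < ?S g" for n
  proof -
    obtain g u where g: "g \<in> U" "norm (\<psi> g) \<le> 1 / real (Suc n)" "norm u / 2 < norm (\<sigma> g u - u)"
      using no by (metis divide_pos_pos not_less of_nat_0_less_iff zero_less_Suc zero_less_one)
    have "norm u * (1 / 2) < norm u * ?S g" using bound[of g u] g(3) by linarith
    then show ?thesis using g mult_less_cancel_left_pos[of "norm u"] by (cases "u = 0") auto
  qed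
  then obtain g where g: "\<And>n. g n \<in> U" "\<And>n. norm (\<psi> (g n)) \<le> 1 / real (Suc n)" "\<And>n. 1 / 2 < ?S (g n)"
    by metis
  have "(\<lambda>n. \<psi> (g n)) \<longlonglongrightarrow> 0"
    by (rule Lim_null_comparison[OF _ inverse_Suc_tendsto]) (use g(2) in auto)
  then have "g \<longlonglongrightarrow> \<xi> 0" using g(1) R_pos subspace_0[OF subspace_V] by (intro tendsto_xi) auto
  then have "(\<lambda>n. ?S (g n)) \<longlonglongrightarrow> (\<Sum>e\<in>real_basis. norm (\<sigma> \<one> e - e))"
    by (intro tendsto_intros sigma_tendsto) simp
  then have "(\<lambda>n. ?S (g n)) \<longlonglongrightarrow> 0" by simp
  then have "\<forall>\<^sub>F n in sequentially. ?S (g n) < 1 / 2" by (rule order_tendstoD(2)) simp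
  then show False using g(3) by (metis (mono_tags, lifting) eventually_sequentially less_asym order_refl)
qed

text \<open>Take n of order r divided by the norm of \<open>\<psi> g\<close>. All powers up to n are
  still close to the identity, so in the telescoping sum for \<open>\<sigma> (g [^] n) u - u\<close>
  each of the n terms differs from \<open>\<sigma> g u - u\<close> by at most half of the norm of
  the latter. The whole sum has at most half the norm of u, so n times the norm of
  \<open>\<sigma> g u - u\<close> is at most the norm of u. No derivative of \<sigma> is involved;
  the estimate serves to prove \<open>dsigma\<close> additive in the Lie algebra.\<close>

lemma sigma_Lipschitz:
  "\<exists>K r. r > 0 \<and> (\<forall>g\<in>U. norm (\<psi> g) \<le> r \<longrightarrow> (\<forall>u. norm (\<sigma> g u - u) \<le> K * norm (\<psi> g) * norm u))"
proof -
  obtain r' where r': "r' > 0" "\<And>g u. g \<in> U \<Longrightarrow> norm (\<psi> g) \<le> r' \<Longrightarrow> norm (\<sigma> g u - u) \<le> norm u / 2"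
    using sigma_near_one by blast
  define r where "r = min (r' / 2) \<epsilon>"
  have r: "r > 0" "2 * r \<le> r'" "r \<le> \<epsilon>" using r'(1) eps_pos by (auto simp: r_def)
  have "norm (\<sigma> g u - u) \<le> 2 / r * norm (\<psi> g) * norm u" if g: "g \<in> U" "norm (\<psi> g) \<le> r" for g u
  proof (cases "\<psi> g = 0")
    case True
    then have "g = \<one>" using g(1) psi_eqD by simp
    then show ?thesis by simp
  next
    case False
    define x where "x = r / norm (\<psi> g)"
    define n where "n = nat \<lfloor>x\<rfloor>"
    have x1: "x \<ge> 1" using g(2) False r by (simp add: x_def)
    then have "1 \<le> \<lfloor>x\<rfloor>" by simp
    then have nx: "real n \<le> x" "x \<le> 2 * real n" unfolding n_def by linarith+
    have near: "norm (\<sigma> (g [^] k) w - w) \<le> norm w / 2" if "k \<le> n" for k w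
    proof -
      have "real k * norm (\<psi> g) \<le> x * norm (\<psi> g)" using that nx by (intro mult_right_mono) auto
      then have le: "real k * norm (\<psi> g) \<le> r" using False by (simp add: x_def)
      from pow_chart[OF g(1), of k] le r
      have "g [^] k \<in> U" "norm (\<psi> (g [^] k)) \<le> r'" by auto
      then show ?thesis using r'(2) by blast
    qed
    let ?a = "\<sigma> g u - u"
    have tele: "\<sigma> (g [^] m) u - u = (\<Sum>k<m. \<sigma> (g [^] k) ?a)" for m :: nat
      by (induction m) (simp_all add: sigma_mult sigma_diff algebra_simps)
    have "real n *\<^sub>R ?a = (\<sigma> (g [^] n) u - u) - (\<Sum>k<n. \<sigma> (g [^] k) ?a - ?a)"
      by (simp add: tele sum_subtractf sum_constant_scaleR scaleR_diff_right)
    then have "real n * norm ?a \<le> norm (\<sigma> (g [^] n) u - u) + norm (\<Sum>k<n. \<sigma> (g [^] k) ?a - ?a)"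
      by (metis abs_of_nat norm_scaleR norm_triangle_ineq4)
    also have "norm (\<Sum>k<n. \<sigma> (g [^] k) ?a - ?a) \<le> (\<Sum>k<n. norm ?a / 2)"
      by (rule sum_norm_le, rule near) simp
    also have "norm (\<sigma> (g [^] n) u - u) \<le> norm u / 2" by (rule near) simp
    finally have na: "real n * norm ?a \<le> norm u" by simp
    have "r * norm ?a = norm (\<psi> g) * (x * norm ?a)" using False by (simp add: x_def)
    also have "\<dots> \<le> norm (\<psi> g) * (2 * real n * norm ?a)"
      using nx by (intro mult_left_mono mult_right_mono) auto
    also have "\<dots> \<le> norm (\<psi> g) * (2 * norm u)"
      using na by (intro mult_left_mono) (auto simp: mult.assoc)
    finally show ?thesis using r(1) by (simp add: field_simps)
  qed
  then show ?thesis using r(1) by blast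
qed

text \<open>\<open>c n\<close> and \<open>e n\<close> agree to first order in the chart, so their
  quotient \<open>k n\<close> is of smaller order than \<open>a n\<close>. The Lipschitz bound
  carries this over to \<sigma>, so both sequences give the same derivative of the representation at
  v.\<close>

lemma dsigma_add_left:
  assumes X: "X \<in> V" and Y: "Y \<in> V"
  shows "dsigma (X + Y) v = dsigma X v + dsigma Y v"
proof -
  have XY: "X + Y \<in> V" using X Y subspace_V by (rule subspace_add[rotated])
  obtain K r where K: "r > 0"
    "\<And>g u. g \<in> U \<Longrightarrow> norm (\<psi> g) \<le> r \<Longrightarrow> norm (\<sigma> g u - u) \<le> K * norm (\<psi> g) * norm u"
    using sigma_Lipschitz by blast
  define a where "a n = 1 / real (Suc n)" for n
  have a: "a \<longlonglongrightarrow> 0" "\<And>n. a n > 0" using inverse_Suc_tendsto by (simp_all add: a_def[abs_def])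
  have a': "a n \<noteq> 0" for n using a(2)[of n] by simp
  define c where "c n = Exp (a n *\<^sub>R X) \<otimes> Exp (a n *\<^sub>R Y)" for n
  define e where "e n = Exp (a n *\<^sub>R (X + Y))" for n
  define k where "k n = inv (e n) \<otimes> c n" for n
  have ek: "e n \<otimes> k n = c n" for n by (simp add: k_def mult_inv_cancel)
  have c1: "c \<longlonglongrightarrow> \<one>" and e1: "e \<longlonglongrightarrow> \<one>"
    using tendsto_mult_group[OF Exp_line_tendsto[OF X a(1)] Exp_line_tendsto[OF Y a(1)]]
      Exp_line_tendsto[OF XY a(1)] by (simp_all add: c_def[abs_def] e_def[abs_def])
  have k1: "k \<longlonglongrightarrow> \<one>" using tendsto_mult_group[OF tendsto_inv_group[OF e1] c1] by (simp add: k_def[abs_def])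
  have "(\<lambda>n. \<psi> (c n) /\<^sub>R a n - \<psi> (e n) /\<^sub>R a n) \<longlonglongrightarrow> (X + Y) - (X + Y)"
    using has_vector_derivative_sequentially[OF Exp_mult_has_derivative[OF X Y] a(1) a']
      has_vector_derivative_sequentially[OF psi_Exp_has_derivative[OF XY] a(1) a']
    by (intro tendsto_diff) (simp_all add: c_def e_def)
  then have diff0: "(\<lambda>n. (\<psi> (c n) - \<psi> (e n)) /\<^sub>R a n) \<longlonglongrightarrow> 0" by (simp add: scaleR_diff_right)
  \<comment> \<open>The bound 1 / (2 (C + 1)) makes the product error at most half of the norm of
    \<open>\<psi> (k n)\<close>; absorbing it bounds that norm by twice the difference of the
    coordinates of \<open>c n\<close> and \<open>e n\<close>.\<close>
  have small: "\<forall>\<^sub>F n in sequentially. norm (\<psi> (e n)) < min R (1 / (2 * (C + 1)))"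
    "\<forall>\<^sub>F n in sequentially. norm (\<psi> (k n)) < min R r"
    using R_pos C_nonneg K(1)
    by (intro order_tendstoD(2)[OF tendsto_norm_zero[OF tendsto_one_psi]] e1 k1; simp)+
  have kd: "\<forall>\<^sub>F n in sequentially. norm (\<psi> (k n)) \<le> 2 * norm (\<psi> (c n) - \<psi> (e n)) \<and> norm (\<psi> (k n)) \<le> r \<and> k n \<in> U"
    using small tendsto_psi(1)[OF e1 one_U] tendsto_psi(1)[OF k1 one_U]
  proof eventually_elim
    case (elim n)
    have "norm (\<psi> (c n) - \<psi> (e n) - \<psi> (k n)) \<le> C * norm (\<psi> (e n)) * norm (\<psi> (k n))"
      using mult_estimate[OF elim(3,4)] elim(1,2) by (simp add: ek)
    also have "\<dots> \<le> 1 / 2 * norm (\<psi> (k n))"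
    proof (rule mult_right_mono)
      have "C * norm (\<psi> (e n)) \<le> C * (1 / (2 * (C + 1)))"
        using elim(1) C_nonneg by (intro mult_left_mono) auto
      also have "\<dots> \<le> 1 / 2" using C_nonneg by (simp add: field_simps)
      finally show "C * norm (\<psi> (e n)) \<le> 1 / 2" .
    qed simp
    finally have "norm (\<psi> (c n) - \<psi> (e n) - \<psi> (k n)) \<le> norm (\<psi> (k n)) / 2" by simp
    then have "norm (\<psi> (k n)) \<le> 2 * norm (\<psi> (c n) - \<psi> (e n))"
      using norm_triangle_ineq2[of "\<psi> (k n)" "\<psi> (c n) - \<psi> (e n)"]
      by (simp add: norm_minus_commute)
    then show ?case using elim by simp
  qed
  have "(\<lambda>n. (\<sigma> (c n) v - \<sigma> (e n) v) /\<^sub>R a n) \<longlonglongrightarrow> 0"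
  proof (rule Lim_null_comparison)
    show "\<forall>\<^sub>F n in sequentially. norm ((\<sigma> (c n) v - \<sigma> (e n) v) /\<^sub>R a n)
        \<le> 2 * \<bar>K\<bar> * norm v * norm ((\<psi> (c n) - \<psi> (e n)) /\<^sub>R a n)"
      using kd
    proof eventually_elim
      case (elim n)
      have "\<sigma> (c n) v - \<sigma> (e n) v = \<sigma> (e n) (\<sigma> (k n) v - v)"
        by (simp add: ek[symmetric] sigma_mult sigma_diff)
      then have "norm (\<sigma> (c n) v - \<sigma> (e n) v) \<le> K * norm (\<psi> (k n)) * norm v"
        using K(2)[of "k n" v] elim by simp
      also have "\<dots> \<le> \<bar>K\<bar> * (2 * norm (\<psi> (c n) - \<psi> (e n))) * norm v"
        using elim by (intro mult_right_mono mult_mono) auto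
      finally have "inverse (a n) * norm (\<sigma> (c n) v - \<sigma> (e n) v) \<le>
          inverse (a n) * (\<bar>K\<bar> * (2 * norm (\<psi> (c n) - \<psi> (e n))) * norm v)"
        using a(2)[of n] by (intro mult_left_mono) auto
      then show ?case using a(2)[of n] by (simp add: mult_ac)
    qed
    show "(\<lambda>n. 2 * \<bar>K\<bar> * norm v * norm ((\<psi> (c n) - \<psi> (e n)) /\<^sub>R a n)) \<longlonglongrightarrow> 0"
      by (rule tendsto_mult_right_zero[OF tendsto_norm_zero[OF diff0]])
  qed
  moreover have "(\<lambda>n. (\<sigma> (e n) v - v) /\<^sub>R a n) \<longlonglongrightarrow> dsigma (X + Y) v"
    using has_vector_derivative_sequentially[OF dsigma_derivative_0[OF XY] a(1) a', of v] by (simp add: e_def)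
  ultimately have "(\<lambda>n. (\<sigma> (c n) v - \<sigma> (e n) v) /\<^sub>R a n + (\<sigma> (e n) v - v) /\<^sub>R a n) \<longlonglongrightarrow> 0 + dsigma (X + Y) v"
    by (rule tendsto_add)
  then have 1: "(\<lambda>n. (\<sigma> (c n) v - v) /\<^sub>R a n) \<longlonglongrightarrow> dsigma (X + Y) v"
    by (simp add: scaleR_diff_right)
  have "((\<lambda>s. \<sigma> (Exp (s *\<^sub>R X)) (\<sigma> (Exp (s *\<^sub>R Y)) v)) has_vector_derivative dsigma X v + dsigma Y v) (at 0)"
    using dsigma_product_rule[OF X dsigma_derivative_0[OF Y, of v]] by simp
  from has_vector_derivative_sequentially[OF this a(1) a']
  have "(\<lambda>n. (\<sigma> (c n) v - v) /\<^sub>R a n) \<longlonglongrightarrow> dsigma X v + dsigma Y v" by (simp add: c_def sigma_mult)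
  with 1 show ?thesis by (rule LIMSEQ_unique)
qed

end

lemma linear_on_span_expansion:
  fixes f :: "'a::real_inner \<Rightarrow> 'b::real_normed_vector"
  assumes E: "finite E" "\<And>a b. a \<in> E \<Longrightarrow> b \<in> E \<Longrightarrow> a \<bullet> b = (if a = b then 1 else 0)"
    and add: "\<And>x y. x \<in> span E \<Longrightarrow> y \<in> span E \<Longrightarrow> f (x + y) = f x + f y"
    and scale: "\<And>r x. x \<in> span E \<Longrightarrow> f (r *\<^sub>R x) = r *\<^sub>R f x"
    and x: "x \<in> span E"
  shows "f x = (\<Sum>e\<in>E. (x \<bullet> e) *\<^sub>R f e)"
proof -
  have "f (\<Sum>e\<in>A. c e *\<^sub>R e) = (\<Sum>e\<in>A. c e *\<^sub>R f e)" if "A \<subseteq> E" for A c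
    using finite_subset[OF that E(1)] that
  proof (induction A rule: finite_induct)
    case empty
    show ?case using scale[of 0 0] by (simp add: span_zero)
  next
    case (insert a F)
    then have "a \<in> span E" "(\<Sum>e\<in>F. c e *\<^sub>R e) \<in> span E"
      by (auto intro!: span_base span_sum span_scale)
    then show ?case using insert by (simp add: add scale span_scale)
  qed
  from this[OF order_refl, of "\<lambda>e. x \<bullet> e"] show ?thesis
    by (simp add: orthonormal_expansion[OF E x])
qed

lemma linear_on_span_has_vector_derivative:
  fixes f :: "'a::real_inner \<Rightarrow> 'b::real_normed_vector"
  assumes E: "finite E" "\<And>a b. a \<in> E \<Longrightarrow> b \<in> E \<Longrightarrow> a \<bullet> b = (if a = b then 1 else 0)"
    and add: "\<And>x y. x \<in> span E \<Longrightarrow> y \<in> span E \<Longrightarrow> f (x + y) = f x + f y"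
    and scale: "\<And>r x. x \<in> span E \<Longrightarrow> f (r *\<^sub>R x) = r *\<^sub>R f x"
    and w: "\<And>s. w s \<in> span E" "(w has_vector_derivative D) (at t)" "D \<in> span E"
  shows "((\<lambda>s. f (w s)) has_vector_derivative f D) (at t)"
proof -
  have exp: "f x = (\<Sum>e\<in>E. (x \<bullet> e) *\<^sub>R f e)" if "x \<in> span E" for x
    by (rule linear_on_span_expansion) (use assms that in auto)
  have bl: "bounded_linear (\<lambda>x. (x \<bullet> e) *\<^sub>R f e)" for e
    by (rule bounded_linear_scaleR_const[OF bounded_linear_inner_left])
  have "((\<lambda>s. \<Sum>e\<in>E. (w s \<bullet> e) *\<^sub>R f e) has_vector_derivative (\<Sum>e\<in>E. (D \<bullet> e) *\<^sub>R f e)) (at t)"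
    by (intro has_vector_derivative_sum bounded_linear.has_vector_derivative[OF bl] w)
  then show ?thesis by (simp add: w flip: exp)
qed

lemma linear_on_span_continuous:
  fixes f :: "'a::real_inner \<Rightarrow> 'b::real_normed_vector"
  assumes E: "finite E" "\<And>a b. a \<in> E \<Longrightarrow> b \<in> E \<Longrightarrow> a \<bullet> b = (if a = b then 1 else 0)"
    and add: "\<And>x y. x \<in> span E \<Longrightarrow> y \<in> span E \<Longrightarrow> f (x + y) = f x + f y"
    and scale: "\<And>r x. x \<in> span E \<Longrightarrow> f (r *\<^sub>R x) = r *\<^sub>R f x"
  shows "continuous_on (span E) f"
proof -
  have "f x = (\<Sum>e\<in>E. (x \<bullet> e) *\<^sub>R f e)" if "x \<in> span E" for x
    by (rule linear_on_span_expansion) (use assms that in auto)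
  moreover have "continuous_on (span E) (\<lambda>x. \<Sum>e\<in>E. (x \<bullet> e) *\<^sub>R f e)"
    by (intro continuous_intros)
  ultimately show ?thesis by (metis (no_types, lifting) continuous_on_cong)
qed

section \<open>The bracket, and the passage from the Lie algebra to the group\<close>

context group_chart_rep
begin

definition V_basis :: "'e set" where
  "V_basis = (SOME E. finite E \<and> span E = V \<and> (\<forall>a\<in>E. \<forall>b\<in>E. a \<bullet> b = (if a = b then 1 else 0)))"

lemma V_basis: "finite V_basis" "span V_basis = V"
  "a \<in> V_basis \<Longrightarrow> b \<in> V_basis \<Longrightarrow> a \<bullet> b = (if a = b then 1 else 0)"
proof -
  have "\<exists>E. finite E \<and> span E = V \<and> (\<forall>a\<in>E. \<forall>b\<in>E. a \<bullet> b = (if a = b then 1 else 0))"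
    using subspace_orthonormal_basis[OF subspace_V] by metis
  from someI_ex[OF this]
  show "finite V_basis" "span V_basis = V"
    "a \<in> V_basis \<Longrightarrow> b \<in> V_basis \<Longrightarrow> a \<bullet> b = (if a = b then 1 else 0)"
    unfolding V_basis_def by blast+
qed

lemma V_basis_V: "e \<in> V_basis \<Longrightarrow> e \<in> V"
  using V_basis(2) span_base by blast

lemma V_add: "X \<in> V \<Longrightarrow> Y \<in> V \<Longrightarrow> X + Y \<in> V"
  by (rule subspace_add[OF subspace_V])

lemma V_minus: "X \<in> V \<Longrightarrow> - X \<in> V"
  by (rule subspace_neg[OF subspace_V])

lemma V_zero: "0 \<in> V"
  by (rule subspace_0[OF subspace_V])

lemma linear_path_V:
  fixes f :: "'e \<Rightarrow> 'b::real_normed_vector"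
  assumes "\<And>x y. x \<in> V \<Longrightarrow> y \<in> V \<Longrightarrow> f (x + y) = f x + f y"
    and "\<And>r x. x \<in> V \<Longrightarrow> f (r *\<^sub>R x) = r *\<^sub>R f x"
    and "\<And>s. w s \<in> V" "(w has_vector_derivative D) (at t)" "D \<in> V"
  shows "((\<lambda>s. f (w s)) has_vector_derivative f D) (at t)"
  using linear_on_span_has_vector_derivative[of V_basis f w D t] assms by (simp add: V_basis)

lemma linear_path_rep:
  fixes f :: "'h \<Rightarrow> 'b::real_normed_vector"
  assumes "\<And>x y. f (x + y) = f x + f y" "\<And>r x. f (r *\<^sub>R x) = r *\<^sub>R f x"
    and "(w has_vector_derivative D) (at t)"
  shows "((\<lambda>s. f (w s)) has_vector_derivative f D) (at t)"
  using linear_on_span_has_vector_derivative[of real_basis f w D t] assms by (simp add: real_basis)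

lemma linear_continuous_rep:
  fixes f :: "'h \<Rightarrow> 'b::real_normed_vector"
  assumes "\<And>x y. f (x + y) = f x + f y" "\<And>r x. f (r *\<^sub>R x) = r *\<^sub>R f x"
  shows "continuous_on UNIV f"
  using linear_on_span_continuous[of real_basis f] assms by (simp add: real_basis)

lemma dsigma_scaleR_right: "X \<in> V \<Longrightarrow> dsigma X (r *\<^sub>R v) = r *\<^sub>R dsigma X v"
  by (simp add: scaleR_scaleC dsigma_scaleC_right)

lemma dsigma_minus_left: "X \<in> V \<Longrightarrow> dsigma (- X) v = - dsigma X v"
  using dsigma_scale_left[of X "- 1" v] by simp

lemma dsigma_minus_right: "X \<in> V \<Longrightarrow> dsigma X (- v) = - dsigma X v"
  using dsigma_scaleR_right[of X "- 1" v] by simp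

lemma dsigma_sigma: "X \<in> V \<Longrightarrow> dsigma X (\<sigma> (Exp (t *\<^sub>R X)) v) = \<sigma> (Exp (t *\<^sub>R X)) (dsigma X v)"
  using linear_flow.gen_flow[OF rep_flow, of X v t] flow_gen_eq by (simp add: real_basis)

lemma Adj_flow:
  assumes Y: "Y \<in> V"
  shows "linear_flow V_basis (\<lambda>s. Adj (Exp (s *\<^sub>R Y)))"
proof
  show "continuous_on UNIV (\<lambda>s. Adj (Exp (s *\<^sub>R Y)) w)" if "w \<in> span V_basis" for w
    using continuous_on_compose2[OF continuous_Adj[OF compact_group] continuous_on_Exp_line[OF Y]]
      that by (simp add: V_basis)
qed (simp_all add: V_basis Adj_add Adj_scale Adj_V Exp_add[OF Y] Adj_mult Adj_one)

text \<open>The Lie bracket of Y and X, as generator of the adjoint flow of Y. Linearity in X comes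
  from the flow; additivity in Y is established for commuting lines (\<open>ad_add_left\<close>),
  which covers the torus.\<close>

definition ad :: "'e \<Rightarrow> 'e \<Rightarrow> 'e" where
  "ad Y X = vector_derivative (\<lambda>s. Adj (Exp (s *\<^sub>R Y)) X) (at 0)"

context
  fixes Y assumes Y: "Y \<in> V"
begin

interpretation flow: linear_flow V_basis "\<lambda>s. Adj (Exp (s *\<^sub>R Y))"
  by (rule Adj_flow[OF Y])

lemma Adj_gen_eq: "flow.gen = ad Y"
  by (simp add: fun_eq_iff flow.gen_def ad_def)

lemma ad_V: "X \<in> V \<Longrightarrow> ad Y X \<in> V"
  using flow.gen_derivative_0(2)[of X] unfolding Adj_gen_eq by (simp add: V_basis)

lemma ad_derivative:
  "X \<in> V \<Longrightarrow> ((\<lambda>s. Adj (Exp (s *\<^sub>R Y)) X) has_vector_derivative Adj (Exp (t *\<^sub>R Y)) (ad Y X)) (at t)"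
  using flow.flow_derivative[of X t] unfolding Adj_gen_eq by (simp add: V_basis)

lemma ad_derivative_0:
  "X \<in> V \<Longrightarrow> ((\<lambda>s. Adj (Exp (s *\<^sub>R Y)) X) has_vector_derivative ad Y X) (at 0)"
  using ad_derivative[of X 0] by (simp add: Adj_one ad_V)

lemma ad_product_rule:
  assumes "\<And>s. w s \<in> V" "(w has_vector_derivative D) (at 0)" "D \<in> V"
  shows "((\<lambda>s. Adj (Exp (s *\<^sub>R Y)) (w s)) has_vector_derivative ad Y (w 0) + D) (at 0)"
  using flow.flow_product_rule[of w D 0] assms unfolding Adj_gen_eq
  by (simp add: V_basis Adj_one ad_V V_add)

lemma ad_add_right: "X \<in> V \<Longrightarrow> Z \<in> V \<Longrightarrow> ad Y (X + Z) = ad Y X + ad Y Z"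
  using flow.gen_add[of X Z] unfolding Adj_gen_eq by (simp add: V_basis)

lemma ad_scale_right: "X \<in> V \<Longrightarrow> ad Y (r *\<^sub>R X) = r *\<^sub>R ad Y X"
  using flow.gen_scale[of X r] unfolding Adj_gen_eq by (simp add: V_basis)

lemma ad_scale_left: "X \<in> V \<Longrightarrow> ad (r *\<^sub>R Y) X = r *\<^sub>R ad Y X"
proof -
  assume X: "X \<in> V"
  have sc: "((\<lambda>s. s * r) has_vector_derivative r) (at 0)"
    by (auto intro!: derivative_eq_intros)
  have "((\<lambda>s. Adj (Exp (s *\<^sub>R Y)) X) has_vector_derivative ad Y X) (at (0 * r))"
    using ad_derivative_0[OF X] by simp
  from vector_diff_chain_at[OF sc this]
  have "((\<lambda>s. Adj (Exp (s *\<^sub>R (r *\<^sub>R Y))) X) has_vector_derivative r *\<^sub>R ad Y X) (at 0)"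
    by (simp add: o_def)
  then show ?thesis unfolding ad_def by (rule vector_derivative_at)
qed

end

lemma Adj_commute_ad:
  assumes H: "H \<in> V" and X: "X \<in> V" and comm: "\<And>s. g \<otimes> Exp (s *\<^sub>R H) = Exp (s *\<^sub>R H) \<otimes> g"
  shows "Adj g (ad H X) = ad H (Adj g X)"
proof -
  have "((\<lambda>s. Adj g (Adj (Exp (s *\<^sub>R H)) X)) has_vector_derivative Adj g (ad H X)) (at 0)"
    by (rule linear_path_V[OF Adj_add Adj_scale Adj_V[OF X] ad_derivative_0[OF H X] ad_V[OF H X]])
  then have "((\<lambda>s. Adj (Exp (s *\<^sub>R H)) (Adj g X)) has_vector_derivative Adj g (ad H X)) (at 0)"
    by (simp add: Adj_mult[OF X, symmetric] comm)
  then show ?thesis unfolding ad_def by (rule vector_derivative_at[symmetric])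
qed

text \<open>Commuting lines have commuting adjoint flows; differentiating in one time after the
  other gives the claim without the Jacobi identity.\<close>

lemma ad_commute:
  assumes H: "H \<in> V" and H': "H' \<in> V" and X: "X \<in> V"
    and comm: "\<And>s t. Exp (s *\<^sub>R H) \<otimes> Exp (t *\<^sub>R H') = Exp (t *\<^sub>R H') \<otimes> Exp (s *\<^sub>R H)"
  shows "ad H' (ad H X) = ad H (ad H' X)"
proof -
  have "((\<lambda>t. ad H (Adj (Exp (t *\<^sub>R H')) X)) has_vector_derivative ad H (ad H' X)) (at 0)"
    by (rule linear_path_V[OF ad_add_right[OF H] ad_scale_right[OF H] Adj_V[OF X]
          ad_derivative_0[OF H' X] ad_V[OF H' X]])
  moreover have "ad H (Adj (Exp (t *\<^sub>R H')) X) = Adj (Exp (t *\<^sub>R H')) (ad H X)" for t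
    using Adj_commute_ad[OF H X, of "Exp (t *\<^sub>R H')"] comm by simp
  ultimately have "((\<lambda>t. Adj (Exp (t *\<^sub>R H')) (ad H X)) has_vector_derivative ad H (ad H' X)) (at 0)"
    by simp
  with ad_derivative_0[OF H' ad_V[OF H X]] show ?thesis by (rule vector_derivative_unique_at)
qed

lemma ad_add_left:
  assumes H: "H \<in> V" and H': "H' \<in> V" and X: "X \<in> V"
    and comm: "\<And>s t. Exp (s *\<^sub>R H) \<otimes> Exp (t *\<^sub>R H') = Exp (t *\<^sub>R H') \<otimes> Exp (s *\<^sub>R H)"
  shows "ad (H + H') X = ad H X + ad H' X"
proof -
  have "((\<lambda>s. Adj (Exp (s *\<^sub>R H)) (Adj (Exp (s *\<^sub>R H')) X)) has_vector_derivative ad H X + ad H' X) (at 0)"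
    using ad_product_rule[OF H Adj_V[OF X] ad_derivative_0[OF H' X] ad_V[OF H' X]]
    by (simp add: Adj_one X)
  then have "((\<lambda>s. Adj (Exp (s *\<^sub>R (H + H'))) X) has_vector_derivative ad H X + ad H' X) (at 0)"
    by (simp add: Exp_commuting_add[OF H H' comm] Adj_mult X)
  then show ?thesis unfolding ad_def by (rule vector_derivative_at)
qed

text \<open>\<open>dsigma\<close> of \<open>Adj (Exp (s *\<^sub>R Y)) X\<close> is the conjugate of
  \<open>dsigma X\<close> by the representation. The two sides are differentiated at s = 0, one by
  linearity in the Lie algebra, the other by the product rule.\<close>

lemma dsigma_ad:
  assumes Y: "Y \<in> V" and X: "X \<in> V"
  shows "dsigma (ad Y X) v = dsigma Y (dsigma X v) - dsigma X (dsigma Y v)"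
proof -
  have "((\<lambda>s. dsigma (Adj (Exp (s *\<^sub>R Y)) X) v) has_vector_derivative dsigma (ad Y X) v) (at 0)"
    by (rule linear_path_V[OF dsigma_add_left dsigma_scale_left Adj_V[OF X]
          ad_derivative_0[OF Y X] ad_V[OF Y X]])
  moreover have "((\<lambda>s. \<sigma> (Exp (s *\<^sub>R Y)) (dsigma X (\<sigma> (Exp (s *\<^sub>R (- Y))) v)))
      has_vector_derivative dsigma Y (dsigma X v) + dsigma X (dsigma (- Y) v)) (at 0)"
    using dsigma_product_rule[OF Y linear_path_rep[OF dsigma_add_right[OF X] dsigma_scaleR_right[OF X]
          dsigma_derivative_0[OF V_minus[OF Y], of v]]] by simp
  moreover have "\<sigma> (Exp (s *\<^sub>R Y)) (dsigma X (\<sigma> (Exp (s *\<^sub>R (- Y))) v)) = dsigma (Adj (Exp (s *\<^sub>R Y)) X) v" for s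
    using Exp_minus[OF scale_V[OF Y], of s] by (simp add: dsigma_Adj[OF X])
  ultimately have "dsigma (ad Y X) v = dsigma Y (dsigma X v) + dsigma X (dsigma (- Y) v)"
    using vector_derivative_unique_at by fastforce
  then show ?thesis by (simp add: dsigma_minus_left Y X dsigma_minus_right)
qed

text \<open>On a line, conjugating A by the representation gives a function of time with zero
  derivative. Hence the elements commuting with A form a closed subgroup that contains every line,
  and \<open>closed_subgroup_eq\<close> applies with the whole connected group as T.\<close>

lemma commute_dsigma_imp_commute:
  assumes A: "\<And>x y. A (x + y) = A x + A y" "\<And>r x. A (r *\<^sub>R x) = r *\<^sub>R A x"
    and comm: "\<And>X v. X \<in> V \<Longrightarrow> A (dsigma X v) = dsigma X (A v)"
  shows "A (\<sigma> g v) = \<sigma> g (A v)"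
proof -
  define H where "H = {g. \<forall>v. A (\<sigma> g v) = \<sigma> g (A v)}"
  have "H = UNIV"
  proof (rule closed_subgroup_eq)
    show "subgroup H G"
    proof
      show "inv x \<in> H" if "x \<in> H" for x
      proof -
        have "A (\<sigma> (inv x) v) = \<sigma> (inv x) (A v)" for v
        proof -
          have "\<sigma> x (A (\<sigma> (inv x) v)) = A (\<sigma> x (\<sigma> (inv x) v))"
            using that by (simp add: H_def del: sigma_inv)
          then have "\<sigma> (inv x) (\<sigma> x (A (\<sigma> (inv x) v))) = \<sigma> (inv x) (A v)" by simp
          then show ?thesis by simp
        qed
        then show ?thesis by (simp add: H_def)
      qed
    qed (auto simp: H_def sigma_mult)
    show "subgroup (UNIV :: 'g set) G" by (metis carrier_UNIV subgroup_self)
    have "closed {g. A (\<sigma> g v) = \<sigma> g (A v)}" for v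
      using continuous_on_compose2[OF linear_continuous_rep[of A, OF A] sigma_cont[of v]] sigma_cont[of "A v"]
      by (intro closed_Collect_eq) auto
    moreover have "H = (\<Inter>v. {g. A (\<sigma> g v) = \<sigma> g (A v)})" by (auto simp: H_def)
    ultimately show "closed H" by auto
    show "Exp (s *\<^sub>R X) \<in> H" if X: "X \<in> V" for X s
    proof -
      have "A (\<sigma> (Exp (s *\<^sub>R X)) v) = \<sigma> (Exp (s *\<^sub>R X)) (A v)" for v
      proof -
        let ?f = "\<lambda>s. \<sigma> (Exp (s *\<^sub>R (- X))) (A (\<sigma> (Exp (s *\<^sub>R X)) v))"
        have "(?f has_vector_derivative 0) (at t)" for t
        proof -
          have "((\<lambda>s. A (\<sigma> (Exp (s *\<^sub>R X)) v)) has_vector_derivative A (\<sigma> (Exp (t *\<^sub>R X)) (dsigma X v))) (at t)"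
            by (rule linear_path_rep[of A, OF A dsigma_derivative[OF X]])
          from dsigma_product_rule[OF V_minus[OF X] this]
          show ?thesis by (simp add: dsigma_minus_left X comm flip: dsigma_sigma)
        qed
        from zero_vector_derivative_const[OF this, of s]
        have "\<sigma> (inv (Exp (s *\<^sub>R X))) (A (\<sigma> (Exp (s *\<^sub>R X)) v)) = A v"
          using Exp_minus[OF scale_V[OF X], of s] by simp
        then show ?thesis by (metis sigma_inv(2))
      qed
      then show ?thesis by (simp add: H_def)
    qed
  qed (auto simp: connected_group)
  then show ?thesis by (auto simp: H_def)
qed

text \<open>Skewness of \<open>dsigma\<close> makes the orthogonal complement of S invariant too, so
  the projection p onto S commutes with the Lie algebra and therefore with G. Then S is invariant
  under G, and irreducibility applies.\<close>

lemma invariant_subspace_eq_UNIV: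
  assumes irr: "irreducible_unitary_rep G UNIV \<sigma>"
    and S: "csubspace S" "v \<in> S" "v \<noteq> 0"
    and inv: "\<And>X u. X \<in> V \<Longrightarrow> u \<in> S \<Longrightarrow> dsigma X u \<in> S"
  shows "S = UNIV"
proof -
  obtain B where B: "finite B" "cspan B = (UNIV :: 'h set)" using finite_dim by blast
  obtain E where E: "corthonormal E" "cspan E = S"
    using finite_dim_csubspace_corthonormal[OF S(1) B(1)] B(2) by auto
  define p where "p v = (\<Sum>e\<in>E. cinner v e *\<^sub>C e)" for v
  have pS: "p v \<in> S" for v unfolding p_def E(2)[symmetric]
    by (intro complex_vector.span_sum complex_vector.span_scale complex_vector.span_base)
  have p_id: "p u = u" if "u \<in> S" for u using corthonormal_expansion[OF E(1)] that E(2) by (simp add: p_def)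
  have p_add: "p (x + y) = p x + p y" for x y
    by (simp add: p_def cinner_add_left scaleC_add_left sum.distrib)
  have p_scale: "p (r *\<^sub>R x) = r *\<^sub>R p x" for r x
    by (simp add: p_def cinner_scaleC_left scaleR_scaleC scaleC_scaleC complex_vector.scale_sum_right)
  have p_perp: "p u = 0" if "\<And>s. s \<in> S \<Longrightarrow> cinner u s = 0" for u
    using that E(2) complex_vector.span_base[of _ E] by (simp add: p_def)
  have perp: "cinner (u - p u) s = 0" if "s \<in> S" for u s
  proof -
    have "cinner (p u) e = cinner u e" if e: "e \<in> E" for e
    proof -
      have "cinner (p u) e = (\<Sum>a\<in>E. if a = e then cinner u e else 0)"
        unfolding p_def cinner_sum_left using E(1) e
        by (intro sum.cong) (auto simp: cinner_scaleC_left corthonormal_def)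
      then show ?thesis using E(1) e by (simp add: corthonormal_def)
    qed
    then have "cinner (u - p u) (\<Sum>e\<in>E. cinner s e *\<^sub>C e) = 0"
      by (simp add: cinner_sum_right cinner_scaleC_right cinner_diff_left)
    then show ?thesis using p_id[OF that] by (simp add: p_def)
  qed
  have "p (dsigma X u) = dsigma X (p u)" if X: "X \<in> V" for X u
  proof -
    have "p (dsigma X (u - p u)) = 0"
      by (rule p_perp) (simp add: dsigma_skew[OF X] perp inv X)
    moreover have "dsigma X u = dsigma X (u - p u) + dsigma X (p u)"
      by (simp add: dsigma_add_right[OF X, symmetric])
    ultimately show ?thesis using p_id[OF inv[OF X pS]] by (simp add: p_add)
  qed
  then have comm: "p (\<sigma> g u) = \<sigma> g (p u)" for g u
    by (intro commute_dsigma_imp_commute p_add p_scale)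
  have "\<sigma> g u \<in> S" if "u \<in> S" for g u using comm[of g u] pS[of "\<sigma> g u"] p_id[OF that] by simp
  then have "S = {0} \<or> S = UNIV"
    using irr S(1) unfolding irreducible_unitary_rep_def by blast
  then show ?thesis using S by auto
qed

end

section \<open>Maximal tori, roots and the stabilizer of the highest weight line\<close>

text \<open>The equations \<open>model_eq\<close>, \<open>lie_exp_eq\<close> and
  \<open>Ad_eq\<close> are assumptions because \<psi> is not tied to \<open>base_chart\<close> here;
  for a translate of that chart the last two follow from \<open>lie_exp_Ad_eq\<close>.\<close>

locale weight_setting = group_chart_rep G V U \<psi> R C \<sigma>
  for G :: "('g::{t2_space, second_countable_topology}, 'e::euclidean_space) lie_group_data" (structure)
    and V :: "'e set" and U :: "'g set" and \<psi> :: "'g \<Rightarrow> 'e" and R C :: real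
    and \<sigma> :: "'g \<Rightarrow> 'h::complex_inner \<Rightarrow> 'h" +
  fixes M :: "'g measure" and T :: "'g set" and P :: "('e \<Rightarrow> real) set" and \<Lambda> :: "'e \<Rightarrow> real"
    and v0 :: 'h
  assumes irreducible: "irreducible_unitary_rep G UNIV \<sigma>"
    and model_eq: "model G = V"
    and lie_exp_eq: "X \<in> V \<Longrightarrow> lie_exp G X = Exp X"
    and Ad_eq: "X \<in> V \<Longrightarrow> Ad G g X = Adj g X"
    and max_torus: "maximal_torus G T"
    and positive_roots: "positive_root_system G T P"
    and highest_weight: "highest_weight_vector G T P \<sigma> \<Lambda> v0"
    and weight_functional: "\<Lambda> \<in> real_functionals G T"
    and haar: "normalized_haar G M"
begin

section \<open>The Lie algebra of the maximal torus\<close>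

abbreviation tt :: "'e set" where "tt \<equiv> torus_algebra G T"

lemma T_facts: "subgroup T G" "closed T" "connected T"
  "x \<in> T \<Longrightarrow> y \<in> T \<Longrightarrow> x \<otimes> y = y \<otimes> x"
  using max_torus by (auto simp: maximal_torus_def torus_def)

lemma tt_iff: "H \<in> tt \<longleftrightarrow> H \<in> V \<and> (\<forall>s. Exp (s *\<^sub>R H) \<in> T)"
  by (auto simp: torus_algebra_def model_eq lie_exp_eq scale_V)

lemma tt_V: "H \<in> tt \<Longrightarrow> H \<in> V"
  by (simp add: tt_iff)

lemma tt_commute:
  "H \<in> tt \<Longrightarrow> H' \<in> tt \<Longrightarrow> Exp (s *\<^sub>R H) \<otimes> Exp (t *\<^sub>R H') = Exp (t *\<^sub>R H') \<otimes> Exp (s *\<^sub>R H)"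
  using T_facts(4) by (simp add: tt_iff)

lemma tt_add: "H \<in> tt \<Longrightarrow> H' \<in> tt \<Longrightarrow> H + H' \<in> tt"
  using Exp_commuting_add[OF tt_V tt_V tt_commute, of H H'] subgroup.m_closed[OF T_facts(1)]
  by (simp add: tt_iff V_add)

lemma tt_scale: "H \<in> tt \<Longrightarrow> r *\<^sub>R H \<in> tt"
  by (simp add: tt_iff scale_V)

text \<open>The products of T with the line of X form a connected abelian subgroup; its closure is a
  torus containing T, so it equals T by maximality.\<close>

lemma centralizer_subset_torus:
  assumes X: "X \<in> V" and comm: "\<And>t s. t \<in> T \<Longrightarrow> t \<otimes> Exp (s *\<^sub>R X) = Exp (s *\<^sub>R X) \<otimes> t"
  shows "X \<in> tt"
proof -
  define Q where "Q = (\<lambda>(t, s). t \<otimes> Exp (s *\<^sub>R X)) ` (T \<times> UNIV)"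
  have prod: "(t \<otimes> Exp (s *\<^sub>R X)) \<otimes> (t' \<otimes> Exp (s' *\<^sub>R X)) = (t \<otimes> t') \<otimes> Exp ((s + s') *\<^sub>R X)"
    if "t \<in> T" "t' \<in> T" for t t' s s'
  proof -
    have "(t \<otimes> Exp (s *\<^sub>R X)) \<otimes> (t' \<otimes> Exp (s' *\<^sub>R X)) = t \<otimes> (Exp (s *\<^sub>R X) \<otimes> t') \<otimes> Exp (s' *\<^sub>R X)"
      by (simp add: m_assoc)
    also have "\<dots> = t \<otimes> (t' \<otimes> Exp (s *\<^sub>R X)) \<otimes> Exp (s' *\<^sub>R X)" using comm[OF that(2)] by simp
    finally show ?thesis by (simp add: m_assoc Exp_add[OF X])
  qed
  have oneT: "\<one> \<in> T" by (rule subgroup.one_closed[OF T_facts(1)])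
  have Q_mult: "x \<otimes> y \<in> Q" if "x \<in> Q" "y \<in> Q" for x y
    using that prod subgroup.m_closed[OF T_facts(1)] by (fastforce simp: Q_def image_iff)
  have Q_comm: "x \<otimes> y = y \<otimes> x" if "x \<in> Q" "y \<in> Q" for x y
    using that prod T_facts(4) by (auto simp: Q_def add.commute)
  have Q_inv: "inv x \<in> Q" if x: "x \<in> Q" for x
  proof -
    obtain t s where ts: "t \<in> T" "x = t \<otimes> Exp (s *\<^sub>R X)" using x by (auto simp: Q_def)
    have "inv t \<in> T" using subgroup.m_inv_closed[OF T_facts(1) ts(1)] .
    moreover have "inv x = inv t \<otimes> Exp ((- s) *\<^sub>R X)"
      using comm[OF calculation, of "- s"] Exp_minus[OF scale_V[OF X], of s]
      by (simp add: ts inv_mult_group)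
    ultimately show ?thesis unfolding Q_def by (intro image_eqI[where x = "(inv t, - s)"]) auto
  qed
  have seq: "\<exists>f. (\<forall>n. f n \<in> Q) \<and> f \<longlonglongrightarrow> x" if "x \<in> closure Q" for x
    using that by (auto simp: closure_sequential)
  have "torus G (closure Q)"
    unfolding torus_def
  proof (intro conjI ballI)
    show "subgroup (closure Q) G"
    proof
      show "x \<otimes> y \<in> closure Q" if xy: "x \<in> closure Q" "y \<in> closure Q" for x y
      proof -
        obtain f g where "\<forall>n. f n \<in> Q" "f \<longlonglongrightarrow> x" "\<forall>n. g n \<in> Q" "g \<longlonglongrightarrow> y" using seq xy by meson
        then show ?thesis unfolding closure_sequential
          by (intro exI[of _ "\<lambda>n. f n \<otimes> g n"]) (auto intro: Q_mult tendsto_mult_group)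
      qed
      have "\<one> \<in> Q" unfolding Q_def using oneT by (intro image_eqI[where x = "(\<one>, 0)"]) auto
      then show "\<one> \<in> closure Q" using closure_subset by blast
      show "inv x \<in> closure Q" if x: "x \<in> closure Q" for x
      proof -
        obtain f where "\<forall>n. f n \<in> Q" "f \<longlonglongrightarrow> x" using seq x by meson
        then show ?thesis unfolding closure_sequential
          by (intro exI[of _ "\<lambda>n. inv (f n)"]) (auto intro: Q_inv tendsto_inv_group)
      qed
    qed simp
    have "((\<lambda>z. fst z \<otimes> Exp (snd z *\<^sub>R X)) \<longlongrightarrow> fst z \<otimes> Exp (snd z *\<^sub>R X)) (at z within S)" for z S
      by (intro tendsto_mult_group Exp_line_tendsto X tendsto_fst tendsto_snd tendsto_ident_at)
    then have "continuous_on (T \<times> UNIV) (\<lambda>(t, s). t \<otimes> Exp (s *\<^sub>R X))"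
      by (simp add: continuous_on_def case_prod_beta)
    then have "connected Q" unfolding Q_def
      by (intro connected_continuous_image connected_Times T_facts(3)) auto
    then show "connected (closure Q)" by (rule connected_imp_connected_closure)
    fix x y assume "x \<in> closure Q" "y \<in> closure Q"
    then obtain f g where fg: "\<forall>n. f n \<in> Q" "f \<longlonglongrightarrow> x" "\<forall>n. g n \<in> Q" "g \<longlonglongrightarrow> y" using seq by meson
    have "(\<lambda>n. f n \<otimes> g n) \<longlonglongrightarrow> x \<otimes> y" "(\<lambda>n. g n \<otimes> f n) \<longlonglongrightarrow> y \<otimes> x"
      using fg by (auto intro: tendsto_mult_group)
    moreover have "(\<lambda>n. f n \<otimes> g n) = (\<lambda>n. g n \<otimes> f n)" using fg Q_comm by auto
    ultimately show "x \<otimes> y = y \<otimes> x" using LIMSEQ_unique by metis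
  qed simp
  moreover have "T \<subseteq> closure Q"
  proof
    fix t assume "t \<in> T"
    then have "t \<in> Q" unfolding Q_def by (intro image_eqI[where x = "(t, 0)"]) auto
    then show "t \<in> closure Q" using closure_subset by blast
  qed
  ultimately have "closure Q = T" using max_torus by (auto simp: maximal_torus_def)
  moreover have "Exp (s *\<^sub>R X) \<in> Q" for s
    unfolding Q_def using oneT by (intro image_eqI[where x = "(\<one>, s)"]) auto
  ultimately show ?thesis using X closure_subset by (auto simp: tt_iff)
qed

text \<open>Being fixed by the lines of T only says that these lines centralize the line of X. The
  elements of T that do so form a closed subgroup containing all lines of T, hence all of T, and the
  centralizer lemma applies.\<close>

lemma fixed_by_torus_imp_tt:
  assumes X: "X \<in> V" and fixed: "\<And>H s. H \<in> tt \<Longrightarrow> Adj (Exp (s *\<^sub>R H)) X = X"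
  shows "X \<in> tt"
proof (rule centralizer_subset_torus[OF X])
  define Z where "Z = T \<inter> (\<Inter>s. {t. t \<otimes> Exp (s *\<^sub>R X) = Exp (s *\<^sub>R X) \<otimes> t})"
  have "Z = T"
  proof (rule closed_subgroup_eq)
    show "subgroup Z G"
    proof
      show "x \<otimes> y \<in> Z" if "x \<in> Z" "y \<in> Z" for x y
      proof -
        have "x \<otimes> y \<otimes> Exp (s *\<^sub>R X) = Exp (s *\<^sub>R X) \<otimes> (x \<otimes> y)" for s
        proof -
          have c: "x \<otimes> Exp (s *\<^sub>R X) = Exp (s *\<^sub>R X) \<otimes> x" "y \<otimes> Exp (s *\<^sub>R X) = Exp (s *\<^sub>R X) \<otimes> y"
            using that by (auto simp: Z_def)
          have "x \<otimes> y \<otimes> Exp (s *\<^sub>R X) = x \<otimes> Exp (s *\<^sub>R X) \<otimes> y" by (simp add: m_assoc c(2))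
          also have "\<dots> = Exp (s *\<^sub>R X) \<otimes> (x \<otimes> y)" unfolding c(1) by (simp add: m_assoc)
          finally show ?thesis .
        qed
        then show ?thesis using that subgroup.m_closed[OF T_facts(1)] by (auto simp: Z_def)
      qed
      show "\<one> \<in> Z" using subgroup.one_closed[OF T_facts(1)] by (simp add: Z_def)
      show "inv x \<in> Z" if "x \<in> Z" for x
      proof -
        have "inv x \<otimes> Exp (s *\<^sub>R X) = Exp (s *\<^sub>R X) \<otimes> inv x" for s
        proof -
          have "x \<otimes> Exp (s *\<^sub>R X) = Exp (s *\<^sub>R X) \<otimes> x" using that by (simp add: Z_def)
          then have "inv x \<otimes> (x \<otimes> Exp (s *\<^sub>R X)) \<otimes> inv x = inv x \<otimes> (Exp (s *\<^sub>R X) \<otimes> x) \<otimes> inv x" by simp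
          then show ?thesis by (simp add: m_assoc mult_inv_cancel)
        qed
        then show ?thesis using that subgroup.m_inv_closed[OF T_facts(1)] by (auto simp: Z_def)
      qed
    qed simp
    have "closed {t. t \<otimes> Exp (s *\<^sub>R X) = Exp (s *\<^sub>R X) \<otimes> t}" for s
      by (intro closed_Collect_eq)
        (auto simp: continuous_on_def intro!: tendsto_mult_group tendsto_ident_at)
    then show "closed Z" using T_facts(2) by (auto simp: Z_def)
    show "Exp (s *\<^sub>R H) \<in> Z" if H: "H \<in> V" "\<And>s. Exp (s *\<^sub>R H) \<in> T" for H s
    proof -
      have "H \<in> tt" using H by (simp add: tt_iff)
      then have "Exp (s *\<^sub>R H) \<otimes> Exp (t *\<^sub>R X) \<otimes> inv (Exp (s *\<^sub>R H)) = Exp (t *\<^sub>R X)" for t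
        using Exp_Adj[OF X, of t "Exp (s *\<^sub>R H)"] fixed by simp
      then have "Exp (s *\<^sub>R H) \<otimes> Exp (t *\<^sub>R X) = Exp (t *\<^sub>R X) \<otimes> Exp (s *\<^sub>R H)" for t
        by (metis UNIV_I carrier_UNIV inv_solve_right' inv_closed m_closed)
      then show ?thesis using H by (simp add: Z_def)
    qed
  qed (use T_facts in \<open>auto simp: Z_def\<close>)
  then show "t \<otimes> Exp (s *\<^sub>R X) = Exp (s *\<^sub>R X) \<otimes> t" if "t \<in> T" for t s
    using that by (auto simp: Z_def)
qed

text \<open>The Euclidean inner product averaged over the group. With \<open>inv g\<close> in the
  integrand, acting by \<open>Adj h\<close> on both arguments becomes a left translation of g, under
  which M is invariant.\<close>

definition inv_form :: "'e \<Rightarrow> 'e \<Rightarrow> real" where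
  "inv_form X Y = (\<integral>g. Adj (inv g) X \<bullet> Adj (inv g) Y \<partial>M)"

lemma haar_facts: "prob_space M" "sets M = sets borel" "distr M M (\<lambda>x. g \<otimes> x) = M" "space M = UNIV"
  using haar sets_eq_imp_space_eq[of M borel] by (auto simp: normalized_haar_def)

lemma continuous_integrable:
  fixes f :: "'g \<Rightarrow> 'b::{banach, second_countable_topology}"
  assumes "continuous_on UNIV f"
  shows "integrable M f"
proof -
  interpret prob_space M by (rule haar_facts)
  have "f \<in> borel_measurable M"
    using borel_measurable_continuous_onI[OF assms] haar_facts(2) measurable_cong_sets by blast
  moreover have "bounded (range f)"
    using compact_continuous_image[OF assms compact_group] compact_imp_bounded by blast
  then obtain K where "\<And>x. norm (f x) \<le> K" by (auto simp: bounded_iff)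
  ultimately show ?thesis by (intro integrable_const_bound[of _ K]) auto
qed

lemma continuous_Adj_inv: "X \<in> V \<Longrightarrow> continuous_on UNIV (\<lambda>g. Adj (inv g) X)"
  using continuous_on_compose2[OF continuous_Adj[OF compact_group] continuous_inv] by simp

lemma inv_form_integrable: "X \<in> V \<Longrightarrow> Y \<in> V \<Longrightarrow> integrable M (\<lambda>g. Adj (inv g) X \<bullet> Adj (inv g) Y)"
  by (intro continuous_integrable continuous_on_inner continuous_Adj_inv)

lemma inv_form_commute: "inv_form X Y = inv_form Y X"
  by (simp add: inv_form_def inner_commute)

lemma inv_form_add_left: "X \<in> V \<Longrightarrow> Y \<in> V \<Longrightarrow> Z \<in> V \<Longrightarrow> inv_form (X + Y) Z = inv_form X Z + inv_form Y Z"
  by (simp add: inv_form_def Adj_add inner_add_left inv_form_integrable)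

lemma inv_form_scale_left: "X \<in> V \<Longrightarrow> inv_form (r *\<^sub>R X) Z = r * inv_form X Z"
  by (simp add: inv_form_def Adj_scale)

lemma inv_form_add_right: "X \<in> V \<Longrightarrow> Y \<in> V \<Longrightarrow> Z \<in> V \<Longrightarrow> inv_form Z (X + Y) = inv_form Z X + inv_form Z Y"
  using inv_form_add_left by (simp add: inv_form_commute)

lemma inv_form_scale_right: "X \<in> V \<Longrightarrow> inv_form Z (r *\<^sub>R X) = r * inv_form Z X"
  using inv_form_scale_left by (simp add: inv_form_commute)

lemma Adj_inj: "X \<in> V \<Longrightarrow> Adj g X = 0 \<Longrightarrow> X = 0"
proof -
  assume X: "X \<in> V" "Adj g X = 0"
  have "X = Adj (inv g) (Adj g X)" using Adj_mult[OF X(1), of "inv g" g] Adj_one[OF X(1)] by simp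
  also have "\<dots> = 0" using X(2) Adj_scale[OF V_zero, of "inv g" 0] by simp
  finally show "X = 0" .
qed

text \<open>The integrand is continuous and nowhere zero on a compact group, hence bounded below by
  a positive constant, and M has total mass 1.\<close>

lemma inv_form_pos:
  assumes X: "X \<in> V" "X \<noteq> 0"
  shows "inv_form X X > 0"
proof -
  interpret prob_space M by (rule haar_facts)
  have "continuous_on UNIV (\<lambda>g. Adj (inv g) X \<bullet> Adj (inv g) X)"
    by (intro continuous_on_inner continuous_Adj_inv X)
  then obtain g where g: "\<And>h. Adj (inv g) X \<bullet> Adj (inv g) X \<le> Adj (inv h) X \<bullet> Adj (inv h) X"
    using continuous_attains_inf[OF compact_group] by blast
  have "Adj (inv g) X \<noteq> 0" using Adj_inj X by blast
  then have "0 < Adj (inv g) X \<bullet> Adj (inv g) X" by simp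
  also have "\<dots> = (\<integral>h. Adj (inv g) X \<bullet> Adj (inv g) X \<partial>M)" by (simp add: prob_space)
  also have "\<dots> \<le> inv_form X X"
    unfolding inv_form_def by (intro integral_mono inv_form_integrable X g) simp
  finally show ?thesis .
qed

lemma inv_form_Adj:
  assumes X: "X \<in> V" and Y: "Y \<in> V"
  shows "inv_form (Adj h X) (Adj h Y) = inv_form X Y"
proof -
  let ?f = "\<lambda>g. Adj (inv g) X \<bullet> Adj (inv g) Y"
  have cont: "continuous_on UNIV (\<lambda>x. inv h \<otimes> x)"
    unfolding continuous_on_def by (auto intro!: tendsto_mult_group tendsto_ident_at)
  have meas: "(\<lambda>x. inv h \<otimes> x) \<in> measurable M M"
    using borel_measurable_continuous_onI[OF cont] haar_facts(2) measurable_cong_sets by blast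
  have "inv_form (Adj h X) (Adj h Y) = (\<integral>g. ?f (inv h \<otimes> g) \<partial>M)"
    by (simp add: inv_form_def Adj_mult X Y inv_mult_group)
  also have "\<dots> = (\<integral>g. ?f g \<partial>distr M M (\<lambda>x. inv h \<otimes> x))"
    by (rule integral_distr[symmetric, OF meas]) (rule borel_measurable_integrable[OF inv_form_integrable[OF X Y]])
  also have "\<dots> = inv_form X Y" by (simp add: haar_facts(3) inv_form_def)
  finally show ?thesis .
qed

lemma inv_form_skew:
  assumes H: "H \<in> V" and X: "X \<in> V" and Y: "Y \<in> V"
  shows "inv_form (ad H X) Y = - inv_form X (ad H Y)"
proof -
  have "((\<lambda>s. inv_form (Adj (Exp (s *\<^sub>R H)) X) Y) has_vector_derivative inv_form (ad H X) Y) (at 0)"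
    by (rule linear_path_V[of "\<lambda>X. inv_form X Y", OF _ _ Adj_V[OF X] ad_derivative_0[OF H X] ad_V[OF H X]])
      (simp_all add: inv_form_add_left inv_form_scale_left Y)
  moreover have "inv_form (Adj (Exp (s *\<^sub>R H)) X) Y = inv_form X (Adj (Exp (s *\<^sub>R (- H))) Y)" for s
    using inv_form_Adj[OF X Adj_V[OF Y], of "Exp (s *\<^sub>R H)" "inv (Exp (s *\<^sub>R H))"] Exp_minus[OF scale_V[OF H], of s]
    by (simp add: Adj_mult[OF Y, symmetric] Adj_one Y)
  ultimately have 1: "((\<lambda>s. inv_form X (Adj (Exp (s *\<^sub>R (- H))) Y)) has_vector_derivative inv_form (ad H X) Y) (at 0)"
    by simp
  have "((\<lambda>s. inv_form X (Adj (Exp (s *\<^sub>R (- H))) Y)) has_vector_derivative inv_form X (ad (- H) Y)) (at 0)"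
    by (rule linear_path_V[of "\<lambda>Y. inv_form X Y", OF _ _ Adj_V[OF Y] ad_derivative_0[OF V_minus[OF H] Y]
          ad_V[OF V_minus[OF H] Y]])
      (simp_all add: inv_form_add_right inv_form_scale_right X)
  from vector_derivative_unique_at[OF 1 this]
  have "inv_form (ad H X) Y = inv_form X (ad (- 1 *\<^sub>R H) Y)" by simp
  also have "\<dots> = - inv_form X (ad H Y)"
    using ad_scale_left[OF H Y, of "- 1"] inv_form_scale_right[OF ad_V[OF H Y], of X "- 1"] by simp
  finally show ?thesis .
qed

text \<open>The form is represented by a map L that is injective on V by positivity, hence onto V;
  the preimage under L of a Euclidean normal vector of S in V is orthogonal to S for the
  form.\<close>

lemma inv_form_complement:
  assumes S: "subspace S" "S \<subseteq> V" "S \<noteq> V"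
  shows "\<exists>X\<in>V. X \<noteq> 0 \<and> (\<forall>Y\<in>S. inv_form X Y = 0)"
proof -
  define L where "L X = (\<Sum>e\<in>V_basis. \<Sum>e'\<in>V_basis. ((X \<bullet> e) * inv_form e e') *\<^sub>R e')" for X
  have lin: "linear L"
    by (rule linearI)
      (simp_all add: L_def inner_add_left distrib_right scaleR_add_left sum.distrib scaleR_sum_right mult.assoc)
  have LV: "L X \<in> V" for X
    unfolding L_def using V_basis(2) by (metis (no_types, lifting) span_base span_scale span_sum)
  have coord: "(\<Sum>e\<in>V_basis. (X \<bullet> e) * inv_form e Y) = inv_form X Y" if "X \<in> V" "Y \<in> V" for X Y
    using linear_on_span_expansion[of V_basis "\<lambda>X. inv_form X Y" X] that
    by (simp add: V_basis inv_form_add_left inv_form_scale_left)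
  have LB: "L X \<bullet> Y = inv_form X Y" if X: "X \<in> V" and Y: "Y \<in> V" for X Y
  proof -
    have "L X \<bullet> Y = (\<Sum>e\<in>V_basis. \<Sum>e'\<in>V_basis. (X \<bullet> e) * ((Y \<bullet> e') * inv_form e' e))"
      unfolding L_def inner_sum_left by (intro sum.cong) (simp_all add: inner_commute inv_form_commute)
    also have "\<dots> = (\<Sum>e\<in>V_basis. (X \<bullet> e) * inv_form Y e)"
      by (intro sum.cong refl) (simp add: coord[OF Y V_basis_V] flip: sum_distrib_left)
    also have "\<dots> = inv_form X Y" using coord[OF X Y] by (simp add: inv_form_commute)
    finally show ?thesis .
  qed
  have "inj_on L V"
  proof (rule inj_onI)
    fix X Y assume XY: "X \<in> V" "Y \<in> V" "L X = L Y"
    have D: "X - Y \<in> V" using XY subspace_V by (simp add: subspace_diff)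
    have "L (X - Y) = 0" using XY lin by (simp add: linear_diff)
    then have "inv_form (X - Y) (X - Y) = 0" using LB[OF D D] by simp
    then show "X = Y" using inv_form_pos[OF D] by force
  qed
  then have "dim (L ` V) = dim V"
    using subspace_V by (intro dim_image_eq[OF lin]) (simp add: span_eq_iff[THEN iffD2])
  then have LV_eq: "L ` V = V"
    using LV by (intro subspace_dim_equal linear_subspace_image lin subspace_V) auto
  have "span S \<subset> span V" using S subspace_V by (simp add: span_eq_iff[THEN iffD2] psubset_eq)
  then have "\<exists>Z. Z \<noteq> 0 \<and> Z \<in> span V \<and> (\<forall>y\<in>span S. orthogonal Z y)"
    by (rule orthogonal_to_subspace_exists_gen) blast
  then obtain Z where Z: "Z \<noteq> 0" "Z \<in> span V" "\<forall>y\<in>span S. orthogonal Z y" by blast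
  then obtain X where X: "X \<in> V" "L X = Z" using LV_eq subspace_V by (metis imageE span_eq_iff)
  have "inv_form X Y = 0" if "Y \<in> S" for Y
    using LB[OF X(1), of Y] Z(3)[rule_format, OF span_base[OF that]] S(2) that X(2) by (auto simp: orthogonal_def)
  moreover have "X \<noteq> 0" using X Z(1) linear_0[OF lin] by auto
  ultimately show ?thesis using X by blast
qed

text \<open>
  A maximizer of the Rayleigh quotient is an eigenvector, and by minimality the eigenspace is the
  whole invariant subspace.
\<close>

lemma symmetric_commuting_scalar:
  assumes W: "subspace W" "W \<subseteq> V" "W \<noteq> {0}"
    and minimal: "\<And>W'. subspace W' \<Longrightarrow> W' \<subseteq> W \<Longrightarrow> W' \<noteq> {0} \<Longrightarrow>
        (\<And>H X. H \<in> tt \<Longrightarrow> X \<in> W' \<Longrightarrow> ad H X \<in> W') \<Longrightarrow> W' = W"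
    and inv: "\<And>H X. H \<in> tt \<Longrightarrow> X \<in> W \<Longrightarrow> ad H X \<in> W"
    and S: "\<And>X. X \<in> W \<Longrightarrow> S X \<in> W"
    and S_add: "\<And>X Y. X \<in> V \<Longrightarrow> Y \<in> V \<Longrightarrow> S (X + Y) = S X + S Y"
    and S_scale: "\<And>r X. X \<in> V \<Longrightarrow> S (r *\<^sub>R X) = r *\<^sub>R S X"
    and S_V: "\<And>X. X \<in> V \<Longrightarrow> S X \<in> V"
    and S_sym: "\<And>X Y. X \<in> W \<Longrightarrow> Y \<in> W \<Longrightarrow> inv_form (S X) Y = inv_form X (S Y)"
    and S_comm: "\<And>H X. H \<in> tt \<Longrightarrow> X \<in> W \<Longrightarrow> S (ad H X) = ad H (S X)"
  shows "\<exists>\<mu>. \<forall>X\<in>W. S X = \<mu> *\<^sub>R X"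
proof -
  define f where "f X = inv_form (S X) X / inv_form X X" for X
  let ?K = "sphere 0 1 \<inter> W"
  have WV: "X \<in> V" if "X \<in> W" for X using W(2) that by blast
  have expB: "inv_form X Y = (\<Sum>e\<in>V_basis. (X \<bullet> e) * (\<Sum>e'\<in>V_basis. (Y \<bullet> e') * inv_form e e'))"
    if "X \<in> V" "Y \<in> V" for X Y
  proof -
    have "inv_form X Y = (\<Sum>e\<in>V_basis. (X \<bullet> e) * inv_form e Y)"
      using linear_on_span_expansion[of V_basis "\<lambda>X. inv_form X Y" X] that
      by (simp add: V_basis inv_form_add_left inv_form_scale_left)
    moreover have "inv_form e Y = (\<Sum>e'\<in>V_basis. (Y \<bullet> e') * inv_form e e')" if "e \<in> V_basis" for e
      using linear_on_span_expansion[of V_basis "\<lambda>Y. inv_form e Y" Y] that \<open>Y \<in> V\<close>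
      by (simp add: V_basis inv_form_add_right inv_form_scale_right V_basis_V)
    ultimately show ?thesis by simp
  qed
  have contS: "continuous_on V S"
    using linear_on_span_continuous[of V_basis S] S_add S_scale by (simp add: V_basis)
  have contB: "continuous_on ?K (\<lambda>X. inv_form (g X) X)" if g: "continuous_on V g" "\<And>X. X \<in> V \<Longrightarrow> g X \<in> V" for g
  proof -
    have "continuous_on ?K (\<lambda>X. \<Sum>e\<in>V_basis. (g X \<bullet> e) * (\<Sum>e'\<in>V_basis. (X \<bullet> e') * inv_form e e'))"
      using continuous_on_subset[OF g(1), of ?K] W(2) by (intro continuous_intros) auto
    then show ?thesis by (rule continuous_on_eq) (use expB g(2) WV in auto)
  qed
  have pos: "inv_form X X > 0" if "X \<in> W" "X \<noteq> 0" for X using inv_form_pos WV that by blast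
  have "continuous_on ?K f" unfolding f_def
    by (intro continuous_on_divide contB contS continuous_on_id) (use S_V pos in force)+
  moreover have "compact ?K" by (intro compact_Int_closed compact_sphere closed_subspace W)
  moreover have "?K \<noteq> {}"
  proof -
    obtain X where "X \<in> W" "X \<noteq> 0" using W(3) subspace_0[OF W(1)] by auto
    then have "X /\<^sub>R norm X \<in> ?K" using subspace_scale[OF W(1)] by auto
    then show ?thesis by blast
  qed
  ultimately obtain X0 where X0: "X0 \<in> ?K" "\<And>Y. Y \<in> ?K \<Longrightarrow> f Y \<le> f X0"
    using continuous_attains_sup[of ?K f] by blast
  define \<mu> where "\<mu> = f X0"
  have X0W: "X0 \<in> W" "X0 \<noteq> 0" using X0(1) by auto
  have le: "inv_form (S Y) Y \<le> \<mu> * inv_form Y Y" if Y: "Y \<in> W" for Y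
  proof (cases "Y = 0")
    case True
    then show ?thesis using inv_form_scale_right[OF V_zero, of _ 0] by simp
  next
    case False
    let ?Z = "Y /\<^sub>R norm Y"
    have YV: "Y \<in> V" "S Y \<in> V" using WV S_V Y by auto
    have "?Z \<in> ?K" using Y False subspace_scale[OF W(1)] by auto
    then have "f ?Z \<le> \<mu>" unfolding \<mu>_def by (rule X0(2))
    moreover have "f ?Z = f Y"
      using False by (simp add: f_def S_scale YV inv_form_scale_left inv_form_scale_right scale_V)
    ultimately have "f Y \<le> \<mu>" by (simp only:)
    then show ?thesis using pos[OF Y False] by (simp add: f_def pos_divide_le_eq)
  qed
  have eq: "inv_form (S X0) X0 = \<mu> * inv_form X0 X0" using pos[OF X0W] by (simp add: \<mu>_def f_def)
  let ?D = "S X0 - \<mu> *\<^sub>R X0"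
  have D: "?D \<in> W" using S[OF X0W(1)] subspace_scale[OF W(1) X0W(1)] subspace_diff[OF W(1)] by blast
  have orth: "inv_form ?D Y = 0" if Y: "Y \<in> W" for Y
  proof -
    have m: "X0 \<in> V" "Y \<in> V" "S X0 \<in> V" "S Y \<in> V" using WV X0W Y S_V by auto
    have BD: "inv_form ?D Y = inv_form (S X0) Y - \<mu> * inv_form X0 Y"
      using inv_form_add_left[of "S X0" "(- \<mu>) *\<^sub>R X0" Y] inv_form_scale_left[of X0 "- \<mu>" Y] m
        scale_V[OF m(1), of "- \<mu>"] by simp
    \<comment> \<open>The inequality \<open>le\<close> at X0 + t Y, with the equality at X0
      subtracted: the term linear in t is bounded by a quadratic one for every t, which will force
      it to vanish.\<close>
    have quad: "2 * t * inv_form ?D Y \<le> t\<^sup>2 * (\<mu> * inv_form Y Y - inv_form (S Y) Y)" for t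
    proof -
      have "X0 + t *\<^sub>R Y \<in> W" using X0W(1) Y W(1) by (simp add: subspace_add subspace_scale)
      from le[OF this]
      have "inv_form (S X0) X0 + t * inv_form (S X0) Y + t * inv_form (S Y) X0 + t\<^sup>2 * inv_form (S Y) Y \<le>
          \<mu> * (inv_form X0 X0 + t * inv_form X0 Y + t * inv_form Y X0 + t\<^sup>2 * inv_form Y Y)"
        using m by (simp add: S_add S_scale scale_V inv_form_add_left inv_form_add_right inv_form_scale_left inv_form_scale_right
            V_add power2_eq_square algebra_simps)
      moreover have "inv_form (S Y) X0 = inv_form (S X0) Y" using S_sym[OF Y X0W(1)] by (simp add: inv_form_commute)
      moreover have "inv_form Y X0 = inv_form X0 Y" by (rule inv_form_commute)
      ultimately show ?thesis unfolding BD by (simp add: eq algebra_simps)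
    qed
    define b q where "b = inv_form ?D Y" and "q = \<mu> * inv_form Y Y - inv_form (S Y) Y"
    have q: "2 * t * b \<le> t\<^sup>2 * q" for t using quad by (simp add: b_def q_def)
    have "q \<ge> 0" using le[OF Y] by (simp add: q_def)
    have "b = 0"
    proof (rule ccontr)
      assume b: "b \<noteq> 0"
      \<comment> \<open>At t = b / p the inequality becomes 2 p b^2 \<le> q b^2 after clearing
        denominators, which is impossible for p > q \<ge> 0 and nonzero b. Taking p = q + 1 also
        keeps p positive when q = 0.\<close>
      define p where "p = q + 1"
      have p: "p > 0" using \<open>q \<ge> 0\<close> by (simp add: p_def)
      have "2 * (b / p) * b * p\<^sup>2 \<le> (b / p)\<^sup>2 * q * p\<^sup>2"
        using q[of "b / p"] by (rule mult_right_mono) simp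
      moreover have "2 * (b / p) * b * p\<^sup>2 = 2 * b\<^sup>2 * p" "(b / p)\<^sup>2 * q * p\<^sup>2 = b\<^sup>2 * q"
        using p by (simp_all add: power2_eq_square)
      ultimately have "2 * b\<^sup>2 * p \<le> b\<^sup>2 * q" by (simp only:)
      then have "2 * b\<^sup>2 * (q + 1) \<le> b\<^sup>2 * q" by (simp only: p_def)
      then have "b\<^sup>2 * (q + 2) \<le> 0" by (simp add: algebra_simps)
      moreover have "b\<^sup>2 * (q + 2) > 0" using b \<open>q \<ge> 0\<close> by (intro mult_pos_pos) auto
      ultimately show False by simp
    qed
    then show ?thesis by (simp add: b_def)
  qed
  have "?D = 0" using orth[OF D] pos[OF D] by force
  define W' where "W' = {X \<in> W. S X = \<mu> *\<^sub>R X}"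
  have "W' = W"
  proof (rule minimal)
    have S0: "S 0 = 0" using S_scale[OF V_zero, of 0] by simp
    show "subspace W'"
      unfolding W'_def
      by (rule subspaceI)
        (auto simp: S0 subspace_0 subspace_add subspace_scale W(1) S_add S_scale WV scaleR_add_right mult.commute)
    show "W' \<subseteq> W" by (auto simp: W'_def)
    have "X0 \<in> W'" using X0W \<open>?D = 0\<close> by (simp add: W'_def)
    then show "W' \<noteq> {0}" using X0W by auto
    show "ad H X \<in> W'" if "H \<in> tt" "X \<in> W'" for H X
      using that by (auto simp: W'_def inv S_comm ad_scale_right tt_V WV)
  qed
  then show ?thesis by (auto simp: W'_def)
qed


section \<open>The stabilizer of the highest weight line\<close>

definition dsigmaC :: "'e \<Rightarrow> 'e \<Rightarrow> 'h \<Rightarrow> 'h" where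
  "dsigmaC X Y v = dsigma X v + \<i> *\<^sub>C dsigma Y v"

text \<open>The condition that X + \<i> Y lies in the stabilizer of the line of v0 inside the
  complexified Lie algebra. For a highest weight vector this contains the Lie algebra of the torus
  and all positive root spaces.\<close>

definition stabilizes :: "'e \<Rightarrow> 'e \<Rightarrow> bool" where
  "stabilizes X Y \<longleftrightarrow> (\<exists>c. dsigmaC X Y v0 = c *\<^sub>C v0)"

lemma dsigmaC_add: "X \<in> V \<Longrightarrow> Y \<in> V \<Longrightarrow> dsigmaC X Y (u + v) = dsigmaC X Y u + dsigmaC X Y v"
  and dsigmaC_scaleC: "X \<in> V \<Longrightarrow> Y \<in> V \<Longrightarrow> dsigmaC X Y (c *\<^sub>C u) = c *\<^sub>C dsigmaC X Y u"
  by (simp_all add: dsigmaC_def dsigma_add_right dsigma_scaleC_right scaleC_add_right scaleC_scaleC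
      mult.commute)

lemma dsigmaC_ad:
  assumes H: "H \<in> V" and X: "X \<in> V" and Y: "Y \<in> V"
  shows "dsigmaC (ad H X) (ad H Y) v = dsigma H (dsigmaC X Y v) - dsigmaC X Y (dsigma H v)"
  by (simp add: dsigmaC_def dsigma_ad H X Y dsigma_add_right dsigma_scaleC_right
      complex_vector.scale_right_diff_distrib)

lemma bounded_linear_scaleC_left: "bounded_linear (\<lambda>c. c *\<^sub>C (v :: 'h))"
proof
  show "\<exists>K. \<forall>x. norm (x *\<^sub>C v) \<le> norm x * K"
    by (intro exI[of _ "norm v"]) (simp add: norm_scaleC)
qed (simp_all add: scaleC_add_left scaleR_scaleC[where 'a = 'h] scaleC_scaleC scaleR_conv_of_real)

lemma tt_weight:
  assumes H: "H \<in> tt"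
  shows "\<exists>c. dsigma H v0 = c *\<^sub>C v0"
proof -
  have "\<sigma> (Exp (s *\<^sub>R H)) v0 = exp (\<i> * of_real (\<Lambda> H) * of_real s) *\<^sub>C v0" for s
  proof -
    have "\<sigma> (lie_exp G (s *\<^sub>R H)) v0 = exp (\<i> * complex_of_real (\<Lambda> (s *\<^sub>R H))) *\<^sub>C v0"
      using highest_weight tt_scale[OF H] unfolding highest_weight_vector_def by blast
    moreover have "\<Lambda> (s *\<^sub>R H) = s * \<Lambda> H"
      using weight_functional H unfolding real_functionals_def by blast
    ultimately show ?thesis by (simp add: lie_exp_eq scale_V tt_V H mult_ac)
  qed
  moreover have "((\<lambda>s. exp (\<i> * of_real (\<Lambda> H) * of_real s) *\<^sub>C v0) has_vector_derivative
      (\<i> * of_real (\<Lambda> H)) *\<^sub>C v0) (at 0)"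
  proof (rule bounded_linear.has_vector_derivative[OF bounded_linear_scaleC_left])
    have "((\<lambda>z. exp (\<i> * of_real (\<Lambda> H) * z)) has_field_derivative \<i> * of_real (\<Lambda> H)) (at (of_real 0))"
      by (auto intro!: derivative_eq_intros)
    then show "((\<lambda>s. exp (\<i> * of_real (\<Lambda> H) * of_real s)) has_vector_derivative \<i> * of_real (\<Lambda> H)) (at 0)"
      by (rule has_vector_derivative_real_field)
  qed
  ultimately have "dsigma H v0 = (\<i> * of_real (\<Lambda> H)) *\<^sub>C v0"
    by (intro dsigma_eqI tt_V H) simp
  then show ?thesis by blast
qed

lemma differential_rep_eq: "X \<in> V \<Longrightarrow> differential_rep G \<sigma> X v = dsigma X v"
  by (simp add: differential_rep_def dsigma_def lie_exp_eq scale_V)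

lemma root_space_imp_stabilizes:
  assumes "\<alpha> \<in> P" "(X, Y) \<in> root_space G T \<alpha>"
  shows "stabilizes X Y"
proof -
  have "X \<in> V" "Y \<in> V" using assms(2) by (auto simp: root_space_def model_eq)
  moreover have "differential_rep G \<sigma> X v0 + \<i> *\<^sub>C differential_rep G \<sigma> Y v0 = 0"
    using highest_weight assms unfolding highest_weight_vector_def by blast
  ultimately have "dsigmaC X Y v0 = 0" by (simp add: dsigmaC_def differential_rep_eq)
  then show ?thesis unfolding stabilizes_def by (intro exI[of _ 0]) simp
qed

text \<open>
  Equivalently, the stabilizer of the highest weight line and its complex conjugate span the
  complexified Lie algebra.  If the real parts of stabilizing elements did not exhaust \<open>V\<close>, the torus would
  act on their orthogonal complement, and a minimal invariant subspace of it would consist either of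
  fixed vectors of the torus, which lie in its Lie algebra, or of real parts of root vectors.
\<close>

theorem stabilizer_polarization:
  assumes "X \<in> V"
  shows "\<exists>Y\<in>V. stabilizes X Y"
proof -
  define q where "q = {X \<in> V. \<exists>Y\<in>V. stabilizes X Y}"
  have dsigmaC_sum: "dsigmaC (X + X') (Y + Y') v = dsigmaC X Y v + dsigmaC X' Y' v"
    if "X \<in> V" "Y \<in> V" "X' \<in> V" "Y' \<in> V" for X Y X' Y' v
    using that by (simp add: dsigmaC_def dsigma_add_left scaleC_add_right)
  have dsigmaC_scale: "dsigmaC (r *\<^sub>R X) (r *\<^sub>R Y) v = r *\<^sub>R dsigmaC X Y v" if "X \<in> V" "Y \<in> V" for X Y r v
    using that by (simp add: dsigmaC_def dsigma_scale_left scaleR_add_right scaleR_scaleC scaleC_add_right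
        scaleC_scaleC mult.commute)
  have q: "subspace q"
  proof (rule subspaceI)
    have "dsigma 0 v0 = 0" using dsigma_scale_left[OF V_zero, of 0 v0] by simp
    then have "stabilizes 0 0" unfolding stabilizes_def dsigmaC_def by (intro exI[of _ 0]) simp
    then show "0 \<in> q" using V_zero by (auto simp: q_def)
  next
    fix X X' assume "X \<in> q" "X' \<in> q"
    then obtain Y Y' c c' where "X \<in> V" "Y \<in> V" "X' \<in> V" "Y' \<in> V"
      "dsigmaC X Y v0 = c *\<^sub>C v0" "dsigmaC X' Y' v0 = c' *\<^sub>C v0" by (auto simp: q_def stabilizes_def)
    then show "X + X' \<in> q"
      by (auto simp: q_def stabilizes_def V_add dsigmaC_sum scaleC_add_left[symmetric] intro!: bexI[of _ "Y + Y'"])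
  next
    fix r X assume "X \<in> q"
    then obtain Y c where "X \<in> V" "Y \<in> V" "dsigmaC X Y v0 = c *\<^sub>C v0" by (auto simp: q_def stabilizes_def)
    then show "r *\<^sub>R X \<in> q"
      by (auto simp: q_def stabilizes_def scale_V dsigmaC_scale scaleR_scaleC scaleC_scaleC intro!: bexI[of _ "r *\<^sub>R Y"])
  qed
  have qV: "q \<subseteq> V" by (auto simp: q_def)
  have tt_q: "H \<in> q" if H: "H \<in> tt" for H
  proof -
    have "dsigma 0 v0 = 0" using dsigma_scale_left[OF V_zero, of 0 v0] by simp
    then have "stabilizes H 0" using tt_weight[OF H] by (simp add: stabilizes_def dsigmaC_def)
    then show ?thesis using tt_V[OF H] V_zero by (auto simp: q_def)
  qed
  have q_ad: "ad H X \<in> q" if H: "H \<in> tt" and X: "X \<in> q" for H X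
  proof -
    obtain Y c where Y: "X \<in> V" "Y \<in> V" "dsigmaC X Y v0 = c *\<^sub>C v0" using X by (auto simp: q_def stabilizes_def)
    obtain d where d: "dsigma H v0 = d *\<^sub>C v0" using tt_weight[OF H] by blast
    note HV = tt_V[OF H]
    \<comment> \<open>Both operators act on v0 by scalars, so their commutator annihilates
      v0.\<close>
    have "dsigmaC (ad H X) (ad H Y) v0 = 0"
      by (simp add: dsigmaC_ad HV Y dsigma_scaleC_right d dsigmaC_scaleC scaleC_scaleC mult.commute)
    then have "stabilizes (ad H X) (ad H Y)" unfolding stabilizes_def by (intro exI[of _ 0]) simp
    then show ?thesis using ad_V[OF HV] Y by (auto simp: q_def)
  qed
  have "q = V"
  proof (rule ccontr)
    assume "q \<noteq> V"
    define qp where "qp = {X \<in> V. \<forall>Y\<in>q. inv_form X Y = 0}"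
    have qp: "subspace qp"
    proof (rule subspaceI)
      show "0 \<in> qp" using inv_form_scale_left[OF V_zero, of 0] V_zero by (auto simp: qp_def)
    qed (use qV in \<open>auto simp: qp_def V_add scale_V inv_form_add_left inv_form_scale_left subset_iff\<close>)
    have qp_ad: "ad H X \<in> qp" if "H \<in> tt" "X \<in> qp" for H X
      using that q_ad qV tt_V ad_V by (auto simp: qp_def inv_form_skew subset_iff)
    obtain X1 where "X1 \<in> qp" "X1 \<noteq> 0"
      using inv_form_complement[OF q qV \<open>q \<noteq> V\<close>] by (auto simp: qp_def)
    define inv_sub where "inv_sub W \<longleftrightarrow> subspace W \<and> W \<subseteq> qp \<and> W \<noteq> {0} \<and>
      (\<forall>H\<in>tt. \<forall>X\<in>W. ad H X \<in> W)" for W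
    have "inv_sub qp" using qp qp_ad \<open>X1 \<in> qp\<close> \<open>X1 \<noteq> 0\<close> by (auto simp: inv_sub_def)
    from ex_has_least_nat[of inv_sub, OF this, of dim]
    obtain W where W: "inv_sub W" "\<And>W'. inv_sub W' \<Longrightarrow> dim W \<le> dim W'" by blast
    have Wsub: "subspace W" "W \<subseteq> qp" "W \<noteq> {0}" and W_ad: "\<And>H X. H \<in> tt \<Longrightarrow> X \<in> W \<Longrightarrow> ad H X \<in> W"
      using W(1) by (auto simp: inv_sub_def)
    have WV: "W \<subseteq> V" using Wsub(2) by (auto simp: qp_def)
    have WV': "X \<in> V" if "X \<in> W" for X using that WV by blast
    have W_q: "X = 0" if "X \<in> W" "X \<in> q" for X
      using that Wsub(2) inv_form_pos[of X] by (force simp: qp_def)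
    have minimal: "W' = W" if "subspace W'" "W' \<subseteq> W" "W' \<noteq> {0}"
      "\<And>H X. H \<in> tt \<Longrightarrow> X \<in> W' \<Longrightarrow> ad H X \<in> W'" for W'
    proof -
      have "inv_sub W'" using that Wsub(2) by (auto simp: inv_sub_def)
      from W(2)[OF this] show ?thesis
        using that Wsub(1) by (intro subspace_dim_equal) auto
    qed
    have comm: "ad H (ad H' X) = ad H' (ad H X)" if "H \<in> tt" "H' \<in> tt" "X \<in> V" for H H' X
      by (rule ad_commute[OF tt_V tt_V _ tt_commute]) (use that in auto)
    \<comment> \<open>\<open>ad H\<close> and \<open>ad H'\<close> are skew for the form and
      commute, so their product is symmetric; it commutes with the torus action and is therefore a
      scalar on the minimal subspace W.\<close>
    have "\<exists>\<mu>. \<forall>X\<in>W. ad H (ad H' X) = \<mu> *\<^sub>R X" if H: "H \<in> tt" "H' \<in> tt" for H H'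
    proof (rule symmetric_commuting_scalar[OF Wsub(1) WV Wsub(3) minimal])
      show "inv_form (ad H (ad H' X)) Y = inv_form X (ad H (ad H' Y))" if "X \<in> W" "Y \<in> W" for X Y
      proof -
        have m: "X \<in> V" "Y \<in> V" "H \<in> V" "H' \<in> V" using that WV' H tt_V by auto
        have "inv_form (ad H (ad H' X)) Y = inv_form X (ad H' (ad H Y))"
          using m by (simp add: inv_form_skew ad_V)
        also have "ad H' (ad H Y) = ad H (ad H' Y)" using comm[OF H m(2)] by simp
        finally show ?thesis .
      qed
      show "ad H (ad H' (ad K X)) = ad K (ad H (ad H' X))" if "K \<in> tt" "X \<in> W" for K X
        using comm[OF H(1) that(1)] comm[OF H(2) that(1)] ad_V tt_V H WV' that by simp
    qed (use H W_ad tt_V in \<open>auto simp: ad_V ad_add_right ad_scale_right\<close>)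
    then obtain \<mu> where \<mu>: "\<And>H H' X. H \<in> tt \<Longrightarrow> H' \<in> tt \<Longrightarrow> X \<in> W \<Longrightarrow> ad H (ad H' X) = \<mu> H H' *\<^sub>R X"
      by metis
    obtain X0 where X0: "X0 \<in> W" "X0 \<noteq> 0" using Wsub(3) subspace_0[OF Wsub(1)] by auto
    show False
    proof (cases "\<forall>H\<in>tt. \<forall>X\<in>W. ad H X = 0")
      case True
      have "X0 \<in> tt"
      proof (rule fixed_by_torus_imp_tt[OF WV'[OF X0(1)]])
        fix H s assume H: "H \<in> tt"
        have "((\<lambda>s. Adj (Exp (s *\<^sub>R H)) X0) has_vector_derivative 0) (at t)" for t
        proof -
          have "Adj (Exp (t *\<^sub>R H)) 0 = 0" using Adj_scale[OF V_zero, of _ 0] by simp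
          then show ?thesis
            using ad_derivative[OF tt_V[OF H] WV'[OF X0(1)], of t] True H X0(1) by simp
        qed
        from zero_vector_derivative_const[OF this, of s]
        show "Adj (Exp (s *\<^sub>R H)) X0 = X0" using Adj_one[OF WV'[OF X0(1)]] by simp
      qed
      then show False using W_q X0 tt_q by blast
    next
      case False
      then obtain H0 X1 where H0: "H0 \<in> tt" "X1 \<in> W" "ad H0 X1 \<noteq> 0" by blast
      have m1: "H0 \<in> V" "X1 \<in> V" "ad H0 X1 \<in> V" using H0 tt_V WV' ad_V by auto
      have "X1 \<noteq> 0" using H0(3) ad_scale_right[OF m1(1) V_zero, of 0] by auto
      have "\<mu> H0 H0 * inv_form X1 X1 = inv_form (ad H0 (ad H0 X1)) X1"
        using \<mu>[OF H0(1,1,2)] by (simp add: inv_form_scale_left m1)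
      also have "\<dots> = - inv_form (ad H0 X1) (ad H0 X1)" by (rule inv_form_skew) (use m1 in auto)
      also have "\<dots> < 0" using inv_form_pos[OF m1(3) H0(3)] by simp
      finally have "\<mu> H0 H0 < 0"
        using inv_form_pos[OF m1(2) \<open>X1 \<noteq> 0\<close>] by (simp add: mult_less_0_iff)
      \<comment> \<open>\<open>ad H0\<close> squares to the negative scalar
        \<open>\<mu> H0 H0\<close> on W, so after division by c it becomes a complex structure
        J.\<close>
      define c where "c = sqrt (- \<mu> H0 H0)"
      have c: "c > 0" "c * c = - \<mu> H0 H0" using \<open>\<mu> H0 H0 < 0\<close> by (simp_all add: c_def)
      define J where "J X = ad H0 X /\<^sub>R c" for X
      \<comment> \<open>Applying J to \<open>ad H X\<close> gives \<open>\<mu> H H0 / c\<close>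
        times X, so \<open>ad H\<close> is minus this scalar times J. The value 0 off the torus
        algebra is demanded by \<open>real_functionals\<close>.\<close>
      define a where "a H = (if H \<in> tt then - \<mu> H H0 / c else 0)" for H
      have JW: "J X \<in> W" if "X \<in> W" for X
        using W_ad[OF H0(1) that] subspace_scale[OF Wsub(1)] by (simp add: J_def)
      have JJ: "J (J X) = - X" if "X \<in> W" for X
      proof -
        have "J (J X) = (inverse c * inverse c * \<mu> H0 H0) *\<^sub>R X"
          unfolding J_def using that H0(1) tt_V W_ad WV' by (simp add: ad_scale_right \<mu>)
        also have "inverse c * inverse c * \<mu> H0 H0 = - 1"
          using c \<open>\<mu> H0 H0 < 0\<close> by (simp add: field_simps)
        finally show ?thesis by simp
      qed
      have ad_J: "ad H X = a H *\<^sub>R J X" if H: "H \<in> tt" and X: "X \<in> W" for H X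
      proof -
        have "ad H0 (ad H X) = \<mu> H H0 *\<^sub>R X"
          using comm[OF H H0(1) WV'[OF X]] \<mu>[OF H H0(1) X] by metis
        then have "J (ad H X) = (\<mu> H H0 / c) *\<^sub>R X" by (simp add: J_def divide_inverse mult.commute)
        moreover have "J (r *\<^sub>R X) = r *\<^sub>R J X" for r
          using m1(1) WV'[OF X] by (simp add: J_def ad_scale_right mult.commute)
        ultimately have "J (J (ad H X)) = (\<mu> H H0 / c) *\<^sub>R J X" by simp
        then have "ad H X = - ((\<mu> H H0 / c) *\<^sub>R J X)" using JJ[OF W_ad[OF H X]] by (metis minus_minus)
        then show ?thesis using H by (simp add: a_def)
      qed
      have J0: "J X0 \<noteq> 0"
      proof
        assume "J X0 = 0"
        moreover have "J 0 = 0" using ad_scale_right[OF m1(1) V_zero, of 0] by (simp add: J_def)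
        ultimately show False using JJ[OF X0(1)] X0(2) by simp
      qed
      have cancel: "r = r'" if "r *\<^sub>R J X0 = r' *\<^sub>R J X0" for r r'
        using that J0 by simp
      have a_real: "a \<in> real_functionals G T"
        unfolding real_functionals_def
      proof (intro CollectI conjI ballI allI impI)
        fix H H' assume H: "H \<in> tt" "H' \<in> tt"
        have "ad (H + H') X0 = ad H X0 + ad H' X0"
          by (rule ad_add_left[OF tt_V tt_V WV' tt_commute]) (use H X0 in auto)
        then show "a (H + H') = a H + a H'"
          using H tt_add X0(1) by (intro cancel) (simp add: ad_J scaleR_add_left)
      next
        fix r H assume H: "H \<in> tt"
        have "ad (r *\<^sub>R H) X0 = r *\<^sub>R ad H X0" by (rule ad_scale_left[OF tt_V[OF H] WV'[OF X0(1)]])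
        then show "a (r *\<^sub>R H) = r * a H"
          using H tt_scale X0(1) by (intro cancel) (simp add: ad_J)
      qed (simp add: a_def)
      \<comment> \<open>Turning the orbits of X and J X back by the angle \<open>a H * s\<close>
        gives two functions of s with zero derivative; their values at s = 1 are solved for the
        orbit of X.\<close>
      have rot: "Adj (Exp H) X = cos (a H) *\<^sub>R X + sin (a H) *\<^sub>R J X" if H: "H \<in> tt" and X: "X \<in> W" for H X
      proof -
        let ?u = "\<lambda>s. Adj (Exp (s *\<^sub>R H)) X" and ?v = "\<lambda>s. Adj (Exp (s *\<^sub>R H)) (J X)"
        note HV = tt_V[OF H] and XV = WV'[OF X] and JV = WV'[OF JW[OF X]]
        have u': "(?u has_vector_derivative a H *\<^sub>R ?v t) (at t)" for t
          using ad_derivative[OF HV XV, of t] ad_J[OF H X] Adj_scale[OF JV] by simp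
        have v': "(?v has_vector_derivative - a H *\<^sub>R ?u t) (at t)" for t
          using ad_derivative[OF HV JV, of t] ad_J[OF H JW[OF X]] JJ[OF X] Adj_scale[OF XV, of _ "- a H"] by simp
        have cos': "((\<lambda>s. cos (a H * s)) has_field_derivative - a H * sin (a H * t)) (at t)"
          and sin': "((\<lambda>s. sin (a H * s)) has_field_derivative a H * cos (a H * t)) (at t)" for t
          by (auto intro!: derivative_eq_intros)
        have f: "((\<lambda>s. cos (a H * s) *\<^sub>R ?u s - sin (a H * s) *\<^sub>R ?v s) has_vector_derivative 0) (at t)" for t
          using has_vector_derivative_diff[OF has_vector_derivative_scaleR[OF cos' u']
              has_vector_derivative_scaleR[OF sin' v'], of t] by (simp add: algebra_simps)
        have g: "((\<lambda>s. sin (a H * s) *\<^sub>R ?u s + cos (a H * s) *\<^sub>R ?v s) has_vector_derivative 0) (at t)" for t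
          using has_vector_derivative_add[OF has_vector_derivative_scaleR[OF sin' u']
              has_vector_derivative_scaleR[OF cos' v'], of t] by (simp add: algebra_simps)
        have F: "cos (a H) *\<^sub>R ?u 1 - sin (a H) *\<^sub>R ?v 1 = X"
          using zero_vector_derivative_const[OF f, of 1] Adj_one[OF XV] by simp
        have Gg: "sin (a H) *\<^sub>R ?u 1 + cos (a H) *\<^sub>R ?v 1 = J X"
          using zero_vector_derivative_const[OF g, of 1] Adj_one[OF JV] by simp
        have "p *\<^sub>R (p *\<^sub>R y - r *\<^sub>R z) + r *\<^sub>R (r *\<^sub>R y + p *\<^sub>R z) = (p\<^sup>2 + r\<^sup>2) *\<^sub>R y"
          for p r :: real and y z :: 'e
          by (simp add: scaleR_diff_right scaleR_add_right scaleR_add_left power2_eq_square mult.commute)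
        from this[of "cos (a H)" "?u 1" "sin (a H)" "?v 1"]
        show ?thesis unfolding F Gg by simp
      qed
      have rotJ: "Adj (Exp H) (J X0) = cos (a H) *\<^sub>R J X0 - sin (a H) *\<^sub>R X0" if "H \<in> tt" for H
        using rot[OF that JW[OF X0(1)]] JJ[OF X0(1)] by simp
      have AdH: "Ad G (lie_exp G H) X = Adj (Exp H) X" if "H \<in> tt" "X \<in> V" for H X
        using that by (simp add: Ad_eq lie_exp_eq tt_V)
      have mX: "X0 \<in> V" "J X0 \<in> V" using WV' X0 JW by auto
      have Adj_neg: "Adj g (- J X0) = - Adj g (J X0)" for g
        using Adj_scale[OF mX(2), of g "- 1"] by simp
      \<comment> \<open>X0 - \<i> J X0 is a root vector for a, and its conjugate X0 + \<i> J X0 is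
        one for - a. Both have real part X0, so it does not matter which of the two roots is
        positive.\<close>
      have rs: "(X0, - J X0) \<in> root_space G T a" "(X0, J X0) \<in> root_space G T (- a)"
        using mX rot[OF _ X0(1)] rotJ V_minus[OF mX(2)]
        by (auto simp: root_space_def model_eq AdH Adj_neg)
      have aH0: "a H0 = c" using c H0(1) by (simp add: a_def field_simps)
      have "a H0 \<noteq> 0" using aH0 c by simp
      then have "a \<noteq> 0" by auto
      then have "a \<in> roots G T" using a_real rs(1) X0(2) by (auto simp: roots_def)
      then have "a \<in> P \<or> - a \<in> P"
        using positive_roots by (auto simp: positive_root_system_def)
      then have "stabilizes X0 (- J X0) \<or> stabilizes X0 (J X0)" using root_space_imp_stabilizes rs by blast
      then have "X0 \<in> q" using mX V_minus[OF mX(2)] by (auto simp: q_def)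
      then show False using W_q X0 by blast
    qed
  qed
  then show ?thesis using assms by (auto simp: q_def)
qed

text \<open>The filtration of the representation by the number of Lie algebra elements applied to
  v0. Lower words are kept at each stage, so the levels increase and their union is a
  subspace.\<close>

primrec words :: "nat \<Rightarrow> 'h set" where
  "words 0 = cspan {v0}"
| "words (Suc n) = cspan (words n \<union> {dsigma X u |X u. X \<in> V \<and> u \<in> words n})"

lemma words_csubspace: "csubspace (words n)"
  by (cases n) (simp_all add: complex_vector.subspace_span)

lemma words_Suc: "words n \<subseteq> words (Suc n)"
  using complex_vector.span_superset[of "words n \<union> {dsigma X u |X u. X \<in> V \<and> u \<in> words n}"] by auto

lemma dsigma_words: "X \<in> V \<Longrightarrow> u \<in> words n \<Longrightarrow> dsigma X u \<in> words (Suc n)"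
  by (auto intro!: complex_vector.span_base)

lemma words_Suc_induct [consumes 1]:
  assumes "u \<in> words (Suc n)"
    and "csubspace {u. Q u}"
    and "\<And>u. u \<in> words n \<Longrightarrow> Q u" "\<And>X u. X \<in> V \<Longrightarrow> u \<in> words n \<Longrightarrow> Q (dsigma X u)"
  shows "Q u"
  using assms(1) unfolding words.simps
  by (rule complex_vector.span_induct) (use assms(2-4) in auto)

lemma words_UNIV: "(\<Union>n. words n) = UNIV"
proof (rule invariant_subspace_eq_UNIV[OF irreducible])
  have mono: "words n \<subseteq> words k" if "n \<le> k" for n k
    by (rule lift_Suc_mono_le[of words, OF words_Suc that])
  show "csubspace (\<Union>n. words n)"
    unfolding complex_vector.subspace_def
  proof (intro conjI ballI allI)
    show "0 \<in> (\<Union>n. words n)" using complex_vector.subspace_0[OF words_csubspace] by blast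
    show "x + y \<in> (\<Union>n. words n)" if xy: "x \<in> (\<Union>n. words n)" "y \<in> (\<Union>n. words n)" for x y
    proof -
      obtain n k where "x \<in> words n" "y \<in> words k" using xy by blast
      then have "x \<in> words (max n k)" "y \<in> words (max n k)"
        using mono[of n "max n k"] mono[of k "max n k"] by auto
      then show ?thesis using complex_vector.subspace_add[OF words_csubspace] by blast
    qed
    show "c *\<^sub>C x \<in> (\<Union>n. words n)" if "x \<in> (\<Union>n. words n)" for c x
      using that complex_vector.subspace_scale[OF words_csubspace] by blast
  qed
  have "v0 \<in> words 0" by (simp add: complex_vector.span_base)
  then show "v0 \<in> (\<Union>n. words n)" by blast
  show "v0 \<noteq> 0" using highest_weight by (simp add: highest_weight_vector_def)
  show "dsigma X u \<in> (\<Union>n. words n)" if "X \<in> V" "u \<in> (\<Union>n. words n)" for X u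
    using that dsigma_words by blast
qed

text \<open>Moving a stabilizing operator past one factor costs only the operator of a bracket,
  which takes the place of that factor. So the number of factors does not grow, although the bracket
  itself need not stabilize the line.\<close>

lemma stabilizes_words:
  assumes st: "stabilizes X Y" "X \<in> V" "Y \<in> V" and u: "u \<in> words n"
  shows "dsigmaC X Y u \<in> words n"
  using u
proof (induction n arbitrary: u)
  case 0
  then obtain c where "u = c *\<^sub>C v0" by (auto simp: complex_vector.span_singleton)
  moreover obtain d where "dsigmaC X Y v0 = d *\<^sub>C v0" using st(1) by (auto simp: stabilizes_def)
  ultimately show ?case
    using st by (auto simp: dsigmaC_scaleC complex_vector.span_singleton scaleC_scaleC)
next
  case (Suc n)
  from Suc.prems show ?case
  proof (rule words_Suc_induct)
    have "dsigmaC X Y 0 = 0" using dsigmaC_scaleC[OF st(2,3), of 0 0] by simp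
    then show "csubspace {u. dsigmaC X Y u \<in> words (Suc n)}"
      using words_csubspace[of "Suc n"] unfolding complex_vector.subspace_def
      by (auto simp: dsigmaC_add st dsigmaC_scaleC simp del: words.simps)
    show "dsigmaC X Y u \<in> words (Suc n)" if "u \<in> words n" for u
      using Suc.IH[OF that] words_Suc by blast
    show "dsigmaC X Y (dsigma Z u) \<in> words (Suc n)" if Z: "Z \<in> V" and u: "u \<in> words n" for Z u
    proof -
      have "dsigmaC X Y (dsigma Z u) = dsigma Z (dsigmaC X Y u) + (- dsigma (ad Z X) u + (- \<i>) *\<^sub>C dsigma (ad Z Y) u)"
        by (simp add: dsigmaC_def dsigma_ad Z st dsigma_add_right dsigma_scaleC_right
            complex_vector.scale_right_diff_distrib)
      moreover have "dsigma Z (dsigmaC X Y u) \<in> words (Suc n)"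
        by (rule dsigma_words[OF Z Suc.IH[OF u]])
      moreover have "dsigma (ad Z X) u \<in> words (Suc n)" "dsigma (ad Z Y) u \<in> words (Suc n)"
        by (rule dsigma_words[OF ad_V[OF Z] u], fact)+
      ultimately show ?thesis
        using words_csubspace[of "Suc n"] complex_vector.subspace_add complex_vector.subspace_neg
          complex_vector.subspace_scale by metis
    qed
  qed
qed

text \<open>
  The adjoint of the complex conjugate of a stabilizing element is, up to sign, this element
  itself, so that it can be moved to the other argument of a matrix coefficient.
\<close>

theorem symbol_zero_imp_zero:
  assumes A: "clinear_on UNIV A" and zero: "\<And>y. cinner (A (\<sigma> y v0)) (\<sigma> y v0) = 0"
  shows "A u = 0"
proof -
  define \<N> where "\<N> = {A. clinear_on UNIV A \<and> (\<forall>y. cinner (A (\<sigma> y v0)) (\<sigma> y v0) = 0)}"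
  have lin: "A (x + y) = A x + A y" "A (c *\<^sub>C x) = c *\<^sub>C A x" if "A \<in> \<N>" for A x y c
    using that by (auto simp: \<N>_def clinear_on_def)
  have linR: "A (r *\<^sub>R x) = r *\<^sub>R A x" if "A \<in> \<N>" for A x r
    using lin(2)[OF that] by (simp add: scaleR_scaleC)
  define br where "br X A = (\<lambda>u. dsigma X (A u) - A (dsigma X u))" for X and A :: "'h \<Rightarrow> 'h"
  \<comment> \<open>The symbol of the commutator at y is, up to sign, the derivative of the symbol
    of A at y in the direction of the line of X.\<close>
  have br: "br X A \<in> \<N>" if X: "X \<in> V" and AN: "A \<in> \<N>" for X A
  proof -
    have "cinner (br X A (\<sigma> y v0)) (\<sigma> y v0) = 0" for y
    proof -
      let ?w = "\<lambda>s. \<sigma> (Exp (s *\<^sub>R X)) (\<sigma> y v0)"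
      have w: "(?w has_vector_derivative dsigma X (\<sigma> y v0)) (at 0)" by (rule dsigma_derivative_0[OF X])
      have "((\<lambda>s. A (?w s)) has_vector_derivative A (dsigma X (\<sigma> y v0))) (at 0)"
        by (rule linear_path_rep[of A, OF lin(1)[OF AN] linR[OF AN] w])
      from has_vector_derivative_cinner[OF this w]
      have "((\<lambda>s. cinner (A (?w s)) (?w s)) has_vector_derivative
          cinner (A (\<sigma> y v0)) (dsigma X (\<sigma> y v0)) + cinner (A (dsigma X (\<sigma> y v0))) (\<sigma> y v0)) (at 0)"
        by simp
      moreover have "cinner (A (?w s)) (?w s) = 0" for s
        using AN unfolding \<N>_def sigma_mult[symmetric] by blast
      ultimately have "((\<lambda>s::real. 0) has_vector_derivative
          cinner (A (\<sigma> y v0)) (dsigma X (\<sigma> y v0)) + cinner (A (dsigma X (\<sigma> y v0))) (\<sigma> y v0)) (at 0)"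
        by simp
      from vector_derivative_unique_at[OF this has_vector_derivative_const]
      have "cinner (A (\<sigma> y v0)) (dsigma X (\<sigma> y v0)) + cinner (A (dsigma X (\<sigma> y v0))) (\<sigma> y v0) = 0" .
      then show ?thesis
        by (simp add: br_def cinner_diff_left dsigma_skew X add_eq_0_iff)
    qed
    moreover have "clinear_on UNIV (br X A)"
      by (auto simp: clinear_on_def br_def lin[OF AN] dsigma_add_right X dsigma_scaleC_right
          complex_vector.scale_right_diff_distrib)
    ultimately show ?thesis by (simp add: \<N>_def)
  qed
  have v0z: "cinner (A (c *\<^sub>C v0)) (d *\<^sub>C v0) = 0" if "A \<in> \<N>" for A c d
  proof -
    have "cinner (A (\<sigma> \<one> v0)) (\<sigma> \<one> v0) = 0" using that unfolding \<N>_def by blast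
    then show ?thesis by (simp add: lin[OF that] cinner_scaleC_left cinner_scaleC_right)
  qed
  \<comment> \<open>Let p and q be the coefficients of A at \<open>dsigma X a\<close> and
    \<open>dsigma Y a\<close> against b. The induction hypothesis for \<open>dsigmaC X Y a\<close>
    gives p + \<i> q = 0. As \<open>dsigmaC X Y b\<close> still lies on the line of v0, the
    hypothesis for a applies there as well; after the commutators with A have moved the operators to
    the other argument, it gives - p + \<i> q = 0. Hence p = 0. The commutators are the reason to
    induct for all A in \<N> at once.\<close>
  have base: "cinner (A a) b = 0" if "A \<in> \<N>" "a \<in> words n" "b \<in> words 0" for A a b n
    using that
  proof (induction n arbitrary: A a b)
    case 0
    then show ?case using v0z by (auto simp: complex_vector.span_singleton)
  next
    case (Suc n)
    note AN = Suc.prems(1) and b = Suc.prems(3)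
    from Suc.prems(2) show ?case
    proof (rule words_Suc_induct)
      have "A 0 = 0" using lin(2)[OF AN, of 0 0] by simp
      then show "csubspace {a. cinner (A a) b = 0}"
        unfolding complex_vector.subspace_def
        by (auto simp: lin[OF AN] cinner_add_left cinner_scaleC_left)
      show "cinner (A a) b = 0" if "a \<in> words n" for a using Suc.IH[OF AN that b] .
      show "cinner (A (dsigma X a)) b = 0" if X: "X \<in> V" and a: "a \<in> words n" for X a
      proof -
        obtain Y where Y: "Y \<in> V" "stabilizes X Y" using stabilizer_polarization[OF X] by blast
        have 1: "cinner (A (dsigmaC X Y a)) b = 0"
          by (rule Suc.IH[OF AN stabilizes_words[OF Y(2) X Y(1) a] b])
        have 2: "cinner (A a) (dsigmaC X Y b) = 0"
          by (rule Suc.IH[OF AN a stabilizes_words[OF Y(2) X Y(1) b]])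
        have 3: "cinner (br X A a) b = 0" "cinner (br Y A a) b = 0"
          by (rule Suc.IH[OF br[OF X AN] a b], rule Suc.IH[OF br[OF Y(1) AN] a b])
        have e1: "cinner (A (dsigma X a)) b + \<i> * cinner (A (dsigma Y a)) b = 0"
          using 1 by (simp add: dsigmaC_def lin[OF AN] cinner_add_left cinner_scaleC_left)
        have e2: "cinner (A a) (dsigma X b) - \<i> * cinner (A a) (dsigma Y b) = 0"
          using 2 by (simp add: dsigmaC_def cinner_add_right cinner_scaleC_right)
        have e3: "cinner (A (dsigma X a)) b = - cinner (A a) (dsigma X b)"
          "cinner (A (dsigma Y a)) b = - cinner (A a) (dsigma Y b)"
          using 3 by (simp_all add: br_def cinner_diff_left dsigma_skew X Y)
        show ?thesis using e1 e2 unfolding e3 by (simp add: algebra_simps complex_eq_iff)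
      qed
    qed
  qed
  \<comment> \<open>A factor is moved from b to a by the commutator with A. This raises the level of
    a, so n is arbitrary in the induction.\<close>
  have step: "cinner (A a) b = 0" if "A \<in> \<N>" "a \<in> words n" "b \<in> words k" for A a b n k
    using that
  proof (induction k arbitrary: A a b n)
    case 0
    then show ?case using base by blast
  next
    case (Suc k)
    note AN = Suc.prems(1) and a = Suc.prems(2)
    from Suc.prems(3) show ?case
    proof (rule words_Suc_induct)
      show "csubspace {b. cinner (A a) b = 0}"
        unfolding complex_vector.subspace_def
        by (auto simp: cinner_add_right cinner_scaleC_right)
      show "cinner (A a) b = 0" if "b \<in> words k" for b using Suc.IH[OF AN a that] .
      show "cinner (A a) (dsigma X b) = 0" if X: "X \<in> V" and b: "b \<in> words k" for X b
      proof -
        have "cinner (br X A a) b = 0" by (rule Suc.IH[OF br[OF X AN] a b])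
        moreover have "cinner (A (dsigma X a)) b = 0" by (rule Suc.IH[OF AN dsigma_words[OF X a] b])
        ultimately show ?thesis by (simp add: br_def cinner_diff_left dsigma_skew X)
      qed
    qed
  qed
  have AN: "A \<in> \<N>" using A zero by (simp add: \<N>_def)
  have "cinner (A u) (A u) = 0"
  proof -
    obtain n k where "u \<in> words n" "A u \<in> words k" using words_UNIV by blast
    then show ?thesis using step[OF AN] by blast
  qed
  then show ?thesis by (simp add: cinner_eq_zero_iff)
qed

end

section \<open>Toeplitz operators and symbols\<close>

lemma sum_fun_apply: "(\<Sum>i\<in>I. f i) x = (\<Sum>i\<in>I. f i x)"
  by (induction I rule: infinite_finite_induct) auto

lemma endomorphisms_iff:
  "A \<in> endomorphisms \<longleftrightarrow> (\<forall>x y. A (x + y) = A x + A y) \<and> (\<forall>c x. A (c *\<^sub>C x) = c *\<^sub>C A x)"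
  by (auto simp: endomorphisms_def clinear_on_def)

lemma tensor_conj_endomorphism: "tensor_conj v w \<in> endomorphisms"
  by (simp add: endomorphisms_iff tensor_conj_def cinner_add_left cinner_scaleC_left scaleC_add_left
      scaleC_scaleC)

lemma endomorphisms_csubspace: "csubspace (endomorphisms :: ('h::complex_vector \<Rightarrow> 'h) set)"
  unfolding complex_vector.subspace_def
  by (auto simp: endomorphisms_iff scaleC_add_right scaleC_fun_def scaleC_scaleC mult.commute algebra_simps)

lemma endomorphism_sum:
  assumes "A \<in> endomorphisms"
  shows "A (\<Sum>i\<in>I. f i) = (\<Sum>i\<in>I. A (f i))"
proof (induction I rule: infinite_finite_induct)
  case empty
  have "A (0 *\<^sub>C 0) = 0 *\<^sub>C A 0" using assms unfolding endomorphisms_iff by blast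
  then show ?case by simp
next
  case (infinite I)
  have "A (0 *\<^sub>C 0) = 0 *\<^sub>C A 0" using assms unfolding endomorphisms_iff by blast
  with infinite show ?case by simp
qed (use assms in \<open>simp add: endomorphisms_iff\<close>)

section \<open>Rank-one operators, and the comparison of the two exponential maps\<close>

context group_chart_rep
begin

lemma endomorphism_expansion:
  assumes E: "corthonormal E" "cspan E = (UNIV :: 'h set)" and A: "A \<in> endomorphisms"
  shows "A = (\<Sum>b\<in>E. tensor_conj (A b) b)"
proof
  fix u
  have "A u = A (\<Sum>b\<in>E. cinner u b *\<^sub>C b)" using corthonormal_expansion[OF E(1)] E(2) by simp
  also have "\<dots> = (\<Sum>b\<in>E. A (cinner u b *\<^sub>C b))" by (rule endomorphism_sum[OF A])
  also have "\<dots> = (\<Sum>b\<in>E. cinner u b *\<^sub>C A b)" using A by (simp add: endomorphisms_iff)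
  finally show "A u = (\<Sum>b\<in>E. tensor_conj (A b) b) u" by (simp add: sum_fun_apply tensor_conj_def)
qed

text \<open>Whatever basis the choice in \<open>hs_inner\<close> picks, it is orthonormal, and
  expanding w in it gives the claim. With both vectors equal to \<open>\<sigma> y v0\<close>, the
  symbol of A at y becomes the pairing of A with a conjugate of the rank-one operator of v0.\<close>

lemma hs_inner_tensor:
  assumes A: "A \<in> endomorphisms"
  shows "hs_inner A (tensor_conj v (w :: 'h)) = cinner (A w) v"
proof -
  define E where "E = (SOME E :: 'h set. orthonormal_basis E)"
  have "\<exists>E :: 'h set. orthonormal_basis E"
    using exists_orthonormal_basis by (auto simp: orthonormal_basis_def corthonormal_def)
  then have "orthonormal_basis E" unfolding E_def by (rule someI_ex)
  then have E: "corthonormal E" "cspan E = UNIV"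
    by (auto simp: orthonormal_basis_def corthonormal_def)
  have "hs_inner A (tensor_conj v w) = (\<Sum>b\<in>E. cinner (A b) (cinner b w *\<^sub>C v))"
    by (simp add: hs_inner_def E_def tensor_conj_def)
  also have "\<dots> = (\<Sum>b\<in>E. cinner (cinner w b *\<^sub>C A b) v)"
    by (intro sum.cong refl) (simp add: cinner_scaleC_left cinner_scaleC_right flip: cinner_commute)
  also have "\<dots> = cinner (\<Sum>b\<in>E. A (cinner w b *\<^sub>C b)) v"
    using A by (simp add: cinner_sum_left endomorphisms_iff)
  also have "\<dots> = cinner (A w) v"
    using corthonormal_expansion[OF E(1), of w] E(2) by (simp flip: endomorphism_sum[OF A])
  finally show ?thesis .
qed

lemma hs_inner_sum_right: "hs_inner A (\<Sum>i\<in>I. f i) = (\<Sum>i\<in>I. hs_inner A (f i))"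
  unfolding hs_inner_def sum_fun_apply cinner_sum_right by (rule sum.swap)

lemma tensor_conj_rep_sum: "tensor_conj_rep G \<sigma> g (\<Sum>i\<in>I. f i) = (\<Sum>i\<in>I. tensor_conj_rep G \<sigma> g (f i))"
  by (simp add: fun_eq_iff tensor_conj_rep_def sum_fun_apply sigma_sum)

lemma tensor_conj_rep_tensor:
  "tensor_conj_rep G \<sigma> g (tensor_conj v v) = tensor_conj (\<sigma> g v) (\<sigma> g v)"
  by (simp add: fun_eq_iff tensor_conj_rep_def tensor_conj_def sigma_scaleC cinner_sigma_left)

text \<open>Translating a chart does not change derivatives, so uniqueness of one-parameter
  subgroups makes the definite description in \<open>lie_exp\<close> denote the line of
  \<open>Exp\<close>, and the derivative defining \<open>Ad\<close> is the direction of the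
  conjugated line.\<close>

lemma lie_exp_Ad_eq:
  assumes chart: "\<And>g. base_chart G g = \<psi> g + a" and X: "X \<in> V"
  shows "lie_exp G X = Exp X" "Ad G g X = Adj g X"
proof -
  have deriv_iff: "((\<lambda>s. base_chart G (\<gamma> s)) has_vector_derivative Y) (at 0) \<longleftrightarrow>
      ((\<lambda>s. \<psi> (\<gamma> s)) has_vector_derivative Y) (at 0)" for \<gamma> Y
    by (simp add: chart has_vector_derivative_iff_quotient)
  have exp: "lie_exp G X = Exp X" if X: "X \<in> V" for X
  proof -
    have "(THE \<gamma>. one_parameter_subgroup G X \<gamma>) = (\<lambda>s. Exp (s *\<^sub>R X))"
    proof (rule the_equality)
      show "one_parameter_subgroup G X (\<lambda>s. Exp (s *\<^sub>R X))"
        unfolding one_parameter_subgroup_def deriv_iff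
        using continuous_on_Exp_line[OF X] Exp_add[OF X] psi_Exp_has_derivative[OF X] by blast
    next
      fix \<gamma> assume "one_parameter_subgroup G X \<gamma>"
      then show "\<gamma> = (\<lambda>s. Exp (s *\<^sub>R X))"
        unfolding one_parameter_subgroup_def deriv_iff using one_parameter_unique(2) by blast
    qed
    then show ?thesis by (simp add: lie_exp_def)
  qed
  show "lie_exp G X = Exp X" by (rule exp[OF X])
  have "((\<lambda>s. \<psi> (Exp (s *\<^sub>R Adj g X))) has_vector_derivative Adj g X) (at 0)"
    by (rule psi_Exp_has_derivative[OF Adj_V[OF X]])
  then have "((\<lambda>s. base_chart G (g \<otimes> lie_exp G (s *\<^sub>R X) \<otimes> inv g)) has_vector_derivative Adj g X) (at 0)"
    unfolding deriv_iff by (simp add: exp scale_V[OF X] Exp_Adj[OF X])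
  then show "Ad G g X = Adj g X" unfolding Ad_def by (rule vector_derivative_at)
qed

end

section \<open>Symbols and the adjoint of the quantization\<close>

context weight_setting
begin

definition symbol :: "('h \<Rightarrow> 'h) \<Rightarrow> 'g \<Rightarrow> complex" where
  "symbol A y = cinner (A (\<sigma> y v0)) (\<sigma> y v0)"

definition symbols :: "('g \<Rightarrow> complex) set" where
  "symbols = symbol ` endomorphisms"

lemma symbol_add: "symbol (A + B) = symbol A + symbol B"
  and symbol_scaleC: "symbol (c *\<^sub>C A) = c *\<^sub>C symbol A"
  by (simp_all add: fun_eq_iff symbol_def cinner_add_left scaleC_fun_def cinner_scaleC_left scaleC_complex_def)

lemma symbols_csubspace: "csubspace symbols"
proof -
  note End = endomorphisms_csubspace[unfolded complex_vector.subspace_def]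
  have "symbol 0 = 0" by (simp add: fun_eq_iff symbol_def)
  then show ?thesis
    using End unfolding complex_vector.subspace_def symbols_def
    by (auto simp flip: symbol_add symbol_scaleC intro!: image_eqI)
qed

lemma symbol_tensor: "symbol (tensor_conj v w) y = cinner v (\<sigma> y v0) * cnj (cinner w (\<sigma> y v0))"
  by (simp add: symbol_def tensor_conj_def cinner_scaleC_left flip: cinner_commute)

lemma cnj_symbol_tensor: "cnj (symbol (tensor_conj v w) y) = symbol (tensor_conj w v) y"
  by (simp add: symbol_tensor mult.commute)

lemma symbol_continuous: "A \<in> endomorphisms \<Longrightarrow> continuous_on UNIV (symbol A)"
proof -
  assume A: "A \<in> endomorphisms"
  have "continuous_on UNIV A"
    using A by (intro linear_continuous_rep) (simp_all add: endomorphisms_iff scaleR_scaleC)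
  then have "continuous_on UNIV (\<lambda>y. A (\<sigma> y v0))"
    using continuous_on_compose2[OF _ sigma_cont] by blast
  then show "continuous_on UNIV (symbol A)"
    unfolding symbol_def[abs_def] by (intro continuous_on_cinner sigma_cont)
qed

lemma continuous_measurable: "continuous_on UNIV (f :: 'g \<Rightarrow> complex) \<Longrightarrow> f \<in> borel_measurable M"
  using borel_measurable_continuous_onI[of f] haar_facts(2) measurable_cong_sets by blast

lemma integrable_mult_continuous:
  fixes f g :: "'g \<Rightarrow> complex"
  assumes f: "integrable M f" and g: "continuous_on UNIV g"
  shows "integrable M (\<lambda>y. f y * g y)"
proof -
  have "bounded (range g)"
    using compact_continuous_image[OF g compact_group] compact_imp_bounded by blast
  then obtain K where K: "\<And>x. cmod (g x) \<le> K" by (auto simp: bounded_iff)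
  show ?thesis
  proof (rule Bochner_Integration.integrable_bound)
    show "integrable M (\<lambda>y. K * cmod (f y))" using f by simp
    show "(\<lambda>y. f y * g y) \<in> borel_measurable M"
      using borel_measurable_integrable[OF f] continuous_measurable[OF g] by simp
    have "cmod (f y * g y) \<le> norm (K * cmod (f y))" for y
    proof -
      have "cmod (f y * g y) \<le> cmod (f y) * K" using K[of y] by (simp add: norm_mult mult_left_mono)
      also have "\<dots> \<le> norm (K * cmod (f y))" by (simp add: mult.commute)
      finally show ?thesis .
    qed
    then show "AE y in M. cmod (f y * g y) \<le> norm (K * cmod (f y))" by simp
  qed
qed

lemma L2_integrable: "f \<in> L2_quotient G M L \<Longrightarrow> integrable M f"
proof -
  interpret prob_space M by (rule haar_facts)
  assume f: "f \<in> L2_quotient G M L"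
  show ?thesis
  proof (rule Bochner_Integration.integrable_bound)
    show "integrable M (\<lambda>y. 1 + (cmod (f y))\<^sup>2)" using f by (simp add: L2_quotient_def)
    have "cmod (f y) \<le> norm (1 + (cmod (f y))\<^sup>2)" for y
    proof -
      have "0 \<le> (cmod (f y) - 1 / 2)\<^sup>2" by simp
      then have "cmod (f y) \<le> 1 + (cmod (f y))\<^sup>2" by (simp add: power2_eq_square algebra_simps)
      then show ?thesis by simp
    qed
    then show "AE y in M. norm (f y) \<le> norm (1 + (cmod (f y))\<^sup>2)" by simp
  qed (use f in \<open>simp add: L2_quotient_def\<close>)
qed

lemma symbol_integrable: "h \<in> symbols \<Longrightarrow> integrable M h"
  by (auto simp: symbols_def intro: continuous_integrable symbol_continuous)

lemma dim_pos: "complex_of_nat (cdim (UNIV :: 'h set)) \<noteq> 0"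
proof -
  obtain B where B: "complex_vector.independent B" "(UNIV :: 'h set) \<subseteq> cspan B" "card B = cdim (UNIV :: 'h set)"
    using complex_vector.basis_exists[of "UNIV :: 'h set"] by metis
  obtain B' where B': "finite B'" "cspan B' = (UNIV :: 'h set)" using finite_dim by blast
  have "finite B" using complex_vector.independent_span_bound[OF B'(1) B(1)] B'(2) by auto
  moreover have "B \<noteq> {}"
    using B(2) highest_weight by (auto simp: highest_weight_vector_def)
  ultimately show ?thesis using B(3) by (metis card_0_eq of_nat_eq_0_iff)
qed

text \<open>The integral is conjugate-linear in w, so in finite dimension it is represented by a
  unique vector; this makes the definite description in \<open>toeplitz\<close> meaningful. The
  integrals exist because symbols are continuous on a compact group.\<close>

lemma cinner_toeplitz:
  assumes f: "integrable M f"
  shows "cinner (toeplitz M \<sigma> v0 f v) w =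
    of_nat (cdim (UNIV :: 'h set)) * (\<integral>y. f y * symbol (tensor_conj v w) y \<partial>M)"
proof -
  let ?d = "complex_of_nat (cdim (UNIV :: 'h set))"
  define F where "F w = ?d * (\<integral>y. f y * symbol (tensor_conj v w) y \<partial>M)" for w
  have int: "integrable M (\<lambda>y. f y * symbol (tensor_conj v w) y)" for w
    by (intro integrable_mult_continuous f symbol_continuous tensor_conj_endomorphism)
  have F_sum: "F (\<Sum>b\<in>E. c b *\<^sub>C b) = (\<Sum>b\<in>E. cnj (c b) * F b)" if "finite E" for E c
  proof -
    have "f y * symbol (tensor_conj v (\<Sum>b\<in>E. c b *\<^sub>C b)) y =
        (\<Sum>b\<in>E. cnj (c b) * (f y * symbol (tensor_conj v b) y))" for y
      by (simp add: symbol_tensor cinner_sum_left cinner_scaleC_left sum_distrib_left mult_ac)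
    then have "F (\<Sum>b\<in>E. c b *\<^sub>C b) = ?d * (\<Sum>b\<in>E. cnj (c b) * (\<integral>y. f y * symbol (tensor_conj v b) y \<partial>M))"
      using int by (simp add: F_def)
    then show ?thesis by (simp add: F_def sum_distrib_left mult_ac)
  qed
  obtain E :: "'h set" where E: "corthonormal E" "cspan E = UNIV" using exists_orthonormal_basis by blast
  define u where "u = (\<Sum>b\<in>E. F b *\<^sub>C b)"
  have u: "cinner u w = F w" for w
  proof -
    have "F w = F (\<Sum>b\<in>E. cinner w b *\<^sub>C b)" using corthonormal_expansion[OF E(1)] E(2) by simp
    also have "\<dots> = (\<Sum>b\<in>E. cnj (cinner w b) * F b)" using E(1) by (intro F_sum) (simp add: corthonormal_def)
    finally show ?thesis
      by (simp add: u_def cinner_sum_left cinner_scaleC_left mult.commute flip: cinner_commute)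
  qed
  have "toeplitz M \<sigma> v0 f v = u"
    unfolding toeplitz_def
  proof (rule the_equality)
    show "\<forall>w. cinner u w = ?d * (\<integral>y. f y * cinner v (\<sigma> y v0) * cnj (cinner w (\<sigma> y v0)) \<partial>M)"
      using u by (simp add: F_def symbol_tensor mult.assoc)
    show "u' = u"
      if "\<forall>w. cinner u' w = ?d * (\<integral>y. f y * cinner v (\<sigma> y v0) * cnj (cinner w (\<sigma> y v0)) \<partial>M)" for u'
      by (rule cinner_ext) (use that u in \<open>simp add: F_def symbol_tensor mult.assoc\<close>)
  qed
  then show ?thesis using u by (simp add: F_def)
qed

lemma toeplitz_endomorphism:
  assumes f: "integrable M f"
  shows "toeplitz M \<sigma> v0 f \<in> endomorphisms"
proof -
  have int: "integrable M (\<lambda>y. f y * symbol (tensor_conj v w) y)" for v w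
    by (intro integrable_mult_continuous f symbol_continuous tensor_conj_endomorphism)
  have "toeplitz M \<sigma> v0 f (x + y) = toeplitz M \<sigma> v0 f x + toeplitz M \<sigma> v0 f y" for x y
  proof (rule cinner_ext)
    fix w
    have "f z * symbol (tensor_conj (x + y) w) z =
        f z * symbol (tensor_conj x w) z + f z * symbol (tensor_conj y w) z" for z
      by (simp add: symbol_tensor cinner_add_left algebra_simps)
    then show "cinner (toeplitz M \<sigma> v0 f (x + y)) w =
        cinner (toeplitz M \<sigma> v0 f x + toeplitz M \<sigma> v0 f y) w"
      using int by (simp add: cinner_toeplitz[OF f] cinner_add_left distrib_left)
  qed
  moreover have "toeplitz M \<sigma> v0 f (c *\<^sub>C x) = c *\<^sub>C toeplitz M \<sigma> v0 f x" for c x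
  proof (rule cinner_ext)
    fix w
    have "(\<lambda>z. f z * symbol (tensor_conj (c *\<^sub>C x) w) z) = (\<lambda>z. c * (f z * symbol (tensor_conj x w) z))"
      by (simp add: fun_eq_iff symbol_tensor cinner_scaleC_left mult_ac)
    then show "cinner (toeplitz M \<sigma> v0 f (c *\<^sub>C x)) w = cinner (c *\<^sub>C toeplitz M \<sigma> v0 f x) w"
      by (simp add: cinner_toeplitz[OF f] cinner_scaleC_left)
  qed
  ultimately show ?thesis by (simp add: endomorphisms_iff)
qed

lemma toeplitz_linear:
  assumes f: "integrable M f" and g: "integrable M g"
  shows "toeplitz M \<sigma> v0 (f + g) = toeplitz M \<sigma> v0 f + toeplitz M \<sigma> v0 g"
    "toeplitz M \<sigma> v0 (c *\<^sub>C f) = c *\<^sub>C toeplitz M \<sigma> v0 f"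
proof -
  have int: "integrable M (\<lambda>y. f y * symbol (tensor_conj v w) y)" if "integrable M f" for f v w
    by (intro integrable_mult_continuous that symbol_continuous tensor_conj_endomorphism)
  have fg: "integrable M (f + g)" "integrable M (c *\<^sub>C f)"
    using f g by (simp_all add: plus_fun_def scaleC_fun_def scaleC_complex_def)
  show "toeplitz M \<sigma> v0 (f + g) = toeplitz M \<sigma> v0 f + toeplitz M \<sigma> v0 g"
  proof (rule ext, rule cinner_ext)
    fix v w
    show "cinner (toeplitz M \<sigma> v0 (f + g) v) w = cinner ((toeplitz M \<sigma> v0 f + toeplitz M \<sigma> v0 g) v) w"
      using int[OF f] int[OF g]
      by (simp add: cinner_toeplitz f g fg cinner_add_left distrib_right distrib_left)
  qed
  show "toeplitz M \<sigma> v0 (c *\<^sub>C f) = c *\<^sub>C toeplitz M \<sigma> v0 f"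
  proof (rule ext, rule cinner_ext)
    fix v w
    show "cinner (toeplitz M \<sigma> v0 (c *\<^sub>C f) v) w = cinner ((c *\<^sub>C toeplitz M \<sigma> v0 f) v) w"
      unfolding cinner_toeplitz[OF fg(2)]
      by (simp add: scaleC_fun_def scaleC_complex_def cinner_scaleC_left cinner_toeplitz f mult.assoc)
  qed
qed

text \<open>Matrix coefficients of the Toeplitz operator are, up to the nonzero dimension, integrals
  of f against symbols of rank-one operators. These operators span all endomorphisms, and
  conjugating the symbol of a rank-one operator exchanges its two vectors.\<close>

lemma toeplitz_eq_zero_iff:
  assumes f: "integrable M f"
  shows "toeplitz M \<sigma> v0 f = 0 \<longleftrightarrow> (\<forall>h\<in>symbols. (\<integral>y. f y * cnj (h y) \<partial>M) = 0)"
proof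
  assume T0: "toeplitz M \<sigma> v0 f = 0"
  have 0: "(\<integral>y. f y * symbol (tensor_conj v w) y \<partial>M) = 0" for v w
    using cinner_toeplitz[OF f, of v w] T0 dim_pos by simp
  have int: "integrable M (\<lambda>y. f y * symbol (tensor_conj v w) y)" for v w
    by (intro integrable_mult_continuous f symbol_continuous tensor_conj_endomorphism)
  obtain E :: "'h set" where E: "corthonormal E" "cspan E = UNIV" using exists_orthonormal_basis by blast
  show "\<forall>h\<in>symbols. (\<integral>y. f y * cnj (h y) \<partial>M) = 0"
  proof
    fix h assume "h \<in> symbols"
    then obtain A where A: "A \<in> endomorphisms" "h = symbol A" by (auto simp: symbols_def)
    have "f y * cnj (h y) = (\<Sum>b\<in>E. f y * symbol (tensor_conj b (A b)) y)" for y
    proof -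
      have "symbol A y = (\<Sum>b\<in>E. symbol (tensor_conj (A b) b) y)"
        by (subst endomorphism_expansion[OF E A(1)]) (simp add: symbol_def sum_fun_apply cinner_sum_left)
      then show ?thesis by (simp add: A(2) cnj_symbol_tensor sum_distrib_left)
    qed
    then show "(\<integral>y. f y * cnj (h y) \<partial>M) = 0" using int 0 by simp
  qed
next
  assume h: "\<forall>h\<in>symbols. (\<integral>y. f y * cnj (h y) \<partial>M) = 0"
  show "toeplitz M \<sigma> v0 f = 0"
  proof (rule ext, rule cinner_ext)
    fix v w
    have "symbol (tensor_conj w v) \<in> symbols" using tensor_conj_endomorphism by (auto simp: symbols_def)
    then have "(\<integral>y. f y * cnj (symbol (tensor_conj w v) y) \<partial>M) = 0" using h by blast
    then show "cinner (toeplitz M \<sigma> v0 f v) w = cinner (0 v) w"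
      by (simp add: cinner_toeplitz[OF f] cnj_symbol_tensor)
  qed
qed

text \<open>The open set where h is nonzero is null. If it were nonempty, its translates would cover
  the compact group, finitely many would suffice, and the total mass 1 would be 0. The conclusion
  holds everywhere, which matters since functions agreeing almost everywhere are not
  identified.\<close>

lemma continuous_null_imp_zero:
  fixes h :: "'g \<Rightarrow> complex"
  assumes h: "continuous_on UNIV h" and 0: "(\<integral>y. h y * cnj (h y) \<partial>M) = 0"
  shows "h = 0"
proof (rule ccontr)
  interpret prob_space M by (rule haar_facts)
  assume "h \<noteq> 0"
  define O' where "O' = {y. h y \<noteq> 0}"
  have "O' = h -` (- {0})" by (auto simp: O'_def)
  then have "open O'" using h open_vimage[of "- {0 :: complex}" h] by (simp add: open_Compl)
  obtain z where z: "z \<in> O'" using \<open>h \<noteq> 0\<close> by (auto simp: O'_def fun_eq_iff)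
  have int: "integrable M (\<lambda>y. (cmod (h y))\<^sup>2)"
    by (intro continuous_integrable continuous_intros h)
  have "(\<integral>y. complex_of_real ((cmod (h y))\<^sup>2) \<partial>M) = 0" using 0 by (simp only: complex_norm_square)
  then have "(\<integral>y. (cmod (h y))\<^sup>2 \<partial>M) = 0" by (simp only: integral_complex_of_real of_real_eq_0_iff)
  then have "AE y in M. (cmod (h y))\<^sup>2 = 0"
    using integral_nonneg_eq_0_iff_AE[OF int] by simp
  then have "AE y in M. y \<notin> O'" by (simp add: O'_def)
  then have null: "emeasure M O' = 0"
    using \<open>open O'\<close> haar_facts(2,4) by (subst (asm) AE_iff_measurable[of O']) auto
  have tr: "emeasure M ((\<lambda>x. g \<otimes> x) -` O') = 0 \<and> open ((\<lambda>x. g \<otimes> x) -` O')" for g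
  proof
    have cont: "continuous_on UNIV (\<lambda>x. g \<otimes> x)"
      unfolding continuous_on_def by (auto intro!: tendsto_mult_group tendsto_ident_at)
    have meas: "(\<lambda>x. g \<otimes> x) \<in> measurable M M"
      using borel_measurable_continuous_onI[OF cont] haar_facts(2) measurable_cong_sets by blast
    show "open ((\<lambda>x. g \<otimes> x) -` O')" using open_vimage[OF \<open>open O'\<close> cont] .
    have "emeasure M ((\<lambda>x. g \<otimes> x) -` O') = emeasure (distr M M (\<lambda>x. g \<otimes> x)) O'"
      using \<open>open O'\<close> haar_facts(2,4) by (subst emeasure_distr[OF meas]) auto
    then show "emeasure M ((\<lambda>x. g \<otimes> x) -` O') = 0" using null haar_facts(3) by simp
  qed
  have "UNIV \<subseteq> (\<Union>g\<in>UNIV. (\<lambda>x. g \<otimes> x) -` O')"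
  proof
    fix x
    have "(z \<otimes> inv x) \<otimes> x = z" by (simp add: m_assoc)
    then show "x \<in> (\<Union>g\<in>UNIV. (\<lambda>x. g \<otimes> x) -` O')" using z by (intro UN_I[of "z \<otimes> inv x"]) auto
  qed
  then obtain D where D: "finite D" "UNIV \<subseteq> (\<Union>g\<in>D. (\<lambda>x. g \<otimes> x) -` O')"
    using compactE_image[OF compact_group, of UNIV "\<lambda>g. (\<lambda>x. g \<otimes> x) -` O'"] tr by metis
  have "(\<Union>g\<in>D. (\<lambda>x. g \<otimes> x) -` O') \<in> null_sets M"
    using D(1) tr haar_facts(2) by (intro null_sets.finite_UN) (auto simp: null_sets_def)
  then have "UNIV \<in> null_sets M" using D(2) by (simp add: top.extremum_unique)
  then show False using emeasure_space_1 haar_facts(4) by (simp add: null_sets_def)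
qed

text \<open>The symbol of A is itself a test function in \<open>toeplitz_eq_zero_iff\<close>, so the
  integral of its squared modulus vanishes.\<close>

lemma toeplitz_symbol_eq_zero:
  assumes A: "A \<in> endomorphisms" and T0: "toeplitz M \<sigma> v0 (symbol A) = 0"
  shows "A = 0"
proof -
  have sA: "symbol A \<in> symbols" using A by (simp add: symbols_def)
  then have "(\<integral>y. symbol A y * cnj (symbol A y) \<partial>M) = 0"
    using T0 toeplitz_eq_zero_iff[OF symbol_integrable[OF sA]] by blast
  then have "symbol A = 0" by (rule continuous_null_imp_zero[OF symbol_continuous[OF A]])
  then have "cinner (A (\<sigma> y v0)) (\<sigma> y v0) = 0" for y by (simp add: symbol_def fun_eq_iff)
  then have "A u = 0" for u
    using A by (intro symbol_zero_imp_zero) (simp_all add: endomorphisms_def)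
  then show ?thesis by (simp add: fun_eq_iff)
qed

text \<open>\<Theta> is an injective linear map of the endomorphisms into themselves, so it is onto
  by dimension. The count is done with an explicit basis A0, since the endomorphisms are a
  finite-dimensional subspace of the space of all functions.\<close>

lemma toeplitz_bij_symbols: "bij_betw (toeplitz M \<sigma> v0) symbols endomorphisms"
proof -
  define \<Theta> where "\<Theta> A = toeplitz M \<sigma> v0 (symbol A)" for A
  have sym: "integrable M (symbol A)" if "A \<in> endomorphisms" for A
    using that symbol_integrable by (auto simp: symbols_def)
  have \<Theta>_End: "\<Theta> A \<in> endomorphisms" if "A \<in> endomorphisms" for A
    unfolding \<Theta>_def by (rule toeplitz_endomorphism[OF sym[OF that]])
  have \<Theta>_add: "\<Theta> (A + B) = \<Theta> A + \<Theta> B" if "A \<in> endomorphisms" "B \<in> endomorphisms" for A B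
    unfolding \<Theta>_def symbol_add by (rule toeplitz_linear(1)[OF sym sym]) fact+
  have \<Theta>_scale: "\<Theta> (c *\<^sub>C A) = c *\<^sub>C \<Theta> A" if "A \<in> endomorphisms" for A c
    unfolding \<Theta>_def symbol_scaleC by (rule toeplitz_linear(2)[OF sym sym]) fact+
  note End = endomorphisms_csubspace
  have \<Theta>_zero: "A = 0" if "A \<in> endomorphisms" "\<Theta> A = 0" for A
    using toeplitz_symbol_eq_zero that by (simp add: \<Theta>_def)
  have \<Theta>_0: "\<Theta> 0 = 0" using \<Theta>_scale[OF complex_vector.subspace_0[OF End], of 0] by simp
  have \<Theta>_inj: "A = B" if "A \<in> endomorphisms" "B \<in> endomorphisms" "\<Theta> A = \<Theta> B" for A B
  proof -
    have "\<Theta> (A + (- 1) *\<^sub>C B) = \<Theta> A + \<Theta> ((- 1) *\<^sub>C B)"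
      by (rule \<Theta>_add[OF that(1) complex_vector.subspace_scale[OF End that(2)]])
    also have "\<Theta> ((- 1) *\<^sub>C B) = (- 1) *\<^sub>C \<Theta> B" by (rule \<Theta>_scale[OF that(2)])
    finally have "\<Theta> (A + (- 1) *\<^sub>C B) = \<Theta> A + (- 1) *\<^sub>C \<Theta> B" .
    moreover have "\<Theta> A + (- 1) *\<^sub>C \<Theta> B = 0" using that(3) by simp
    ultimately have "\<Theta> (A + (- 1) *\<^sub>C B) = 0" by (simp only:)
    then have "A + (- 1) *\<^sub>C B = 0"
      by (rule \<Theta>_zero[OF complex_vector.subspace_add[OF End that(1) complex_vector.subspace_scale[OF End that(2)]]])
    then show ?thesis by simp
  qed
  obtain E :: "'h set" where E: "corthonormal E" "cspan E = UNIV" using exists_orthonormal_basis by blast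
  define T0 where "T0 = (\<lambda>(a, b). tensor_conj a b) ` (E \<times> E)"
  have finT0: "finite T0" using E(1) by (simp add: T0_def corthonormal_def)
  have End_span: "endomorphisms \<subseteq> cspan T0"
  proof
    fix A :: "'h \<Rightarrow> 'h" assume A: "A \<in> endomorphisms"
    have expn: "tensor_conj x b = (\<Sum>a\<in>E. cinner x a *\<^sub>C tensor_conj a b)" for x b
    proof
      fix u
      have "tensor_conj x b u = cinner u b *\<^sub>C (\<Sum>a\<in>E. cinner x a *\<^sub>C a)"
        using corthonormal_expansion[OF E(1)] E(2) by (simp add: tensor_conj_def)
      then show "tensor_conj x b u = (\<Sum>a\<in>E. cinner x a *\<^sub>C tensor_conj a b) u"
        by (simp add: sum_fun_apply scaleC_fun_def tensor_conj_def complex_vector.scale_sum_right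
            scaleC_scaleC mult.commute)
    qed
    have "tensor_conj a b \<in> cspan T0" if "a \<in> E" "b \<in> E" for a b
      using that by (intro complex_vector.span_base) (auto simp: T0_def)
    then have "tensor_conj x b \<in> cspan T0" if "b \<in> E" for x b
      using that by (subst expn) (intro complex_vector.span_sum complex_vector.span_scale)
    then show "A \<in> cspan T0"
      by (subst endomorphism_expansion[OF E A]) (intro complex_vector.span_sum)
  qed
  obtain A0 where A0: "A0 \<subseteq> (endomorphisms :: ('h \<Rightarrow> 'h) set)" "complex_vector.independent A0" "endomorphisms \<subseteq> cspan A0"
    by (rule complex_vector.maximal_independent_subset)
  have finA0: "finite A0"
    using complex_vector.independent_span_bound[OF finT0 A0(2)] A0(1) End_span by blast
  have inj: "inj_on \<Theta> A0" using \<Theta>_inj A0(1) by (auto simp: inj_on_def)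
  have \<Theta>_sum: "\<Theta> (\<Sum>a\<in>S. u a *\<^sub>C a) = (\<Sum>a\<in>S. u a *\<^sub>C \<Theta> a) \<and> (\<Sum>a\<in>S. u a *\<^sub>C a) \<in> endomorphisms"
    if "S \<subseteq> A0" for S u
    using finite_subset[OF that finA0] that
  proof (induction S rule: finite_induct)
    case empty
    show ?case using \<Theta>_0 complex_vector.subspace_0[OF End] by (simp only: sum.empty)
  next
    case (insert x F)
    let ?s = "\<Sum>a\<in>F. u a *\<^sub>C a"
    have x: "x \<in> endomorphisms" and s: "\<Theta> ?s = (\<Sum>a\<in>F. u a *\<^sub>C \<Theta> a)" "?s \<in> endomorphisms"
      using insert A0(1) by auto
    have ux: "u x *\<^sub>C x \<in> endomorphisms" by (rule complex_vector.subspace_scale[OF End x])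
    show ?case
      using \<Theta>_add[OF ux s(2)] \<Theta>_scale[OF x] complex_vector.subspace_add[OF End ux s(2)]
      unfolding sum.insert[OF insert(1,2)] s(1) by metis
  qed
  have indep: "complex_vector.independent (\<Theta> ` A0)"
  proof
    assume "complex_vector.dependent (\<Theta> ` A0)"
    then have "\<exists>u. (\<exists>v\<in>\<Theta> ` A0. u v \<noteq> 0) \<and> (\<Sum>v\<in>\<Theta> ` A0. u v *\<^sub>C v) = 0"
      by (simp only: complex_vector.dependent_finite[OF finite_imageI[OF finA0]])
    then obtain u where "(\<exists>v\<in>\<Theta> ` A0. u v \<noteq> 0) \<and> (\<Sum>v\<in>\<Theta> ` A0. u v *\<^sub>C v) = 0" by (rule exE)
    then have u: "\<exists>v\<in>\<Theta> ` A0. u v \<noteq> 0" "(\<Sum>v\<in>\<Theta> ` A0. u v *\<^sub>C v) = 0" by (rule conjunct1, rule conjunct2)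
    have "(\<Sum>a\<in>A0. u (\<Theta> a) *\<^sub>C \<Theta> a) = 0" using u(2) unfolding sum.reindex[OF inj] o_def .
    then have "\<Theta> (\<Sum>a\<in>A0. u (\<Theta> a) *\<^sub>C a) = 0"
      using \<Theta>_sum[OF order_refl, of "\<lambda>a. u (\<Theta> a)"] by metis
    then have "(\<Sum>a\<in>A0. u (\<Theta> a) *\<^sub>C a) = 0"
      using \<Theta>_sum[OF order_refl, of "\<lambda>a. u (\<Theta> a)"] \<Theta>_zero by blast
    moreover obtain a where "a \<in> A0" "u (\<Theta> a) \<noteq> 0" using u(1) by blast
    ultimately have "complex_vector.dependent A0"
      unfolding complex_vector.dependent_finite[OF finA0] by (intro exI[of _ "\<lambda>a. u (\<Theta> a)"]) blast
    then show False using A0(2) by blast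
  qed
  have surj: "B \<in> \<Theta> ` endomorphisms" if B: "B \<in> endomorphisms" for B
  proof -
    have "B \<in> cspan (\<Theta> ` A0)"
    proof (rule ccontr)
      \<comment> \<open>Adding B to the independent image of A0 would give one more independent
        endomorphism than the spanning set A0 allows.\<close>
      assume no: "B \<notin> cspan (\<Theta> ` A0)"
      have "complex_vector.independent (insert B (\<Theta> ` A0))"
        by (rule complex_vector.independent_insertI[OF no indep])
      moreover have "insert B (\<Theta> ` A0) \<subseteq> cspan A0" using B \<Theta>_End A0(1,3) by blast
      ultimately have "card (insert B (\<Theta> ` A0)) \<le> card A0"
        using complex_vector.independent_span_bound[OF finA0] by blast
      moreover have "B \<notin> \<Theta> ` A0" using no complex_vector.span_base[of B] by metis
      ultimately show False using finA0 card_image[OF inj] by simp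
    qed
    then obtain u where "B = (\<Sum>v\<in>\<Theta> ` A0. u v *\<^sub>C v)"
      unfolding complex_vector.span_finite[OF finite_imageI[OF finA0]] by (rule rangeE)
    then have "B = (\<Sum>a\<in>A0. u (\<Theta> a) *\<^sub>C \<Theta> a)" unfolding sum.reindex[OF inj] o_def .
    then have "B = \<Theta> (\<Sum>a\<in>A0. u (\<Theta> a) *\<^sub>C a)"
      using \<Theta>_sum[OF order_refl, of "\<lambda>a. u (\<Theta> a)"] by metis
    then show ?thesis using \<Theta>_sum[OF order_refl, of "\<lambda>a. u (\<Theta> a)"] by blast
  qed
  show ?thesis
    unfolding bij_betw_def symbols_def
  proof
    show "inj_on (toeplitz M \<sigma> v0) (symbol ` endomorphisms)"
      using \<Theta>_inj by (auto simp: inj_on_def \<Theta>_def)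
    show "toeplitz M \<sigma> v0 ` symbol ` endomorphisms = endomorphisms"
      using \<Theta>_End surj by (auto simp: \<Theta>_def image_image)
  qed
qed

text \<open>Decomposing the orbit of the rank-one operator of v0 and using the orthogonality of the
  copies, the symbol of \<open>J i k u\<close> is the single coefficient of u against the orbit of
  the component \<open>c i k\<close>. These coefficients generate the space K; and as the images of
  the \<open>J i k\<close> sum to all endomorphisms, they also generate all symbols.\<close>

lemma K_space_eq_symbols:
  assumes dec: "orthogonal_decomposition G \<sigma> I W \<pi> m J"
    and comp: "is_components I W m J (tensor_conj v0 v0) c"
  shows "K_space I W \<pi> m c = symbols"
proof -
  define X where "X = Sigma I (\<lambda>i. {1..m i})"
  have finI: "finite I" using dec by (simp add: orthogonal_decomposition_def)
  then have finX: "finite X" by (simp add: X_def)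
  have irr: "irreducible_unitary_rep G (W i) (\<pi> i)" if "i \<in> I" for i
    using dec that by (simp add: orthogonal_decomposition_def)
  have J: "J i k u \<in> endomorphisms" "hs_inner (J i k u) (J i k v) = cinner u v"
      "J i k (\<pi> i g u) = tensor_conj_rep G \<sigma> g (J i k u)"
    if "(i, k) \<in> X" "u \<in> W i" "v \<in> W i" for i k u v g
  proof -
    have "\<forall>i\<in>I. \<forall>k\<in>{1..m i}. clinear_on (W i) (J i k) \<and> J i k ` W i \<subseteq> endomorphisms \<and>
        (\<forall>u\<in>W i. \<forall>v\<in>W i. hs_inner (J i k u) (J i k v) = cinner u v) \<and>
        (\<forall>g. \<forall>u\<in>W i. J i k (\<pi> i g u) = tensor_conj_rep G \<sigma> g (J i k u))"
      using dec unfolding orthogonal_decomposition_def by (elim conjE)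
    then have "J i k ` W i \<subseteq> endomorphisms" "\<forall>u\<in>W i. \<forall>v\<in>W i. hs_inner (J i k u) (J i k v) = cinner u v"
        "\<forall>g. \<forall>u\<in>W i. J i k (\<pi> i g u) = tensor_conj_rep G \<sigma> g (J i k u)"
      using that(1) unfolding X_def by auto
    then show "J i k u \<in> endomorphisms" "hs_inner (J i k u) (J i k v) = cinner u v"
      "J i k (\<pi> i g u) = tensor_conj_rep G \<sigma> g (J i k u)" using that by auto
  qed
  have J0: "hs_inner (J i k u) (J j l v) = 0"
    if "(i, k) \<in> X" "(j, l) \<in> X" "(i, k) \<noteq> (j, l)" "u \<in> W i" "v \<in> W j" for i k j l u v
  proof -
    have "\<forall>i\<in>I. \<forall>k\<in>{1..m i}. \<forall>j\<in>I. \<forall>l\<in>{1..m j}. (i, k) \<noteq> (j, l) \<longrightarrow>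
        (\<forall>u\<in>W i. \<forall>v\<in>W j. hs_inner (J i k u) (J j l v) = 0)"
      using dec unfolding orthogonal_decomposition_def by (elim conjE)
    then show ?thesis using that unfolding X_def by auto
  qed
  have W: "\<pi> i g (u + v) = \<pi> i g u + \<pi> i g v" "\<pi> i g (a *\<^sub>C u) = a *\<^sub>C \<pi> i g u" "\<pi> i g u \<in> W i"
    if "i \<in> I" "u \<in> W i" "v \<in> W i" for i g u v a
    using irr[OF that(1)] that(2,3) by (auto simp: irreducible_unitary_rep_def unitary_rep_def clinear_on_def)
  have Wsub: "csubspace (W i)" if "i \<in> I" for i
    using irr[OF that] by (auto simp: irreducible_unitary_rep_def unitary_rep_def complex_vector.subspace_span)
  have c: "c i k \<in> W i" if "(i, k) \<in> X" for i k
    using comp that by (auto simp: is_components_def X_def)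
  have sumX: "(\<Sum>i\<in>I. \<Sum>k\<in>{1..m i}. F i k) = (\<Sum>(i, k)\<in>X. F i k)" for F :: "_ \<Rightarrow> nat \<Rightarrow> 'h \<Rightarrow> 'h"
    unfolding X_def using finI by (intro sum.Sigma) auto
  have orbit: "tensor_conj (\<sigma> y v0) (\<sigma> y v0) = (\<Sum>(i, k)\<in>X. J i k (\<pi> i y (c i k)))" for y
  proof -
    have "tensor_conj v0 v0 = (\<Sum>(i, k)\<in>X. J i k (c i k))"
      using comp unfolding is_components_def sumX by blast
    then have "tensor_conj (\<sigma> y v0) (\<sigma> y v0) = (\<Sum>x\<in>X. tensor_conj_rep G \<sigma> y (case x of (i, k) \<Rightarrow> J i k (c i k)))"
      by (simp add: tensor_conj_rep_sum flip: tensor_conj_rep_tensor)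
    also have "\<dots> = (\<Sum>(i, k)\<in>X. J i k (\<pi> i y (c i k)))"
      by (intro sum.cong) (auto simp: J(3)[OF _ c c])
    finally show ?thesis .
  qed
  have symbol_eq: "symbol A y = (\<Sum>(i, k)\<in>X. hs_inner A (J i k (\<pi> i y (c i k))))"
    if "A \<in> endomorphisms" for A y
    unfolding symbol_def hs_inner_tensor[OF that, symmetric] orbit hs_inner_sum_right
    by (simp add: case_prod_unfold)
  have single: "symbol (J i k u) = (\<lambda>y. cinner u (\<pi> i y (c i k)))" if ik: "(i, k) \<in> X" and u: "u \<in> W i" for i k u
  proof
    fix y
    have iI: "i \<in> I" using ik by (simp add: X_def)
    have "symbol (J i k u) y = (\<Sum>x\<in>X. if x = (i, k) then cinner u (\<pi> i y (c i k)) else 0)"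
      unfolding symbol_eq[OF J(1)[OF ik u u]]
    proof (intro sum.cong refl)
      fix x assume x: "x \<in> X"
      obtain j l where jl: "x = (j, l)" by (cases x)
      have "j \<in> I" using x jl by (simp add: X_def)
      then have "\<pi> j y (c j l) \<in> W j" using W(3) c x jl by blast
      then show "(case x of (j, l) \<Rightarrow> hs_inner (J i k u) (J j l (\<pi> j y (c j l)))) =
          (if x = (i, k) then cinner u (\<pi> i y (c i k)) else 0)"
        using x jl J(2)[OF ik u] J0[OF ik _ _ u] by auto
    qed
    then show "symbol (J i k u) y = cinner u (\<pi> i y (c i k))" using finX ik by simp
  qed
  show ?thesis
  proof
    show "K_space I W \<pi> m c \<subseteq> symbols"
      unfolding K_space_def
    proof (rule complex_vector.span_minimal[OF _ symbols_csubspace], clarify)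
      fix i u v' assume i: "i \<in> I" and u: "u \<in> W i" and v': "v' \<in> K_component m c i"
      \<comment> \<open>The coefficient is conjugate-linear in v', which still makes Q a complex
        subspace; membership in \<open>W i\<close> is included because \<pi> is known to be linear
        only there.\<close>
      define Q where "Q = {v' \<in> W i. (\<lambda>x. cinner u (\<pi> i x v')) \<in> symbols}"
      have "csubspace Q"
        unfolding complex_vector.subspace_def
      proof (intro conjI ballI allI)
        have "0 \<in> W i" by (rule complex_vector.subspace_0[OF Wsub[OF i]])
        moreover have "\<pi> i x 0 = 0" for x using W(2)[OF i calculation calculation, of x 0] by simp
        ultimately show "0 \<in> Q"
          using complex_vector.subspace_0[OF symbols_csubspace] by (simp add: Q_def zero_fun_def)
        show "x + y \<in> Q" if "x \<in> Q" "y \<in> Q" for x y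
          using that complex_vector.subspace_add[OF symbols_csubspace, of "\<lambda>z. cinner u (\<pi> i z x)" "\<lambda>z. cinner u (\<pi> i z y)"]
            complex_vector.subspace_add[OF Wsub[OF i]]
          by (auto simp: Q_def W i cinner_add_right plus_fun_def)
        show "a *\<^sub>C x \<in> Q" if "x \<in> Q" for a x
          using that complex_vector.subspace_scale[OF symbols_csubspace, of "\<lambda>z. cinner u (\<pi> i z x)" "cnj a"]
            complex_vector.subspace_scale[OF Wsub[OF i]]
          by (auto simp: Q_def W i cinner_scaleC_right scaleC_fun_def scaleC_complex_def)
      qed
      moreover have "{c i k |k. k \<in> {1..m i}} \<subseteq> Q"
      proof clarify
        fix k assume "k \<in> {1..m i}"
        then have ik: "(i, k) \<in> X" using i by (simp add: X_def)
        show "c i k \<in> Q"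
          using single[OF ik u] J(1)[OF ik u u] c[OF ik] by (auto simp: Q_def symbols_def image_iff intro!: bexI[of _ "J i k u"])
      qed
      ultimately have "K_component m c i \<subseteq> Q"
        unfolding K_component_def by (intro complex_vector.span_minimal)
      then show "(\<lambda>x. cinner u (\<pi> i x v')) \<in> symbols" using v' by (auto simp: Q_def)
    qed
    show "symbols \<subseteq> K_space I W \<pi> m c"
    proof
      fix h assume "h \<in> symbols"
      then obtain A where A: "A \<in> endomorphisms" "h = symbol A" by (auto simp: symbols_def)
      obtain a where "is_components I W m J A a"
        using dec A(1) by (auto simp: orthogonal_decomposition_def)
      then have "\<forall>i\<in>I. \<forall>k\<in>{1..m i}. a i k \<in> W i" and a2: "A = (\<Sum>(i, k)\<in>X. J i k (a i k))"
        unfolding is_components_def sumX by blast+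
      then have a1: "a i k \<in> W i" if "(i, k) \<in> X" for i k using that by (auto simp: X_def)
      note a = a1 a2
      have "h = (\<Sum>x\<in>X. symbol (case x of (i, k) \<Rightarrow> J i k (a i k)))"
        unfolding A(2) a(2) by (simp add: fun_eq_iff symbol_def sum_fun_apply cinner_sum_left)
      also have "\<dots> = (\<Sum>(i, k)\<in>X. (\<lambda>y. cinner (a i k) (\<pi> i y (c i k))))"
        using single a(1) by (intro sum.cong) auto
      also have "\<dots> \<in> K_space I W \<pi> m c"
        unfolding K_space_def
      proof (rule complex_vector.span_sum)
        fix x assume x: "x \<in> X"
        obtain i k where ik: "x = (i, k)" by (cases x)
        have "c i k \<in> K_component m c i"
          using x ik unfolding K_component_def by (intro complex_vector.span_base) (auto simp: X_def)
        then show "(case x of (i, k) \<Rightarrow> \<lambda>y. cinner (a i k) (\<pi> i y (c i k))) \<in>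
            cspan {(\<lambda>x. cinner u (\<pi> i x v\<^sub>0)) |i u v\<^sub>0. i \<in> I \<and> u \<in> W i \<and> v\<^sub>0 \<in> K_component m c i}"
        proof -
          assume *: "c i k \<in> K_component m c i"
          have "i \<in> I" "a i k \<in> W i" using x ik a(1) by (auto simp: X_def)
          with * show ?thesis unfolding ik prod.case by (intro complex_vector.span_base) blast
        qed
      qed
      finally show "h \<in> K_space I W \<pi> m c" .
    qed
  qed
qed

end

text \<open>The base chart is translated so that the identity gets coordinate 0. The product read in
  this one chart is twice continuously differentiable on the relatively open set S, so
  \<open>second_difference_bound\<close> at the pair (a, a) yields R and C; the same R keeps
  products inside U.\<close>

lemma lie_group_chart:
  fixes G :: "('g::{t2_space, second_countable_topology}, 'e::euclidean_space) lie_group_data"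
  assumes G: "lie_group G"
  obtains U R C a where "group_chart G (model G) U (\<lambda>g. base_chart G g - a) R C"
proof -
  note lie = G[unfolded lie_group_def]
  have grp: "group G" and carrier: "carrier G = UNIV" and V: "subspace (model G)"
    and cover: "\<Union> (fst ` charts G) = UNIV"
    and cmult: "continuous_on UNIV (\<lambda>(x, y). x \<otimes>\<^bsub>G\<^esub> y)"
    and cinv: "continuous_on UNIV (\<lambda>x. inv\<^bsub>G\<^esub> x)"
    using lie by blast+
  interpret group G by (rule grp)
  define \<phi> where "\<phi> = base_chart G"
  have "\<one>\<^bsub>G\<^esub> \<in> \<Union> (fst ` charts G)" using cover by simp
  then have "\<exists>\<phi> U. (U, \<phi>) \<in> charts G \<and> \<one>\<^bsub>G\<^esub> \<in> U" by force
  then have "\<exists>U. (U, \<phi>) \<in> charts G \<and> \<one>\<^bsub>G\<^esub> \<in> U"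
    unfolding \<phi>_def base_chart_def by (rule someI_ex)
  then obtain U where U: "(U, \<phi>) \<in> charts G" "\<one>\<^bsub>G\<^esub> \<in> U" by blast
  let ?V = "model G" and ?\<chi> = "inv_into U \<phi>"
  have "is_chart G U \<phi>" using lie U(1) by blast
  then have oU: "open U" and o\<phi>: "openin (top_of_set ?V) (\<phi> ` U)" and hom: "homeomorphism U (\<phi> ` U) \<phi> ?\<chi>"
    by (auto simp: is_chart_def)
  define a where "a = \<phi> \<one>\<^bsub>G\<^esub>"
  define S where "S = {(x, y). x \<in> \<phi> ` U \<and> y \<in> \<phi> ` U \<and> ?\<chi> x \<otimes>\<^bsub>G\<^esub> ?\<chi> y \<in> U}"
  define f where "f = (\<lambda>(x, y). \<phi> (?\<chi> x \<otimes>\<^bsub>G\<^esub> ?\<chi> y))"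
  have "\<forall>(U, \<phi>)\<in>charts G. \<forall>(U', \<phi>')\<in>charts G. \<forall>(U'', \<psi>)\<in>charts G.
        smooth_on (model G \<times> model G)
          {(x, y). x \<in> \<phi> ` U \<and> y \<in> \<phi>' ` U' \<and> inv_into U \<phi> x \<otimes>\<^bsub>G\<^esub> inv_into U' \<phi>' y \<in> U''}
          (\<lambda>(x, y). \<psi> (inv_into U \<phi> x \<otimes>\<^bsub>G\<^esub> inv_into U' \<phi>' y))"
    using lie by (elim conjE)
  from bspec[OF this U(1)] have "\<forall>(U', \<phi>')\<in>charts G. \<forall>(U'', \<psi>)\<in>charts G.
        smooth_on (model G \<times> model G)
          {(x, y). x \<in> \<phi> ` U \<and> y \<in> \<phi>' ` U' \<and> inv_into U \<phi> x \<otimes>\<^bsub>G\<^esub> inv_into U' \<phi>' y \<in> U''}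
          (\<lambda>(x, y). \<psi> (inv_into U \<phi> x \<otimes>\<^bsub>G\<^esub> inv_into U' \<phi>' y))" by (simp only: prod.case)
  from bspec[OF this U(1)] have "\<forall>(U'', \<psi>)\<in>charts G.
        smooth_on (model G \<times> model G)
          {(x, y). x \<in> \<phi> ` U \<and> y \<in> \<phi> ` U \<and> inv_into U \<phi> x \<otimes>\<^bsub>G\<^esub> inv_into U \<phi> y \<in> U''}
          (\<lambda>(x, y). \<psi> (inv_into U \<phi> x \<otimes>\<^bsub>G\<^esub> inv_into U \<phi> y))" by (simp only: prod.case)
  from bspec[OF this U(1)] have "smooth_on (?V \<times> ?V) S f" by (simp only: prod.case S_def f_def)
  then have C2: "C_on 2 (?V \<times> ?V) S f" by (simp add: smooth_on_def)
  have \<chi>: "?\<chi> (\<phi> g) = g" if "g \<in> U" for g using hom that by (simp add: homeomorphism_def)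
  have \<phi>\<chi>: "\<phi> (?\<chi> z) = z" "?\<chi> z \<in> U" if "z \<in> \<phi> ` U" for z using that \<chi> by auto
  have aU: "a \<in> \<phi> ` U" and \<chi>a: "?\<chi> a = \<one>\<^bsub>G\<^esub>" using U(2) \<chi> by (auto simp: a_def)
  have \<phi>V: "\<phi> ` U \<subseteq> ?V" by (rule openin_imp_subset[OF o\<phi>])
  have cont\<chi>: "continuous_on (\<phi> ` U) ?\<chi>" using hom by (simp add: homeomorphism_def)
  have "openin (top_of_set (?V \<times> ?V)) S"
  proof -
    have "continuous_on (\<phi> ` U \<times> \<phi> ` U) (\<lambda>z. (?\<chi> (fst z), ?\<chi> (snd z)))"
      by (intro continuous_on_Pair continuous_on_compose2[OF cont\<chi>] continuous_on_fst
          continuous_on_snd continuous_on_id) auto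
    from continuous_on_compose2[OF cmult this]
    have "continuous_on (\<phi> ` U \<times> \<phi> ` U) (\<lambda>z. ?\<chi> (fst z) \<otimes>\<^bsub>G\<^esub> ?\<chi> (snd z))" by simp
    from continuous_openin_preimage_gen[OF this oU]
    have "openin (top_of_set (\<phi> ` U \<times> \<phi> ` U)) S"
      by (rule back_subst[where P = "openin (top_of_set (\<phi> ` U \<times> \<phi> ` U))"]) (auto simp: S_def)
    moreover have "openin (top_of_set (?V \<times> ?V)) (\<phi> ` U \<times> \<phi> ` U)" by (rule openin_Times[OF o\<phi> o\<phi>])
    ultimately show ?thesis by (rule openin_trans)
  qed
  moreover have "(a, a) \<in> S" using aU U(2) by (simp add: S_def \<chi>a carrier)
  ultimately have "\<exists>R C. R > 0 \<and> C \<ge> 0 \<and> (cball a R \<inter> ?V) \<times> (cball a R \<inter> ?V) \<subseteq> S \<and>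
    (\<forall>x\<in>cball a R \<inter> ?V. \<forall>x'\<in>cball a R \<inter> ?V. \<forall>y\<in>cball a R \<inter> ?V. \<forall>y'\<in>cball a R \<inter> ?V.
       norm (f (x, y) - f (x', y) - f (x, y') + f (x', y')) \<le> C * norm (x - x') * norm (y - y'))"
    by (rule second_difference_bound[OF V _ _ C2]) blast
  then obtain R C where "R > 0 \<and> C \<ge> 0 \<and> (cball a R \<inter> ?V) \<times> (cball a R \<inter> ?V) \<subseteq> S \<and>
    (\<forall>x\<in>cball a R \<inter> ?V. \<forall>x'\<in>cball a R \<inter> ?V. \<forall>y\<in>cball a R \<inter> ?V. \<forall>y'\<in>cball a R \<inter> ?V.
       norm (f (x, y) - f (x', y) - f (x, y') + f (x', y')) \<le> C * norm (x - x') * norm (y - y'))"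
    by (elim exE)
  note RC = this[THEN conjunct1]
    this[THEN conjunct2, THEN conjunct1]
    this[THEN conjunct2, THEN conjunct2, THEN conjunct1]
    this[THEN conjunct2, THEN conjunct2, THEN conjunct2]
  let ?\<psi> = "\<lambda>g. \<phi> g - a"
  have inj: "inj_on ?\<psi> U"
  proof (rule inj_onI)
    fix g h assume gh: "g \<in> U" "h \<in> U" "?\<psi> g = ?\<psi> h"
    then have "\<phi> g = \<phi> h" by simp
    then have "?\<chi> (\<phi> g) = ?\<chi> (\<phi> h)" by (rule arg_cong)
    then show "g = h" unfolding \<chi>[OF gh(1)] \<chi>[OF gh(2)] .
  qed
  have \<xi>: "inv_into U ?\<psi> z = ?\<chi> (z + a)" if "z \<in> ?\<psi> ` U" for z
    using that inv_into_f_f[OF inj] \<chi> by auto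
  have ball: "\<phi> g \<in> cball a R \<inter> ?V" if "g \<in> U" "norm (?\<psi> g) \<le> R" for g
    using that \<phi>V by (auto simp: dist_norm norm_minus_commute)
  have prod: "g \<otimes>\<^bsub>G\<^esub> h \<in> U" "f (\<phi> g, \<phi> h) = \<phi> (g \<otimes>\<^bsub>G\<^esub> h)"
    if "g \<in> U" "h \<in> U" "norm (?\<psi> g) \<le> R" "norm (?\<psi> h) \<le> R" for g h
  proof -
    have "(\<phi> g, \<phi> h) \<in> S" using RC(3) ball that by blast
    then show "g \<otimes>\<^bsub>G\<^esub> h \<in> U" using \<chi> that by (simp add: S_def)
    show "f (\<phi> g, \<phi> h) = \<phi> (g \<otimes>\<^bsub>G\<^esub> h)" using \<chi> that by (simp add: f_def)
  qed
  have "group_chart G ?V U ?\<psi> R C"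
  proof (unfold_locales)
    show "homeomorphism U (?\<psi> ` U) ?\<psi> (inv_into U ?\<psi>)"
    proof (rule homeomorphismI)
      have "continuous_on U \<phi>" using hom by (simp add: homeomorphism_def)
      then show "continuous_on U ?\<psi>" by (intro continuous_intros)
      have "continuous_on (?\<psi> ` U) (\<lambda>z. ?\<chi> (z + a))"
        by (rule continuous_on_compose2[OF cont\<chi>]) (auto intro!: continuous_intros)
      then show "continuous_on (?\<psi> ` U) (inv_into U ?\<psi>)"
        by (rule continuous_on_eq) (simp add: \<xi>)
    qed (auto simp: inv_into_f_f[OF inj])
    show "?\<psi> g \<in> ?V" if "g \<in> U" for g
      using \<phi>V that aU subspace_diff[OF V] by blast
    show "cball 0 R \<inter> ?V \<subseteq> ?\<psi> ` U"
    proof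
      fix z assume z: "z \<in> cball 0 R \<inter> ?V"
      have "a + z \<in> cball a R \<inter> ?V" using z aU \<phi>V subspace_add[OF V] by (auto simp: dist_norm)
      then have "(a + z, a + z) \<in> S" using RC(3) by blast
      then obtain g where "g \<in> U" "a + z = \<phi> g" by (auto simp: S_def)
      then have "z = ?\<psi> g" by (metis add_diff_cancel_left')
      with \<open>g \<in> U\<close> show "z \<in> ?\<psi> ` U" by blast
    qed
    show "g \<otimes>\<^bsub>G\<^esub> h \<in> U" if "g \<in> U" "h \<in> U" "norm (?\<psi> g) \<le> R" "norm (?\<psi> h) \<le> R" for g h
      using prod that by blast
    show "norm (?\<psi> (g \<otimes>\<^bsub>G\<^esub> h) - ?\<psi> (g' \<otimes>\<^bsub>G\<^esub> h) - ?\<psi> (g \<otimes>\<^bsub>G\<^esub> h') + ?\<psi> (g' \<otimes>\<^bsub>G\<^esub> h'))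
         \<le> C * norm (?\<psi> g - ?\<psi> g') * norm (?\<psi> h - ?\<psi> h')"
      if g: "g \<in> U" "h \<in> U" "g' \<in> U" "h' \<in> U" "norm (?\<psi> g) \<le> R" "norm (?\<psi> h) \<le> R"
        "norm (?\<psi> g') \<le> R" "norm (?\<psi> h') \<le> R" for g h g' h'
      using RC(4)[rule_format, OF ball[OF g(1,5)] ball[OF g(3,7)] ball[OF g(2,6)] ball[OF g(4,8)]]
      unfolding prod(2)[OF g(1,2,5,6)] prod(2)[OF g(3,2,7,6)] prod(2)[OF g(1,4,5,8)] prod(2)[OF g(3,4,7,8)]
      by simp
  qed (use carrier cmult cinv V oU U(2) RC in \<open>auto simp: a_def\<close>)
  then show ?thesis unfolding \<phi>_def by (rule that)
qed

theorem proposition5p2: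
  fixes G :: "('g::{t2_space, second_countable_topology}, 'e::euclidean_space) lie_group_data"
    and M :: "'g measure"
    and T :: "'g set"
    and P :: "('e \<Rightarrow> real) set"
    and \<Lambda> :: "'e \<Rightarrow> real"
    and \<sigma> :: "'g \<Rightarrow> 'h::complex_inner \<Rightarrow> 'h"
    and v\<^sub>\<Lambda> :: 'h
    and L :: "'g set"
    and I :: "'i set"
    and W :: "'i \<Rightarrow> 'k::complex_inner set"
    and \<pi> :: "'i \<Rightarrow> 'g \<Rightarrow> 'k \<Rightarrow> 'k"
    and m :: "'i \<Rightarrow> nat"
    and J :: "'i \<Rightarrow> nat \<Rightarrow> 'k \<Rightarrow> 'h \<Rightarrow> 'h"
    and c :: "'i \<Rightarrow> nat \<Rightarrow> 'k"
    and K :: "('g \<Rightarrow> complex) set"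
  assumes "compact_connected_lie_group G"
    and "normalized_haar G M"
    and "maximal_torus G T"
    and "positive_root_system G T P"
    and "analytically_integral G T \<Lambda>"
    and "dominant G T P \<Lambda>"
    and "irreducible_unitary_rep G (UNIV :: 'h set) \<sigma>"
    and "highest_weight_vector G T P \<sigma> \<Lambda> v\<^sub>\<Lambda>"
    and "norm v\<^sub>\<Lambda> = 1"
    and "L = line_stabilizer \<sigma> v\<^sub>\<Lambda>"
    and "orthogonal_decomposition G \<sigma> I W \<pi> m J"
    and "is_components I W m J (tensor_conj v\<^sub>\<Lambda> v\<^sub>\<Lambda>) c"
    and "K = K_space I W \<pi> m c"
  shows "{f \<in> L2_quotient G M L. toeplitz M \<sigma> v\<^sub>\<Lambda> f = 0} = L2_orthogonal_complement G M L K
       \<and> clinear_on K (toeplitz M \<sigma> v\<^sub>\<Lambda>)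
       \<and> bij_betw (toeplitz M \<sigma> v\<^sub>\<Lambda>) K endomorphisms"
proof -
  note Lie = assms(1)[unfolded compact_connected_lie_group_def]
  obtain U R C a where chart: "group_chart G (model G) U (\<lambda>g. base_chart G g - a) R C"
    by (rule lie_group_chart[OF conjunct1[OF Lie]])
  interpret chart: group_chart G "model G" U "\<lambda>g. base_chart G g - a" R C by (rule chart)
  interpret rep: group_chart_rep G "model G" U "\<lambda>g. base_chart G g - a" R C \<sigma>
    using Lie assms(7) by unfold_locales (auto simp: irreducible_unitary_rep_def)
  have exp_Ad: "lie_exp G X = chart.Exp X" "Ad G g X = chart.Adj g X" if "X \<in> model G" for X g
    using rep.lie_exp_Ad_eq(1)[of a X] rep.lie_exp_Ad_eq(2)[of a X g] that by simp_all
  interpret weight_setting G "model G" U "\<lambda>g. base_chart G g - a" R C \<sigma> M T P \<Lambda> v\<^sub>\<Lambda>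
  proof
    show "\<Lambda> \<in> real_functionals G T" using assms(5) by (simp add: analytically_integral_def)
  qed (fact assms exp_Ad refl)+
  have K: "K = symbols" using K_space_eq_symbols[OF assms(11,12)] assms(13) by simp
  have L: "L = line_stabilizer \<sigma> v\<^sub>\<Lambda>" by (rule assms(10))
  show ?thesis
  proof (intro conjI)
    show "{f \<in> L2_quotient G M L. toeplitz M \<sigma> v\<^sub>\<Lambda> f = 0} = L2_orthogonal_complement G M L K"
      unfolding L2_orthogonal_complement_def K using toeplitz_eq_zero_iff[OF L2_integrable] by blast
    show "clinear_on K (toeplitz M \<sigma> v\<^sub>\<Lambda>)"
      unfolding clinear_on_def K using toeplitz_linear symbol_integrable by blast
    show "bij_betw (toeplitz M \<sigma> v\<^sub>\<Lambda>) K endomorphisms"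
      unfolding K by (rule toeplitz_bij_symbols)
  qed
qed

end
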